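(* Let $\Gamma$ be a finite graph such that $Z(A_\Gamma)=\{1\}$, and let $L=\bigoplus_{i=1}^\infty L_i$ be the graded Lie $\mathbb{Z}$-algebra associated to the lower central series of $A_\Gamma$. Let $p$ and $c$ be positive integers. Then $Z(L)=0$, $Z(L/pL)=0$, and the centre of the quotient Lie algebra $L/\big(\bigoplus_{i=c+1}^\infty L_i\big)$ is the image of $L_c$ in this quotient.
   Context: $\Gamma$ is a finite simple graph; $A_\Gamma$ is the group generated by the vertices of $\Gamma$ with relations $[v,w]=1$ for $v,w$ adjacent. $Z(\cdot)$ denotes the centre of a group or Lie algebra. $[g,h]=ghg^{-1}h^{-1}$. Let $\gamma_1=A_\Gamma$, $\gamma_{c+1}=[\gamma_c,A_\Gamma]$ be the lower central series and $L_c=\gamma_c/\gamma_{c+1}$. $L=\bigoplus_{i\ge1}L_i$ is a Lie algebra over $\mathbb{Z}$ with bracket determined bilinearly by $[g\gamma_{i+1},h\gamma_{j+1}]=[g,h]\gamma_{i+j+1}$ for $g\in\gamma_i,h\in\gamma_j$. $pL=\{px: x\in L\}$ is the ideal of $p$th multiples in $L$, and $\bigoplus_{i\ge c+1}L_i$ is an ideal of $L$. *)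

theory Defs
  imports "HOL-Algebra.Product_Groups" "HOL-Algebra.FiniteProduct" "Graph_Theory.Pair_Digraph"
begin

section \<open>Groups given by generators and relators\<close>

text \<open>A word in the letters of \<open>X\<close> and their formal inverses is a list over
  \<open>X \<times> bool\<close>: the pair \<open>(x, True)\<close> stands for \<open>x\<close> and \<open>(x, False)\<close> for the inverse of \<open>x\<close>.\<close>

type_synonym 'v word = "('v \<times> bool) list"

definition words :: "'v set \<Rightarrow> 'v word set" where
  "words X = lists (X \<times> UNIV)"

inductive_set word_cong :: "'v set \<Rightarrow> 'v word set \<Rightarrow> ('v word \<times> 'v word) set"
  for X :: "'v set" and R :: "'v word set" where
  refl: "w \<in> words X \<Longrightarrow> (w, w) \<in> word_cong X R"
| sym: "(u, w) \<in> word_cong X R \<Longrightarrow> (w, u) \<in> word_cong X R"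
| trans: "(u, v) \<in> word_cong X R \<Longrightarrow> (v, w) \<in> word_cong X R \<Longrightarrow> (u, w) \<in> word_cong X R"
| cancel: "u \<in> words X \<Longrightarrow> w \<in> words X \<Longrightarrow> x \<in> X \<Longrightarrow>
    (u @ [(x, b), (x, \<not> b)] @ w, u @ w) \<in> word_cong X R"
| relator: "u \<in> words X \<Longrightarrow> w \<in> words X \<Longrightarrow> r \<in> R \<inter> words X \<Longrightarrow>
    (u @ r @ w, u @ w) \<in> word_cong X R"

definition presented_group :: "'v set \<Rightarrow> 'v word set \<Rightarrow> 'v word set monoid" where
  "presented_group X R =
    \<lparr>carrier = words X // word_cong X R,
     monoid.mult = (\<lambda>A B. \<Union>a\<in>A. \<Union>b\<in>B. word_cong X R `` {a @ b}),
     one = word_cong X R `` {[]}\<rparr>"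

lemma word_cong_words:
  "(u, w) \<in> word_cong X R \<Longrightarrow> u \<in> words X \<and> w \<in> words X"
  by (induction rule: word_cong.induct) (auto simp: words_def)

lemma equiv_word_cong: "equiv (words X) (word_cong X R)"
proof (rule equivI)
  show "refl_on (words X) (word_cong X R)"
    by (auto simp: refl_on_def intro: word_cong.refl)
  show "sym (word_cong X R)"
    by (rule symI) (rule word_cong.sym)
  show "trans (word_cong X R)"
    by (meson transI word_cong.trans)
qed (use word_cong_words in fast)

lemma word_cong_append_right:
  "(u, w) \<in> word_cong X R \<Longrightarrow> v \<in> words X \<Longrightarrow> (u @ v, w @ v) \<in> word_cong X R"
proof (induction rule: word_cong.induct)
  case (refl w)
  then show ?case by (auto simp: words_def intro: word_cong.refl)
next
  case (cancel u w x b)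
  then have "w @ v \<in> words X" by (auto simp: words_def)
  from word_cong.cancel[OF cancel(1) this cancel(3), of b R] show ?case by simp
next
  case (relator u w r)
  then have "w @ v \<in> words X" by (auto simp: words_def)
  from word_cong.relator[OF relator(1) this relator(3)] show ?case by simp
next
  case (sym u w)
  show ?case using sym.IH[OF sym.prems] by (rule word_cong.sym)
next
  case (trans u u' w)
  show ?case using trans.IH(1)[OF trans.prems] trans.IH(2)[OF trans.prems] by (rule word_cong.trans)
qed

lemma word_cong_append_left:
  "(u, w) \<in> word_cong X R \<Longrightarrow> v \<in> words X \<Longrightarrow> (v @ u, v @ w) \<in> word_cong X R"
proof (induction rule: word_cong.induct)
  case (refl w)
  then show ?case by (auto simp: words_def intro: word_cong.refl)
next
  case (cancel u w x b)
  then have "v @ u \<in> words X" by (auto simp: words_def)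
  from word_cong.cancel[OF this cancel(2,3), of b R] show ?case by simp
next
  case (relator u w r)
  then have "v @ u \<in> words X" by (auto simp: words_def)
  from word_cong.relator[OF this relator(2,3)] show ?case by simp
next
  case (sym u w)
  show ?case using sym.IH[OF sym.prems] by (rule word_cong.sym)
next
  case (trans u u' w)
  show ?case using trans.IH(1)[OF trans.prems] trans.IH(2)[OF trans.prems] by (rule word_cong.trans)
qed

lemma word_cong_append:
  assumes "(u, u') \<in> word_cong X R" "(w, w') \<in> word_cong X R"
  shows "(u @ w, u' @ w') \<in> word_cong X R"
proof (rule word_cong.trans)
  show "(u @ w, u' @ w) \<in> word_cong X R"
    using word_cong_append_right[OF assms(1)] word_cong_words[OF assms(2)] by simp
  show "(u' @ w, u' @ w') \<in> word_cong X R"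
    using word_cong_append_left[OF assms(2)] word_cong_words[OF assms(1)] by simp
qed

lemma presented_group_mult:
  assumes "u \<in> words X" "w \<in> words X"
  shows "word_cong X R `` {u} \<otimes>\<^bsub>presented_group X R\<^esub> word_cong X R `` {w}
           = word_cong X R `` {u @ w}"
proof -
  have "word_cong X R `` {a @ b} = word_cong X R `` {u @ w}"
    if "(u, a) \<in> word_cong X R" "(w, b) \<in> word_cong X R" for a b
    by (rule equiv_class_eq[OF equiv_word_cong word_cong_append[OF that], symmetric])
  moreover have "(u, u) \<in> word_cong X R" "(w, w) \<in> word_cong X R"
    using assms by (simp_all add: word_cong.refl)
  ultimately have "(\<Union>a\<in>word_cong X R `` {u}. \<Union>b\<in>word_cong X R `` {w}. word_cong X R `` {a @ b})
      = word_cong X R `` {u @ w}"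
    by blast
  then show ?thesis by (simp add: presented_group_def)
qed

lemma word_cong_inverse:
  "u \<in> words X \<Longrightarrow> (map (\<lambda>(x, b). (x, \<not> b)) (rev u) @ u, []) \<in> word_cong X R"
proof (induction u)
  case Nil
  then show ?case by (simp add: word_cong.refl)
next
  case (Cons a u)
  obtain x b where a: "a = (x, b)" by (cases a)
  let ?i = "map (\<lambda>(x, b). (x, \<not> b)) (rev u)"
  have u: "u \<in> words X" "x \<in> X" using Cons.prems by (auto simp: words_def a)
  have "?i \<in> words X" using u by (auto simp: words_def)
  from word_cong.cancel[OF this u, of "\<not> b" R]
  have c: "(?i @ [(x, \<not> b), (x, b)] @ u, ?i @ u) \<in> word_cong X R" by simp
  have "(?i @ [(x, \<not> b), (x, b)] @ u, []) \<in> word_cong X R"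
    using c Cons.IH[OF u(1)] by (rule word_cong.trans)
  then show ?case by (simp add: a)
qed

lemma group_presented_group: "group (presented_group X R)"
proof (rule groupI)
  let ?P = "presented_group X R"
  have carr: "\<exists>u\<in>words X. A = word_cong X R `` {u}" if "A \<in> carrier ?P" for A
    using that by (auto simp: presented_group_def elim: quotientE)
  have cls: "word_cong X R `` {u} \<in> carrier ?P" if "u \<in> words X" for u
    using that by (auto simp: presented_group_def intro: quotientI)
  have app: "u @ w \<in> words X" if "u \<in> words X" "w \<in> words X" for u w :: "'a word"
    using that by (auto simp: words_def)
  have nil: "[] \<in> words X" by (simp add: words_def)
  have one: "\<one>\<^bsub>?P\<^esub> = word_cong X R `` {[]}" by (simp add: presented_group_def)
  show "A \<otimes>\<^bsub>?P\<^esub> B \<in> carrier ?P" if "A \<in> carrier ?P" "B \<in> carrier ?P" for A B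
    using carr[OF that(1)] carr[OF that(2)] by (auto simp: presented_group_mult app cls)
  show "\<one>\<^bsub>?P\<^esub> \<in> carrier ?P" by (simp add: one cls nil)
  show "A \<otimes>\<^bsub>?P\<^esub> B \<otimes>\<^bsub>?P\<^esub> C = A \<otimes>\<^bsub>?P\<^esub> (B \<otimes>\<^bsub>?P\<^esub> C)"
    if "A \<in> carrier ?P" "B \<in> carrier ?P" "C \<in> carrier ?P" for A B C
    using carr[OF that(1)] carr[OF that(2)] carr[OF that(3)]
    by (auto simp: presented_group_mult app)
  show "\<one>\<^bsub>?P\<^esub> \<otimes>\<^bsub>?P\<^esub> A = A" if "A \<in> carrier ?P" for A
    using carr[OF that] by (auto simp: one presented_group_mult nil)
  show "\<exists>B\<in>carrier ?P. B \<otimes>\<^bsub>?P\<^esub> A = \<one>\<^bsub>?P\<^esub>" if A: "A \<in> carrier ?P" for A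
  proof -
    obtain u where u: "u \<in> words X" "A = word_cong X R `` {u}" using carr[OF A] by blast
    let ?i = "map (\<lambda>(x, b). (x, \<not> b)) (rev u)"
    have i: "?i \<in> words X" using u(1) by (auto simp: words_def)
    have "word_cong X R `` {?i} \<otimes>\<^bsub>?P\<^esub> A = \<one>\<^bsub>?P\<^esub>"
      using equiv_class_eq[OF equiv_word_cong word_cong_inverse[OF u(1)]]
      by (simp add: u(2) presented_group_mult[OF i u(1)] one)
    then show ?thesis using cls[OF i] by blast
  qed
qed


section \<open>The group of a graph\<close>

text \<open>The locale \<^locale>\<open>pair_graph\<close> describes finite simple graphs: a finite vertex set
  with a symmetric irreflexive adjacency relation \<^const>\<open>parcs\<close>.\<close>

definition raag :: "'v pair_pre_digraph \<Rightarrow> 'v word set monoid" where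
  "raag \<Gamma> = presented_group (pverts \<Gamma>)
     {[(v, True), (w, True), (v, False), (w, False)] | v w. (v, w) \<in> parcs \<Gamma>}"

definition group_centre :: "('a, 'b) monoid_scheme \<Rightarrow> 'a set" where
  "group_centre G = {x \<in> carrier G. \<forall>y\<in>carrier G. x \<otimes>\<^bsub>G\<^esub> y = y \<otimes>\<^bsub>G\<^esub> x}"


section \<open>Lie rings\<close>

text \<open>The underlying abelian group of a Lie algebra over the integers is written in the
  multiplicative notation of \<^typ>\<open>'a monoid\<close>, like the library's \<^const>\<open>sum_group\<close> and
  \<^const>\<open>FactGroup\<close>: the sum is \<open>\<otimes>\<close>, zero is \<open>\<one>\<close>, and the multiple \<open>n x\<close> is \<open>x [^] n\<close>.\<close>

record 'a lie_ring = "'a monoid" +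
  bracket :: "'a \<Rightarrow> 'a \<Rightarrow> 'a"

definition lie_centre :: "('a, 'b) lie_ring_scheme \<Rightarrow> 'a set" where
  "lie_centre L = {x \<in> carrier L. \<forall>y\<in>carrier L. bracket L x y = \<one>\<^bsub>L\<^esub>}"

text \<open>For an ideal \<open>I\<close> the cosets in the union below coincide.\<close>

definition lie_quotient :: "('a, 'b) lie_ring_scheme \<Rightarrow> 'a set \<Rightarrow> 'a set lie_ring" where
  "lie_quotient L I = monoid.extend (L Mod I)
     (lie_ring.fields (\<lambda>A B. \<Union>a\<in>A. \<Union>b\<in>B. I #>\<^bsub>L\<^esub> bracket L a b))"

definition multiples :: "nat \<Rightarrow> ('a, 'b) monoid_scheme \<Rightarrow> 'a set" where
  "multiples p L = {x [^]\<^bsub>L\<^esub> p | x. x \<in> carrier L}"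


section \<open>The Lie ring of the lower central series\<close>

definition commutator :: "('a, 'b) monoid_scheme \<Rightarrow> 'a \<Rightarrow> 'a \<Rightarrow> 'a" where
  "commutator G g h = g \<otimes>\<^bsub>G\<^esub> h \<otimes>\<^bsub>G\<^esub> inv\<^bsub>G\<^esub> g \<otimes>\<^bsub>G\<^esub> inv\<^bsub>G\<^esub> h"

definition commutator_subgroup :: "('a, 'b) monoid_scheme \<Rightarrow> 'a set \<Rightarrow> 'a set \<Rightarrow> 'a set" where
  "commutator_subgroup G H K = generate G {commutator G h k | h k. h \<in> H \<and> k \<in> K}"

text \<open>The lower central series starts at index 1; the value at index 0 is never used.\<close>

fun lower_central :: "('a, 'b) monoid_scheme \<Rightarrow> nat \<Rightarrow> 'a set" where
  "lower_central G 0 = carrier G"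
| "lower_central G (Suc 0) = carrier G"
| "lower_central G (Suc (Suc n)) =
     commutator_subgroup G (lower_central G (Suc n)) (carrier G)"

definition lcs_factor :: "('a, 'b) monoid_scheme \<Rightarrow> nat \<Rightarrow> 'a set monoid" where
  "lcs_factor G i = G\<lparr>carrier := lower_central G i\<rparr> Mod lower_central G (i + 1)"

text \<open>The pairing of the factors \<open>i\<close> and \<open>j\<close> into the factor \<open>i + j\<close> induced by the group
  commutator; the cosets in the union coincide.\<close>

definition factor_bracket ::
    "('a, 'b) monoid_scheme \<Rightarrow> nat \<Rightarrow> nat \<Rightarrow> 'a set \<Rightarrow> 'a set \<Rightarrow> 'a set" where
  "factor_bracket G i j A B =
     (\<Union>g\<in>A. \<Union>h\<in>B. lower_central G (i + j + 1) #>\<^bsub>G\<^esub> commutator G g h)"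

text \<open>In degree \<open>n\<close> the bilinear extension of the pairings is the sum of the brackets of the
  components of degrees \<open>i\<close> and \<open>n - i\<close>.\<close>

definition lcs_lie_ring :: "('a, 'b) monoid_scheme \<Rightarrow> (nat \<Rightarrow> 'a set) lie_ring" where
  "lcs_lie_ring G = monoid.extend (sum_group {1..} (lcs_factor G))
     (lie_ring.fields (\<lambda>x y. \<lambda>n\<in>{1..}.
        \<Otimes>\<^bsub>lcs_factor G n\<^esub>i\<in>{1..<n}. factor_bracket G i (n - i) (x i) (y (n - i))))"

definition lcs_degree :: "('a, 'b) monoid_scheme \<Rightarrow> nat \<Rightarrow> (nat \<Rightarrow> 'a set) set" where
  "lcs_degree G c =
     {x \<in> carrier (lcs_lie_ring G). \<forall>i\<ge>1. i \<noteq> c \<longrightarrow> x i = \<one>\<^bsub>lcs_factor G i\<^esub>}"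

definition lcs_degree_ge :: "('a, 'b) monoid_scheme \<Rightarrow> nat \<Rightarrow> (nat \<Rightarrow> 'a set) set" where
  "lcs_degree_ge G c =
     {x \<in> carrier (lcs_lie_ring G). \<forall>i\<ge>1. i < c \<longrightarrow> x i = \<one>\<^bsub>lcs_factor G i\<^esub>}"

end

theory Submission
  imports Defs "HOL-Library.List_Lexorder"
begin

text \<open>A homogeneous element of degree \<open>n\<close> is central (modulo \<open>p\<close>, where \<open>p = 0\<close> is allowed) as
  soon as its brackets with the generators vanish (modulo \<open>p\<close>), so the theorem comes down to the
  following claim about \<open>g \<in> \<gamma>\<^sub>n\<close>: if \<open>[g, v] \<in> \<gamma>\<^bsub>n+1\<^esub>\<^sup>p \<gamma>\<^bsub>n+2\<^esub>\<close> for all vertices \<open>v\<close>, then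
  \<open>g \<in> \<gamma>\<^sub>n\<^sup>p \<gamma>\<^bsub>n+1\<^esub>\<close>.

  The Magnus expansion \<open>v \<mapsto> 1 + v\<close> maps the group to the power series over the trace monoid, and
  the degree \<open>n\<close> part \<open>f\<close> of the expansion of \<open>g\<close> satisfies \<open>f w \<equiv> w f\<close> modulo \<open>p\<close> for every vertex
  \<open>w\<close>. If a trace \<open>t\<close> with first letter \<open>v\<close> had a nonzero coefficient in \<open>f\<close>, choose \<open>w \<noteq> v\<close> not
  adjacent to \<open>v\<close>, which exists as the centre of the group is trivial: then \<open>t w\<close> cannot start with
  \<open>w\<close>, a contradiction. Hence \<open>p\<close> divides \<open>f\<close>.

  It remains to see that \<open>g\<close> is a \<open>p\<close>-th power modulo \<open>\<gamma>\<^bsub>n+1\<^esub>\<close> if \<open>p\<close> divides \<open>f\<close>. The commutators of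
  Lyndon words of length \<open>n\<close>, bracketed by the standard factorisation, span \<open>\<gamma>\<^sub>n\<close> modulo \<open>\<gamma>\<^bsub>n+1\<^esub>\<close>, and
  their expansions have the form \<open>w\<close> plus larger words. Those whose word is the largest of its
  trace are therefore independent modulo every \<open>p\<close>. They suffice for spanning: for any other
  Lyndon word \<open>w\<close> there is an iterated commutator with the same leading word that is trivial in the
  group, and expanding it in the free group writes the commutator of \<open>w\<close> in terms of those of larger
  words.\<close>

section \<open>Lyndon words\<close>

text \<open>Divisibility of the expansion says something about \<open>g\<close> only if the image of
  \<open>L_n\<close> in the series is a pure subgroup. Normal Lyndon words, those greatest in their
  trace, secure this: the matrix of the coefficients of their commutators at these words is
  unitriangular, so it stays invertible modulo every \<open>p\<close>. The two conventions are
  deliberately opposite: a leading word is the least in the support, a normal word the greatest in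
  its trace, so no other word of the same trace can contribute to the coefficient. All Lyndon
  commutators together are too many: for adjacent letters \<open>a < b\<close> the word
  \<open>ab\<close> is Lyndon, but its commutator is trivial and the greatest word of its trace is
  \<open>ba\<close>. In the free group every word is its own trace, so exponents can be read off
  coefficients there and relations extracted. Allowing \<open>p = 0\<close>, where divisibility
  means vanishing, makes one claim serve all three centres. In the quotient by the degrees above
  \<open>c\<close> it applies only to components of degree below \<open>c\<close>, because brackets
  with elements of degree \<open>c\<close> already lie in the ideal; this is why \<open>L_c\<close>
  survives.\<close>

lemma less_append_prefix: "x @ u < x @ v \<longleftrightarrow> u < (v :: 'a::linorder list)"
  by (induction x) auto

text \<open>The two words already differ at a position inside both, so the comparison ignores
  whatever is appended.\<close>

lemma less_append_right:
  fixes u v :: "'a::linorder list"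
  assumes "u < v" "\<nexists>z. v = u @ z"
  shows "u @ x < v @ y"
  using assms
proof (induction u arbitrary: v)
  case Nil
  then show ?case by simp
next
  case (Cons a u)
  then show ?case by (cases v) auto
qed

lemma less_appendI: "v \<noteq> [] \<Longrightarrow> (u :: 'a::linorder list) < u @ v"
  using less_append_prefix[of u "[]" v] by (cases v) auto

text \<open>Characterisation by proper suffixes, equivalent to the word being strictly smaller than
  all its nontrivial rotations.\<close>

definition lyndon :: "'a::linorder list \<Rightarrow> bool" where
  "lyndon w \<longleftrightarrow> w \<noteq> [] \<and> (\<forall>u v. w = u @ v \<longrightarrow> u \<noteq> [] \<longrightarrow> v \<noteq> [] \<longrightarrow> w < v)"

lemma lyndon_not_Nil: "lyndon w \<Longrightarrow> w \<noteq> []"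
  by (simp add: lyndon_def)

lemma lyndonD: "lyndon (u @ v) \<Longrightarrow> u \<noteq> [] \<Longrightarrow> v \<noteq> [] \<Longrightarrow> u @ v < v"
  by (auto simp: lyndon_def)

lemma lyndon_letter: "lyndon [a]"
  by (auto simp: lyndon_def append_eq_Cons_conv Cons_eq_append_conv)

text \<open>If \<open>v = u @ z\<close>, cancelling the prefix \<open>u\<close> turns the claim into
  \<open>v < z\<close>, an instance of the Lyndon property of \<open>v\<close>; otherwise the words
  differ before \<open>u\<close> ends.\<close>

lemma lyndon_append_less:
  assumes "lyndon v" "u < v" "u \<noteq> []"
  shows "u @ v < v"
proof (cases "\<exists>z. v = u @ z")
  case True
  then obtain z where z: "v = u @ z" by blast
  with assms have "z \<noteq> []" by auto
  then have "v < z" using lyndonD[of u z] assms z by simp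
  then show ?thesis using z less_append_prefix[of u v z] by simp
next
  case False
  then show ?thesis using less_append_right[OF assms(2), of v "[]"] by simp
qed

lemma lyndon_append_swap:
  assumes "lyndon u" "lyndon v" "u < v"
  shows "u @ v < v @ u"
proof -
  have "u @ v < v" using lyndon_append_less assms lyndon_not_Nil by blast
  also have "v < v @ u" using assms(1) by (simp add: less_appendI lyndon_not_Nil)
  finally show ?thesis .
qed

text \<open>A proper suffix that starts inside \<open>u\<close> is \<open>z @ v\<close> with
  \<open>u < z\<close>, and \<open>u\<close> is not a prefix of the shorter \<open>z\<close>; any
  other is \<open>v\<close> or a suffix of it, hence at least \<open>v\<close>, which exceeds
  \<open>u @ v\<close>.\<close>

lemma lyndon_append:
  assumes "lyndon u" "lyndon v" "u < v"
  shows "lyndon (u @ v)"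
  unfolding lyndon_def
proof (intro conjI allI impI)
  show "u @ v \<noteq> []" using assms lyndon_not_Nil by auto
  fix x y assume xy: "u @ v = x @ y" "x \<noteq> []" "y \<noteq> []"
  have uv: "u @ v < v" using assms lyndon_append_less lyndon_not_Nil by blast
  show "u @ v < y"
  proof (cases "length x < length u")
    case True
    then obtain z where z: "u = x @ z" "y = z @ v" "z \<noteq> []"
      using xy by (auto simp: append_eq_append_conv2)
    have "u < z" using lyndonD[of x z] assms z xy by simp
    moreover have "\<nexists>t. z = u @ t" using z xy
      by (metis append_eq_append_conv_if append_self_conv2 length_append le_add2 length_0_conv append_eq_conv_conj drop_all)
    ultimately show ?thesis unfolding z(2) by (rule less_append_right)
  next
    case False
    then obtain z where z: "v = z @ y" using xy by (auto simp: append_eq_append_conv2)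
    show ?thesis
    proof (cases "z = []")
      case True
      then show ?thesis using uv z by simp
    next
      case False
      then have "v < y" using lyndonD[of z y] assms z xy by simp
      then show ?thesis using uv by simp
    qed
  qed
qed

section \<open>The standard factorisation\<close>

text \<open>The least proper nonempty suffix is also the longest proper Lyndon suffix, so this gives
  the usual standard factorisation. The minimum makes sense only from length 2 on.\<close>

definition rfactor :: "'a::linorder list \<Rightarrow> 'a list" where
  "rfactor w = Min {v. \<exists>u. w = u @ v \<and> u \<noteq> [] \<and> v \<noteq> []}"

definition lfactor :: "'a::linorder list \<Rightarrow> 'a list" where
  "lfactor w = take (length w - length (rfactor w)) w"

lemma finite_suffixes: "finite {v. \<exists>u. w = u @ v \<and> P u v}"
proof (rule finite_subset)
  show "{v. \<exists>u. w = u @ v \<and> P u v} \<subseteq> (\<lambda>n. drop n w) ` {..length w}"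
  proof
    fix v assume "v \<in> {v. \<exists>u. w = u @ v \<and> P u v}"
    then obtain u where "w = u @ v" by blast
    then show "v \<in> (\<lambda>n. drop n w) ` {..length w}"
      by (intro image_eqI[of _ _ "length u"]) auto
  qed
qed simp

lemma rfactor_le: "w = u @ v \<Longrightarrow> u \<noteq> [] \<Longrightarrow> v \<noteq> [] \<Longrightarrow> rfactor w \<le> v"
  unfolding rfactor_def by (rule Min_le[OF finite_suffixes]) auto

lemma factorisation:
  assumes "length w \<ge> 2"
  shows "w = lfactor w @ rfactor w" "lfactor w \<noteq> []" "rfactor w \<noteq> []"
proof -
  have "w = [hd w] @ tl w \<and> [hd w] \<noteq> [] \<and> tl w \<noteq> []"
    using assms by (cases w; cases "tl w") auto
  then have "{v. \<exists>u. w = u @ v \<and> u \<noteq> [] \<and> v \<noteq> []} \<noteq> {}" by blast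
  from Min_in[OF finite_suffixes this] obtain u
    where "w = u @ rfactor w" "u \<noteq> []" "rfactor w \<noteq> []"
    unfolding rfactor_def by blast
  moreover from this have "lfactor w = u"
    unfolding lfactor_def
    by (metis append_eq_conv_conj add_diff_cancel_right' length_append)
  ultimately show "w = lfactor w @ rfactor w" "lfactor w \<noteq> []" "rfactor w \<noteq> []" by auto
qed

lemma length_factors:
  assumes "length w \<ge> 2"
  shows "length (lfactor w) < length w" "length (rfactor w) < length w"
    "length (lfactor w) + length (rfactor w) = length w"
proof -
  have "length w = length (lfactor w) + length (rfactor w)"
    using factorisation(1)[OF assms] by (metis length_append)
  moreover have "length (lfactor w) > 0" "length (rfactor w) > 0"
    using factorisation(2,3)[OF assms] by auto
  ultimately show "length (lfactor w) < length w" "length (rfactor w) < length w"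
    "length (lfactor w) + length (rfactor w) = length w" by linarith+
qed

lemma lyndon_rfactor:
  assumes "length w \<ge> 2"
  shows "lyndon (rfactor w)"
  unfolding lyndon_def
proof (intro conjI allI impI)
  show "rfactor w \<noteq> []" using factorisation[OF assms] by simp
  fix x y assume xy: "rfactor w = x @ y" "x \<noteq> []" "y \<noteq> []"
  then have "rfactor w \<le> y"
    using rfactor_le[of w "lfactor w @ x" y] factorisation[OF assms] by simp
  moreover have "rfactor w \<noteq> y" using xy by simp
  ultimately show "rfactor w < y" by simp
qed

text \<open>Suppose a proper suffix \<open>y\<close> of the left factor \<open>u\<close> is below
  \<open>u\<close>. As \<open>w\<close> is Lyndon, \<open>u @ v < y @ v\<close>, which forces
  \<open>u = y @ z\<close>; cancelling \<open>y\<close> gives \<open>z @ v < v\<close>, although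
  \<open>v\<close> is the least proper suffix of \<open>w\<close>.\<close>

lemma lyndon_lfactor:
  assumes "lyndon w" "length w \<ge> 2"
  shows "lyndon (lfactor w)"
  unfolding lyndon_def
proof (intro conjI allI impI)
  let ?u = "lfactor w" and ?v = "rfactor w"
  note fac = factorisation[OF assms(2)]
  show "?u \<noteq> []" by (rule fac)
  fix x y assume xy: "?u = x @ y" "x \<noteq> []" "y \<noteq> []"
  then have w: "w = x @ (y @ ?v)" using fac by simp
  then have less: "?u @ ?v < y @ ?v" using lyndonD[of x "y @ ?v"] xy fac assms(1) by simp
  show "?u < y"
  proof (rule ccontr)
    assume "\<not> ?u < y"
    moreover have "?u \<noteq> y" using xy by simp
    ultimately have yu: "y < ?u" by simp
    show False
    proof (cases "\<exists>z. ?u = y @ z")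
      case True
      then obtain z where z: "?u = y @ z" by blast
      have "z \<noteq> []" using \<open>?u \<noteq> y\<close> z by auto
      have "w = y @ (z @ ?v)" using fac z by simp
      then have "?v \<le> z @ ?v" using rfactor_le[of w y "z @ ?v"] xy \<open>z \<noteq> []\<close> by auto
      moreover have "y @ (z @ ?v) < y @ ?v" using less z by simp
      ultimately show False by (simp only: less_append_prefix)
    next
      case False
      then show False using less_append_right[OF yu, of ?v ?v] less by simp
    qed
  qed
qed

lemma lfactor_less_rfactor:
  assumes "lyndon w" "length w \<ge> 2"
  shows "lfactor w < rfactor w"
proof -
  note fac = factorisation[OF assms(2)]
  have "lfactor w < w" using less_appendI[of "rfactor w" "lfactor w"] fac by simp
  also have "w < rfactor w" using lyndonD[of "lfactor w" "rfactor w"] fac assms by simp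
  finally show ?thesis .
qed

text \<open>Every proper suffix starting inside \<open>u\<close> has the form \<open>z @ v\<close>
  with \<open>z\<close> at least \<open>rfactor u\<close>, hence at least \<open>v\<close>, so
  \<open>v\<close> stays the least one. The condition thus tells when \<open>[u, v]\<close> is
  already a standard bracket.\<close>

lemma factors_append:
  assumes "lyndon u" "lyndon v" "length u \<ge> 2 \<Longrightarrow> v \<le> rfactor u"
  shows "rfactor (u @ v) = v" "lfactor (u @ v) = u"
proof -
  have ne: "u \<noteq> []" "v \<noteq> []" using assms lyndon_not_Nil by auto
  have "v \<le> y" if xy: "u @ v = x @ y" "x \<noteq> []" "y \<noteq> []" for x y
  proof (cases "length x < length u")
    case True
    then obtain z where z: "u = x @ z" "y = z @ v" "z \<noteq> []"
      using xy by (auto simp: append_eq_append_conv2)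
    have "length u \<ge> 2" using z xy by (cases x; cases z) auto
    then have "v \<le> z" using assms(3) rfactor_le[of u x z] z xy by auto
    also have "z < y" using z ne less_appendI by simp
    finally show ?thesis by simp
  next
    case False
    then obtain z where z: "v = z @ y" using xy by (auto simp: append_eq_append_conv2)
    then show ?thesis
      using lyndonD[of z y] assms xy by (cases "z = []") auto
  qed
  then show r: "rfactor (u @ v) = v"
    unfolding rfactor_def using ne by (intro Min_eqI[OF finite_suffixes]) auto
  show "lfactor (u @ v) = u" by (simp add: lfactor_def r)
qed

section \<open>Bracketings and their evaluation\<close>

datatype 'a lie_word = Letter 'a | Brack "'a lie_word" "'a lie_word"

primrec degree :: "'a lie_word \<Rightarrow> nat" where
  "degree (Letter a) = 1"
| "degree (Brack s t) = degree s + degree t"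

primrec letters :: "'a lie_word \<Rightarrow> 'a set" where
  "letters (Letter a) = {a}"
| "letters (Brack s t) = letters s \<union> letters t"

text \<open>The same bracketing is evaluated with group commutators and with
  \<open>f * g - g * f\<close>; the second value represents the lowest-order part of the expansion
  of the first minus 1.\<close>

primrec lie_eval :: "('b \<Rightarrow> 'b \<Rightarrow> 'b) \<Rightarrow> ('a \<Rightarrow> 'b) \<Rightarrow> 'a lie_word \<Rightarrow> 'b" where
  "lie_eval br e (Letter a) = e a"
| "lie_eval br e (Brack s t) = br (lie_eval br e s) (lie_eval br e t)"

lemma degree_pos: "degree t > 0"
  by (induction t) auto

text \<open>For the empty word the value is the arbitrary \<open>Letter (hd [])\<close>, which is
  why the facts about it speak of nonempty words.\<close>

function lyndon_brack :: "'a::linorder list \<Rightarrow> 'a lie_word" where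
  "lyndon_brack w = (if length w \<ge> 2
     then Brack (lyndon_brack (lfactor w)) (lyndon_brack (rfactor w)) else Letter (hd w))"
  by auto
termination
  by (relation "measure length") (auto simp: length_factors)

declare lyndon_brack.simps [simp del]

lemma lyndon_brack_letter: "lyndon_brack [a] = Letter a"
  by (simp add: lyndon_brack.simps)

lemma degree_lyndon_brack: "w \<noteq> [] \<Longrightarrow> degree (lyndon_brack w) = length w"
proof (induction w rule: lyndon_brack.induct)
  case (1 w)
  show ?case
  proof (cases "length w \<ge> 2")
    case True
    then show ?thesis
      using 1 factorisation[OF True] length_factors[OF True] by (simp add: lyndon_brack.simps[of w])
  next
    case False
    then have "length w = 1" using "1.prems" by (cases w; cases "tl w") auto
    with False show ?thesis by (simp add: lyndon_brack.simps[of w])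
  qed
qed

lemma letters_lyndon_brack: "w \<noteq> [] \<Longrightarrow> letters (lyndon_brack w) = set w"
proof (induction w rule: lyndon_brack.induct)
  case (1 w)
  show ?case
  proof (cases "length w \<ge> 2")
    case True
    have "set w = set (lfactor w) \<union> set (rfactor w)"
      using factorisation(1)[OF True] by (metis set_append)
    then show ?thesis
      using 1 True factorisation[OF True] by (simp add: lyndon_brack.simps[of w])
  next
    case False
    then obtain a where "w = [a]" using "1.prems" by (cases w; cases "tl w") auto
    then show ?thesis by (simp add: lyndon_brack_letter)
  qed
qed

section \<open>The lower central series\<close>

context group
begin

section \<open>Commutator identities\<close>

lemma inv_mult_cancel:
  assumes "x \<in> carrier G" "y \<in> carrier G"
  shows "inv x \<otimes> (x \<otimes> y) = y" "x \<otimes> (inv x \<otimes> y) = y"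
  using assms by (simp_all flip: m_assoc)

lemmas group_normalise = m_assoc inv_mult_group inv_mult_cancel

lemma commutator_closed [simp]:
  "x \<in> carrier G \<Longrightarrow> y \<in> carrier G \<Longrightarrow> commutator G x y \<in> carrier G"
  by (simp add: commutator_def)

lemma commutator_self: "x \<in> carrier G \<Longrightarrow> commutator G x x = \<one>"
  by (simp add: commutator_def group_normalise)

lemma commutator_one:
  "x \<in> carrier G \<Longrightarrow> commutator G x \<one> = \<one>" "x \<in> carrier G \<Longrightarrow> commutator G \<one> x = \<one>"
  by (simp_all add: commutator_def)

lemma inv_commutator:
  "x \<in> carrier G \<Longrightarrow> y \<in> carrier G \<Longrightarrow> inv (commutator G x y) = commutator G y x"
  by (simp add: commutator_def group_normalise)

lemma commutator_eq_one_iff: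
  assumes "x \<in> carrier G" "y \<in> carrier G"
  shows "commutator G x y = \<one> \<longleftrightarrow> x \<otimes> y = y \<otimes> x"
proof -
  have "commutator G x y \<otimes> (y \<otimes> x) = x \<otimes> y"
    using assms by (simp add: commutator_def group_normalise)
  moreover have "commutator G x y \<otimes> (y \<otimes> x) = y \<otimes> x \<longleftrightarrow> commutator G x y = \<one>"
    using assms by (simp add: l_cancel_one)
  ultimately show ?thesis by metis
qed

lemma commutator_mult_right:
  assumes "x \<in> carrier G" "y \<in> carrier G" "z \<in> carrier G"
  shows "commutator G x (y \<otimes> z) = commutator G x y \<otimes> (y \<otimes> commutator G x z \<otimes> inv y)"
  using assms by (simp add: commutator_def group_normalise)

text \<open>The conjugations belong to the convention \<open>g h g^-1 h^-1\<close>; modulo deeper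
  terms of the lower central series they disappear and the Jacobi identity remains.\<close>

lemma hall_witt:
  assumes "x \<in> carrier G" "y \<in> carrier G" "z \<in> carrier G"
  shows "commutator G (commutator G x y) (y \<otimes> z \<otimes> inv y)
    \<otimes> commutator G (commutator G y z) (z \<otimes> x \<otimes> inv z)
    \<otimes> commutator G (commutator G z x) (x \<otimes> y \<otimes> inv x) = \<one>"
  using assms by (simp add: commutator_def group_normalise)

lemma conj_commutator:
  assumes "x \<in> carrier G" "y \<in> carrier G" "z \<in> carrier G"
  shows "z \<otimes> commutator G x y \<otimes> inv z
    = commutator G (z \<otimes> x \<otimes> inv z) (z \<otimes> y \<otimes> inv z)"
  using assms by (simp add: commutator_def group_normalise)

lemma commutator_in_commutator_subgroup:
  "h \<in> H \<Longrightarrow> k \<in> K \<Longrightarrow> commutator G h k \<in> commutator_subgroup G H K"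
  unfolding commutator_subgroup_def by (rule generate.incl) auto

lemma commutator_subgroup_subset:
  assumes "subgroup N G" "\<And>h k. h \<in> H \<Longrightarrow> k \<in> K \<Longrightarrow> commutator G h k \<in> N"
  shows "commutator_subgroup G H K \<subseteq> N"
  unfolding commutator_subgroup_def by (rule generate_subgroup_incl[OF _ assms(1)]) (auto simp: assms(2))

lemma normal_commutator_subgroup:
  assumes "H \<lhd> G" "K \<lhd> G"
  shows "commutator_subgroup G H K \<lhd> G"
  unfolding commutator_subgroup_def
proof (rule normal_generateI)
  have HK: "H \<subseteq> carrier G" "K \<subseteq> carrier G"
    using assms by (auto dest: normal_imp_subgroup subgroup.subset)
  then show "{commutator G h k |h k. h \<in> H \<and> k \<in> K} \<subseteq> carrier G" by (auto simp: subset_iff)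
  fix c g assume "c \<in> {commutator G h k |h k. h \<in> H \<and> k \<in> K}" and g: "g \<in> carrier G"
  then obtain h k where c: "c = commutator G h k" "h \<in> H" "k \<in> K" by blast
  have "g \<otimes> h \<otimes> inv g \<in> H" "g \<otimes> k \<otimes> inv g \<in> K"
    using assms c g by (auto intro: normal.inv_op_closed2)
  moreover have "g \<otimes> c \<otimes> inv g = commutator G (g \<otimes> h \<otimes> inv g) (g \<otimes> k \<otimes> inv g)"
    using c g HK by (simp add: conj_commutator subset_iff)
  ultimately show "g \<otimes> c \<otimes> inv g \<in> {commutator G h k |h k. h \<in> H \<and> k \<in> K}" by blast
qed

section \<open>Strong centrality of the lower central series\<close>

lemma normal_lower_central: "lower_central G n \<lhd> G"
proof (induction n rule: induct_nat_012)
  case (ge2 n)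
  then show ?case by (simp add: normal_commutator_subgroup normal_self)
qed (simp_all add: normal_self)

lemma subgroup_lower_central: "subgroup (lower_central G n) G"
  by (rule normal_imp_subgroup[OF normal_lower_central])

lemma lower_central_subset: "lower_central G n \<subseteq> carrier G"
  by (rule subgroup.subset[OF subgroup_lower_central])

lemma lower_central_closed: "x \<in> lower_central G n \<Longrightarrow> x \<in> carrier G"
  using lower_central_subset by blast

lemma conj_in_normal:
  assumes "N \<lhd> G" "x \<in> N" "g \<in> carrier G"
  shows "g \<otimes> x \<otimes> inv g \<in> N"
  using normal.inv_op_closed2[OF assms(1,3,2)] .

lemma commutator_in_normal:
  assumes "N \<lhd> G" "g \<in> carrier G" "x \<in> N"
  shows "commutator G g x \<in> N" "commutator G x g \<in> N"
proof -
  interpret N: normal N G by (rule assms(1))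
  have x: "x \<in> carrier G" using assms(3) by (rule N.mem_carrier)
  have "commutator G g x = (g \<otimes> x \<otimes> inv g) \<otimes> inv x"
    using x assms by (simp add: commutator_def m_assoc)
  then show "commutator G g x \<in> N" using assms N.inv_op_closed2 by simp
  then show "commutator G x g \<in> N"
    using inv_commutator[OF assms(2) x] N.m_inv_closed by fastforce
qed

lemma lower_central_Suc_subset: "lower_central G (Suc n) \<subseteq> lower_central G n"
proof (cases n)
  case (Suc m)
  show ?thesis unfolding Suc lower_central.simps
    by (rule commutator_subgroup_subset[OF subgroup_lower_central])
      (auto intro: commutator_in_normal[OF normal_lower_central])
qed (simp add: lower_central_subset)

lemma lower_central_antimono: "m \<le> n \<Longrightarrow> lower_central G n \<subseteq> lower_central G m"
  by (induction n rule: dec_induct) (use lower_central_Suc_subset in blast)+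

lemma commutator_normal_mult_right:
  assumes N: "N \<lhd> G" and "x \<in> carrier G" "y \<in> carrier G" "z \<in> carrier G"
    and "commutator G x y \<in> N" "commutator G x z \<in> N"
  shows "commutator G x (y \<otimes> z) \<in> N"
  using assms normal.axioms(1)[OF N]
  by (auto simp: commutator_mult_right intro!: subgroup.m_closed conj_in_normal)

lemma commutator_normal_inv_right:
  assumes N: "N \<lhd> G" and "x \<in> carrier G" "y \<in> carrier G" "commutator G x y \<in> N"
  shows "commutator G x (inv y) \<in> N"
proof -
  have eq: "commutator G x (inv y) = inv y \<otimes> inv (commutator G x y) \<otimes> inv (inv y)"
    using assms by (simp add: commutator_def group_normalise)
  show ?thesis unfolding eq
    using assms normal.axioms(1)[OF N]
    by (intro conj_in_normal[OF N] subgroup.m_inv_closed[of N]) auto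
qed

text \<open>The elements that commute with \<open>g\<close> modulo the normal subgroup
  \<open>N\<close> form a subgroup.\<close>

lemma commutator_generate_right:
  assumes N: "N \<lhd> G" and g: "g \<in> carrier G" and S: "S \<subseteq> carrier G"
    and "\<And>s. s \<in> S \<Longrightarrow> commutator G g s \<in> N" and h: "h \<in> generate G S"
  shows "commutator G g h \<in> N"
  using h
proof (induction rule: generate.induct)
  case one
  then show ?case
    using g N by (auto simp: commutator_one normal.axioms(1) subgroup.one_closed)
next
  case (incl h)
  then show ?case by (rule assms(4))
next
  case (inv h)
  then show ?case using assms by (intro commutator_normal_inv_right) auto
next
  case (eng h1 h2)
  then show ?case
    using assms generate_in_carrier[OF S] by (intro commutator_normal_mult_right) auto
qed

text \<open>The three subgroups argument, by induction on \<open>j\<close>: Hall-Witt expresses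
  \<open>[g, [x, y]]\<close> by two commutators whose inner parts lie in
  \<open>\<gamma>_(i+1)\<close> and \<open>\<gamma>_(i+j)\<close>. The first of them raises
  \<open>i\<close>, so \<open>i\<close> varies in the induction.\<close>

lemma commutator_lower_central:
  assumes "g \<in> lower_central G i" "h \<in> lower_central G j" "i \<ge> 1" "j \<ge> 1"
  shows "commutator G g h \<in> lower_central G (i + j)"
  using assms
proof (induction j arbitrary: i g h)
  case 0
  then show ?case by simp
next
  case (Suc j)
  show ?case
  proof (cases j)
    case 0
    with Suc.prems have "commutator G g h \<in> lower_central G (Suc i)"
      by (cases i) (auto intro: commutator_in_commutator_subgroup lower_central_closed)
    then show ?thesis using 0 by simp
  next
    case (Suc j')
    let ?S = "{commutator G h k |h k. h \<in> lower_central G j \<and> k \<in> carrier G}"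
    let ?N = "lower_central G (i + Suc j)"
    have N: "?N \<lhd> G" "subgroup ?N G"
      by (rule normal_lower_central subgroup_lower_central)+
    have g: "g \<in> carrier G" using Suc.prems lower_central_closed by blast
    have "commutator G g s \<in> ?N" if "s \<in> ?S" for s
    proof -
      from that obtain x y where s: "s = commutator G x y" "x \<in> lower_central G j" "y \<in> carrier G"
        by blast
      have x: "x \<in> carrier G" using s lower_central_closed by blast
      \<comment> \<open>Chosen so that the conjugate \<open>y z y^-1\<close> in Hall-Witt is
        \<open>g\<close> itself.\<close>
      define z where "z = inv y \<otimes> g \<otimes> y"
      have z: "z \<in> lower_central G i" "z \<in> carrier G"
        using conj_in_normal[OF normal_lower_central Suc.prems(1), of "inv y"] s g
        by (simp_all add: z_def)
      have g_eq: "g = y \<otimes> z \<otimes> inv y"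
        using g s by (simp add: z_def group_normalise)
      have comm_z: "commutator G z u \<in> lower_central G (Suc i)" if "u \<in> carrier G" for u
        using that z Suc.prems
        by (cases i) (auto intro: commutator_in_commutator_subgroup)
      have "commutator G y z \<in> lower_central G (Suc i)"
        using comm_z[of y] s z inv_commutator[of z y] subgroup.m_inv_closed[OF subgroup_lower_central]
        by metis
      moreover have "z \<otimes> x \<otimes> inv z \<in> lower_central G j"
        using conj_in_normal[OF normal_lower_central] s z by blast
      ultimately have b: "commutator G (commutator G y z) (z \<otimes> x \<otimes> inv z) \<in> ?N"
        using Suc.IH[of "commutator G y z" "Suc i"] Suc by fastforce
      have "commutator G z x \<in> lower_central G (i + j)"
        using Suc.IH[OF z(1) s(2)] Suc Suc.prems by simp
      then have c: "commutator G (commutator G z x) (x \<otimes> y \<otimes> inv x) \<in> ?N"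
        using s x Suc by (auto intro!: commutator_in_commutator_subgroup)
      let ?b = "commutator G (commutator G y z) (z \<otimes> x \<otimes> inv z)"
      let ?c = "commutator G (commutator G z x) (x \<otimes> y \<otimes> inv x)"
      have "commutator G s g \<otimes> (?b \<otimes> ?c) = \<one>"
        using hall_witt[OF x s(3) z(2), folded g_eq] s x z g by (simp add: m_assoc)
      then have "commutator G s g = inv (?b \<otimes> ?c)"
        using s x z g by (intro inv_equality[symmetric]) auto
      then have "commutator G g s = ?b \<otimes> ?c"
        using inv_commutator[of s g] s x z g by (simp add: inv_inv)
      then show ?thesis using b c N by (simp add: subgroup.m_closed)
    qed
    moreover have "?S \<subseteq> carrier G" using lower_central_subset by (auto intro!: commutator_closed)
    moreover have "h \<in> generate G ?S"
      using Suc.prems Suc by (simp add: commutator_subgroup_def)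
    ultimately show ?thesis using commutator_generate_right[OF N(1) g] by blast
  qed
qed

section \<open>The commutator as a bilinear pairing modulo deeper terms\<close>

lemma coset_eq_iff:
  assumes "subgroup N G" "x \<in> carrier G" "y \<in> carrier G"
  shows "N #> x = N #> y \<longleftrightarrow> x \<otimes> inv y \<in> N"
proof -
  have "x \<in> N #> y \<longleftrightarrow> N #> x = N #> y"
    using assms repr_independence[of x N y] rcos_self[of x N] by metis
  then show ?thesis
    using subgroup.rcos_module[OF assms(1) is_group assms(3,2)] by simp
qed

text \<open>Equality of these cosets serves as congruence modulo \<open>\<gamma>_n\<close>. The
  elements of \<open>L_n\<close> are the cosets with index \<open>Suc n\<close> of elements of
  \<open>\<gamma>_n\<close>.\<close>

definition lcs_coset :: "nat \<Rightarrow> 'a \<Rightarrow> 'a set" where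
  "lcs_coset n x = lower_central G n #> x"

lemma lcs_coset_eq_iff:
  "x \<in> carrier G \<Longrightarrow> y \<in> carrier G \<Longrightarrow>
    lcs_coset n x = lcs_coset n y \<longleftrightarrow> x \<otimes> inv y \<in> lower_central G n"
  unfolding lcs_coset_def by (rule coset_eq_iff[OF subgroup_lower_central])

lemma lcs_coset_mult:
  "x \<in> carrier G \<Longrightarrow> y \<in> carrier G \<Longrightarrow> lcs_coset n (x \<otimes> y) = lcs_coset n x <#> lcs_coset n y"
  unfolding lcs_coset_def by (simp add: normal.rcos_sum[OF normal_lower_central])

lemma lcs_coset_mult_left:
  "x \<in> lower_central G n \<Longrightarrow> y \<in> carrier G \<Longrightarrow> lcs_coset n (x \<otimes> y) = lcs_coset n y"
  using lower_central_closed[of x n] by (simp add: lcs_coset_eq_iff m_assoc)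

lemma lcs_coset_inv_cong:
  assumes "x \<in> carrier G" "y \<in> carrier G" "lcs_coset n x = lcs_coset n y"
  shows "lcs_coset n (inv x) = lcs_coset n (inv y)"
  using assms normal.rcos_inv[OF normal_lower_central] unfolding lcs_coset_def by metis

lemma lcs_coset_commute:
  assumes "x \<in> lower_central G i" "y \<in> lower_central G j" "i \<ge> 1" "j \<ge> 1" "n \<le> i + j"
  shows "lcs_coset n (x \<otimes> y) = lcs_coset n (y \<otimes> x)"
proof -
  have "commutator G x y \<in> lower_central G n"
    using commutator_lower_central[OF assms(1-4)] lower_central_antimono[OF assms(5)] by blast
  then show ?thesis
    using assms(1,2)[THEN lower_central_closed]
    by (simp add: lcs_coset_eq_iff commutator_def group_normalise)
qed

lemma lcs_coset_commutator_mult_left: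
  assumes x: "x \<in> lower_central G i" "x' \<in> lower_central G i" and y: "y \<in> lower_central G j"
    and ij: "i \<ge> 1" "j \<ge> 1"
  shows "lcs_coset (Suc (i + j)) (commutator G (x \<otimes> x') y)
    = lcs_coset (Suc (i + j)) (commutator G x y \<otimes> commutator G x' y)"
proof -
  let ?c = "commutator G x' y" and ?n = "Suc (i + j)"
  note carr = x[THEN lower_central_closed] y[THEN lower_central_closed]
  have c: "?c \<in> lower_central G (i + j)" "commutator G x y \<in> lower_central G (i + j)"
    using assms by (auto intro: commutator_lower_central)
  have "commutator G x ?c \<in> lower_central G (i + (i + j))"
    using assms c by (intro commutator_lower_central) auto
  then have xc: "commutator G x ?c \<in> lower_central G ?n"
    using lower_central_antimono[of ?n "i + (i + j)"] ij by auto
  \<comment> \<open>The exact expansion has the extra factor \<open>[x, [x', y]]\<close>, of degree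
    at least \<open>2 i + j\<close>; as \<open>i \<ge> 1\<close>, it vanishes modulo
    \<open>\<gamma>_(i+j+1)\<close>.\<close>
  have "commutator G (x \<otimes> x') y = commutator G x ?c \<otimes> (?c \<otimes> commutator G x y)"
    using carr by (simp add: commutator_def group_normalise)
  then have "lcs_coset ?n (commutator G (x \<otimes> x') y) = lcs_coset ?n (?c \<otimes> commutator G x y)"
    using lcs_coset_mult_left[OF xc] carr by simp
  also have "\<dots> = lcs_coset ?n (commutator G x y \<otimes> ?c)"
    using ij by (intro lcs_coset_commute[OF c]) auto
  finally show ?thesis .
qed

lemma lcs_coset_commutator_swap:
  assumes "x \<in> carrier G" "y \<in> carrier G" "x' \<in> carrier G" "y' \<in> carrier G"
    and "lcs_coset n (commutator G y x) = lcs_coset n (commutator G y' x')"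
  shows "lcs_coset n (commutator G x y) = lcs_coset n (commutator G x' y')"
  using lcs_coset_inv_cong[OF _ _ assms(5)] assms(1-4) by (simp add: inv_commutator)

lemma lcs_coset_commutator_inv_left:
  assumes "x \<in> lower_central G i" "y \<in> lower_central G j" "i \<ge> 1" "j \<ge> 1"
  shows "lcs_coset (Suc (i + j)) (commutator G (inv x) y)
    = lcs_coset (Suc (i + j)) (inv (commutator G x y))"
proof -
  let ?n = "Suc (i + j)"
  note carr = assms(1,2)[THEN lower_central_closed]
  have ix: "inv x \<in> lower_central G i"
    using assms subgroup.m_inv_closed[OF subgroup_lower_central] by blast
  have "lcs_coset ?n (commutator G (inv x) y \<otimes> commutator G x y) = lcs_coset ?n \<one>"
    using lcs_coset_commutator_mult_left[OF ix assms(1-4)] carr by (simp add: commutator_one)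
  then show ?thesis
    using carr by (simp add: lcs_coset_eq_iff)
qed

lemma lcs_coset_commutator_cong_left:
  assumes x: "x \<in> lower_central G i" "x' \<in> lower_central G i" and y: "y \<in> lower_central G j"
    and ij: "i \<ge> 1" "j \<ge> 1" and eq: "lcs_coset (Suc i) x = lcs_coset (Suc i) x'"
  shows "lcs_coset (Suc (i + j)) (commutator G x y) = lcs_coset (Suc (i + j)) (commutator G x' y)"
proof -
  define z where "z = x \<otimes> inv x'"
  note carr = x[THEN lower_central_closed] y[THEN lower_central_closed]
  have z: "z \<in> lower_central G (Suc i)" using eq carr by (simp add: z_def lcs_coset_eq_iff)
  then have zi: "z \<in> lower_central G i" using lower_central_Suc_subset by blast
  have zy: "commutator G z y \<in> lower_central G (Suc (i + j))"
    using commutator_lower_central[OF z y] ij by simp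
  have "x = z \<otimes> x'" using carr by (simp add: z_def m_assoc)
  then have "lcs_coset (Suc (i + j)) (commutator G x y)
      = lcs_coset (Suc (i + j)) (commutator G z y \<otimes> commutator G x' y)"
    using lcs_coset_commutator_mult_left[OF zi x(2) y ij] by simp
  also have "\<dots> = lcs_coset (Suc (i + j)) (commutator G x' y)"
    using zy carr by (intro lcs_coset_mult_left) auto
  finally show ?thesis .
qed

lemma lcs_coset_commutator_cong:
  assumes x: "x \<in> lower_central G i" "x' \<in> lower_central G i"
    and y: "y \<in> lower_central G j" "y' \<in> lower_central G j"
    and ij: "i \<ge> 1" "j \<ge> 1" and eq: "lcs_coset (Suc i) x = lcs_coset (Suc i) x'"
      "lcs_coset (Suc j) y = lcs_coset (Suc j) y'"
  shows "lcs_coset (Suc (i + j)) (commutator G x y) = lcs_coset (Suc (i + j)) (commutator G x' y')"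
proof -
  note carr = x[THEN lower_central_closed] y[THEN lower_central_closed]
  have "lcs_coset (Suc (i + j)) (commutator G x y) = lcs_coset (Suc (i + j)) (commutator G x' y)"
    by (rule lcs_coset_commutator_cong_left[OF x y(1) ij eq(1)])
  also have "\<dots> = lcs_coset (Suc (i + j)) (commutator G x' y')"
    by (rule lcs_coset_commutator_swap[OF carr(2,3,2,4)
      lcs_coset_commutator_cong_left[OF y x(2) ij(2,1) eq(2), unfolded add.commute[of j i]]])
  finally show ?thesis .
qed

lemma lcs_coset_mem_subgroup:
  assumes "subgroup H G" "lower_central G n \<subseteq> H" "x \<in> carrier G" "y \<in> H"
    "lcs_coset n x = lcs_coset n y"
  shows "x \<in> H"
proof -
  have y: "y \<in> carrier G" using assms subgroup.mem_carrier by metis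
  then have "x \<otimes> inv y \<in> H" using assms by (auto simp: lcs_coset_eq_iff)
  then have "x \<otimes> inv y \<otimes> y \<in> H" using assms(1,4) subgroup.m_closed by metis
  then show ?thesis using assms y by (simp add: m_assoc)
qed

lemma commutator_mem_swap:
  assumes "subgroup H G" "x \<in> carrier G" "y \<in> carrier G" "commutator G x y \<in> H"
  shows "commutator G y x \<in> H"
  using subgroup.m_inv_closed[OF assms(1,4)] assms by (simp add: inv_commutator)

text \<open>The Jacobi identity as a closure property of subgroups above
  \<open>\<gamma>_(i+j+k+1)\<close>, which replaces additive calculation with cosets: Hall-Witt
  writes \<open>[[a, b], c]\<close> as the inverse of a product of two commutators congruent to
  \<open>[[b, c], a]\<close> and \<open>[[c, a], b]\<close>.\<close>

lemma jacobi_mem_subgroup: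
  assumes H: "subgroup H G" "lower_central G (Suc (i + j + k)) \<subseteq> H"
    and a: "a \<in> lower_central G i" and b: "b \<in> lower_central G j" and c: "c \<in> lower_central G k"
    and ijk: "i \<ge> 1" "j \<ge> 1" "k \<ge> 1"
    and mem: "commutator G (commutator G a c) b \<in> H" "commutator G a (commutator G b c) \<in> H"
  shows "commutator G (commutator G a b) c \<in> H"
proof -
  note carr = a[THEN lower_central_closed] b[THEN lower_central_closed] c[THEN lower_central_closed]
  \<comment> \<open>With this conjugate of \<open>c\<close> the first factor of Hall-Witt is exactly
    \<open>[[a, b], c]\<close>; \<open>z\<close> then replaces \<open>c\<close> in the other two,
    which \<open>zc\<close> makes harmless.\<close>
  define z where "z = inv b \<otimes> c \<otimes> b"
  have cz: "c = b \<otimes> z \<otimes> inv b" using carr by (simp add: z_def group_normalise)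
  have z: "z \<in> lower_central G k" "z \<in> carrier G"
    using conj_in_normal[OF normal_lower_central c, of "inv b"] carr by (simp_all add: z_def)
  have conj: "lcs_coset (Suc m) (u \<otimes> v \<otimes> inv u) = lcs_coset (Suc m) v"
    if "u \<in> lower_central G l" "v \<in> lower_central G m" "l \<ge> 1" "m \<ge> 1" for u v l m
  proof -
    have "lcs_coset (Suc m) (u \<otimes> v \<otimes> inv u) = lcs_coset (Suc m) (commutator G u v \<otimes> v)"
      using that(1,2)[THEN lower_central_closed] by (simp add: commutator_def group_normalise)
    moreover have "commutator G u v \<in> lower_central G (Suc m)"
      using commutator_lower_central[OF that] lower_central_antimono[of "Suc m" "l + m"] that by auto
    ultimately show ?thesis using that lower_central_closed by (simp add: lcs_coset_mult_left)
  qed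
  have zc: "lcs_coset (Suc k) z = lcs_coset (Suc k) c"
    using conj[OF b z(1) ijk(2,3)] cz by simp
  let ?n = "Suc (i + j + k)"
  let ?p = "commutator G (commutator G b z) (z \<otimes> a \<otimes> inv z)"
  let ?q = "commutator G (commutator G z a) (a \<otimes> b \<otimes> inv a)"
  have conj_in: "z \<otimes> a \<otimes> inv z \<in> lower_central G i" "a \<otimes> b \<otimes> inv a \<in> lower_central G j"
    using conj_in_normal[OF normal_lower_central] a b z carr by blast+
  have "lcs_coset (Suc (j + k)) (commutator G b z) = lcs_coset (Suc (j + k)) (commutator G b c)"
    by (rule lcs_coset_commutator_cong[OF b b z(1) c ijk(2,3) HOL.refl zc])
  then have "lcs_coset (Suc (j + k + i)) ?p
      = lcs_coset (Suc (j + k + i)) (commutator G (commutator G b c) a)"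
    using ijk by (intro lcs_coset_commutator_cong[OF commutator_lower_central[OF b z(1) ijk(2,3)]
      commutator_lower_central[OF b c ijk(2,3)] conj_in(1) a] conj[OF z(1) a]) auto
  moreover have "Suc (j + k + i) = ?n" by simp
  ultimately have p: "lcs_coset ?n ?p = lcs_coset ?n (commutator G (commutator G b c) a)"
    by (simp only:)
  have "lcs_coset (Suc (k + i)) (commutator G z a) = lcs_coset (Suc (k + i)) (commutator G c a)"
    by (rule lcs_coset_commutator_cong[OF z(1) c a a ijk(3,1) zc HOL.refl])
  then have "lcs_coset (Suc (k + i + j)) ?q
      = lcs_coset (Suc (k + i + j)) (commutator G (commutator G c a) b)"
    using ijk by (intro lcs_coset_commutator_cong[OF commutator_lower_central[OF z(1) a ijk(3,1)]
      commutator_lower_central[OF c a ijk(3,1)] conj_in(2) b] conj[OF a b]) auto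
  moreover have "Suc (k + i + j) = ?n" by simp
  ultimately have q: "lcs_coset ?n ?q = lcs_coset ?n (commutator G (commutator G c a) b)"
    by (simp only:)
  have bcH: "commutator G (commutator G b c) a \<in> H"
    using commutator_mem_swap[OF H(1) _ _ mem(2)] carr by simp
  have pH: "?p \<in> H"
    by (rule lcs_coset_mem_subgroup[OF H _ bcH p]) (use carr z in simp)
  have "commutator G a c \<in> lower_central G (k + i)"
    using commutator_lower_central[OF a c ijk(1,3)] by (simp add: add.commute)
  then have "lcs_coset (Suc (k + i + j)) (commutator G (inv (commutator G a c)) b)
      = lcs_coset (Suc (k + i + j)) (inv (commutator G (commutator G a c) b))"
    using b ijk by (intro lcs_coset_commutator_inv_left) auto
  moreover have "inv (commutator G a c) = commutator G c a" using carr by (simp add: inv_commutator)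
  ultimately have "lcs_coset ?n (commutator G (commutator G c a) b)
      = lcs_coset ?n (inv (commutator G (commutator G a c) b))"
    using \<open>Suc (k + i + j) = ?n\<close> by (simp only:)
  with q have q': "lcs_coset ?n ?q = lcs_coset ?n (inv (commutator G (commutator G a c) b))"
    by (rule HOL.trans)
  have qH: "?q \<in> H"
    by (rule lcs_coset_mem_subgroup[OF H _ subgroup.m_inv_closed[OF H(1) mem(1)] q'])
      (use carr z in simp)
  have "commutator G (commutator G a b) c \<otimes> ?p \<otimes> ?q
      = commutator G (commutator G a b) c \<otimes> (?p \<otimes> ?q)"
    by (rule m_assoc) (use carr z in simp_all)
  then have "commutator G (commutator G a b) c \<otimes> (?p \<otimes> ?q) = \<one>"
    using hall_witt[OF carr(1,2) z(2), folded cz] by simp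
  then have "commutator G (commutator G a b) c = inv (?p \<otimes> ?q)"
    using carr z by (intro inv_equality[symmetric]) auto
  then show ?thesis
    using pH qH H(1) by (simp add: subgroup.m_closed subgroup.m_inv_closed)
qed

end

section \<open>Lyndon commutators span the lower central factors\<close>

context group
begin

text \<open>For \<open>X\<close> inside \<open>\<gamma>_n\<close>, the preimage in the group of the
  subgroup of \<open>L_n\<close> generated by the classes of \<open>X\<close>.\<close>

definition lcs_span :: "nat \<Rightarrow> 'a set \<Rightarrow> 'a set" where
  "lcs_span n X = generate G (X \<union> lower_central G (Suc n))"

lemma subgroup_lcs_span:
  "X \<subseteq> carrier G \<Longrightarrow> subgroup (lcs_span n X) G"
  unfolding lcs_span_def using lower_central_subset by (intro generate_is_subgroup) auto

lemma lcs_span_incl: "x \<in> X \<Longrightarrow> x \<in> lcs_span n X"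
  unfolding lcs_span_def by (rule generate.incl) simp

lemma lower_central_subset_span: "lower_central G (Suc n) \<subseteq> lcs_span n X"
  unfolding lcs_span_def by (auto intro: generate.incl)

lemma lcs_span_subset:
  "subgroup H G \<Longrightarrow> X \<subseteq> H \<Longrightarrow> lower_central G (Suc n) \<subseteq> H \<Longrightarrow> lcs_span n X \<subseteq> H"
  unfolding lcs_span_def by (rule generate_subgroup_incl) auto

lemma lcs_span_mono: "X \<subseteq> Y \<Longrightarrow> lcs_span n X \<subseteq> lcs_span n Y"
  unfolding lcs_span_def by (rule mono_generate) auto

lemma lcs_span_subset_lower_central:
  "X \<subseteq> lower_central G n \<Longrightarrow> lcs_span n X \<subseteq> lower_central G n"
  by (rule lcs_span_subset[OF subgroup_lower_central _ lower_central_Suc_subset])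

text \<open>Commutation with \<open>y\<close> induces a homomorphism from \<open>L_i\<close> to
  \<open>L_(i+j)\<close>, so a spanning set decides.\<close>

lemma commutator_span_left:
  assumes H: "subgroup H G" "lower_central G (Suc (i + j)) \<subseteq> H"
    and ij: "i \<ge> 1" "j \<ge> 1"
    and X: "X \<subseteq> lower_central G i" and y: "y \<in> lower_central G j"
    and mem: "\<And>x. x \<in> X \<Longrightarrow> commutator G x y \<in> H"
    and x: "x \<in> lcs_span i X"
  shows "commutator G x y \<in> H"
proof -
  let ?X = "X \<union> lower_central G (Suc i)"
  have gen: "x \<in> generate G ?X" using x by (simp add: lcs_span_def)
  have sub: "?X \<subseteq> lower_central G i" using X lower_central_Suc_subset by blast
  have y': "y \<in> carrier G" using y lower_central_closed by blast
  have in_i: "z \<in> lower_central G i" if "z \<in> generate G ?X" for z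
    using generate_subgroup_incl[OF sub subgroup_lower_central] that by blast
  have X_mem: "commutator G z y \<in> H" if "z \<in> ?X" for z
    using that mem commutator_lower_central[of z "Suc i" y j] y ij H(2) by auto
  from gen show ?thesis
  proof (induction rule: generate.induct)
    case one
    then show ?case using y' H by (simp add: commutator_one subgroup.one_closed)
  next
    case (incl z)
    then show ?case by (rule X_mem)
  next
    case (inv z)
    then have z: "z \<in> lower_central G i" using sub by blast
    show ?case
      by (rule lcs_coset_mem_subgroup[OF H _ subgroup.m_inv_closed[OF H(1) X_mem[OF inv]]
            lcs_coset_commutator_inv_left[OF z y ij]])
        (use z y' lower_central_closed in simp)
  next
    case (eng z1 z2)
    note z = eng.hyps[THEN in_i]
    show ?case
      by (rule lcs_coset_mem_subgroup[OF H _ subgroup.m_closed[OF H(1) eng.IH]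
            lcs_coset_commutator_mult_left[OF z y ij]])
        (use z y' lower_central_closed in simp)
  qed
qed

lemma commutator_span_right:
  assumes H: "subgroup H G" "lower_central G (Suc (i + j)) \<subseteq> H"
    and ij: "i \<ge> 1" "j \<ge> 1"
    and X: "X \<subseteq> lower_central G i" and y: "y \<in> lower_central G j"
    and mem: "\<And>x. x \<in> X \<Longrightarrow> commutator G y x \<in> H"
    and x: "x \<in> lcs_span i X"
  shows "commutator G y x \<in> H"
proof -
  have y': "y \<in> carrier G" using y lower_central_closed by blast
  have "commutator G z y \<in> H" if "z \<in> X" for z
    using commutator_mem_swap[OF H(1) y' _ mem[OF that]] that X lower_central_closed by blast
  from commutator_span_left[OF H ij X y this x] show ?thesis
    using commutator_mem_swap[OF H(1) _ y'] x lcs_span_subset_lower_central[OF X] lower_central_closed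
    by blast
qed

end

locale generated_group = group G for G (structure) +
  fixes e :: "'c::linorder \<Rightarrow> 'a" and A :: "'c set"
  assumes finite_letters: "finite A"
    and e_closed: "e ` A \<subseteq> carrier G"
    and generates: "generate G (e ` A) = carrier G"
begin

abbreviation group_eval :: "'c lie_word \<Rightarrow> 'a" where
  "group_eval \<equiv> lie_eval (commutator G) e"

definition lyndon_elem :: "'c list \<Rightarrow> 'a" where
  "lyndon_elem w = group_eval (lyndon_brack w)"

definition lyndon_words :: "nat \<Rightarrow> 'c list set" where
  "lyndon_words n = {w. lyndon w \<and> length w = n \<and> set w \<subseteq> A}"

lemma finite_lyndon_words: "finite (lyndon_words n)"
  by (rule finite_subset[OF _ finite_lists_length_eq[OF finite_letters, of n]])
    (auto simp: lyndon_words_def)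

lemma group_eval_lower_central:
  "letters t \<subseteq> A \<Longrightarrow> group_eval t \<in> lower_central G (degree t)"
  by (induction t)
    (use e_closed in \<open>auto intro!: commutator_lower_central simp: Suc_le_eq degree_pos\<close>)

lemma lyndon_elem_lower_central:
  "w \<in> lyndon_words n \<Longrightarrow> lyndon_elem w \<in> lower_central G n"
  using group_eval_lower_central[of "lyndon_brack w"] lyndon_not_Nil[of w]
  by (auto simp: lyndon_words_def lyndon_elem_def letters_lyndon_brack degree_lyndon_brack)

lemma lyndon_elem_subset: "W \<subseteq> lyndon_words n \<Longrightarrow> lyndon_elem ` W \<subseteq> lower_central G n"
  using lyndon_elem_lower_central by blast

lemma lyndon_elem_subset_carrier: "W \<subseteq> lyndon_words n \<Longrightarrow> lyndon_elem ` W \<subseteq> carrier G"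
  using lyndon_elem_subset lower_central_closed by blast

lemma subgroup_lyndon_span: "W \<subseteq> lyndon_words n \<Longrightarrow> subgroup (lcs_span m (lyndon_elem ` W)) G"
  by (rule subgroup_lcs_span[OF lyndon_elem_subset_carrier])

lemma lyndon_words_pos: "w \<in> lyndon_words n \<Longrightarrow> n \<ge> 1"
  using lyndon_not_Nil[of w] by (cases w) (auto simp: lyndon_words_def)

text \<open>If \<open>u v\<close> does not have the standard factorisation \<open>(u, v)\<close>, split \<open>u = u' u''\<close> and apply the
  Jacobi identity. The inner brackets are shorter, and they produce words below \<open>v\<close> again, so that
  the outer brackets have the same length but a smaller maximum of their two words.\<close>

lemma commutator_lyndon_elem:
  assumes "u \<in> lyndon_words i" "v \<in> lyndon_words j" "u < v"
  shows "commutator G (lyndon_elem u) (lyndon_elem v)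
    \<in> lcs_span (i + j) (lyndon_elem ` {w \<in> lyndon_words (i + j). w < v})"
  using assms
proof (induction "i + j" arbitrary: i j u v rule: less_induct)
  case (less i j)
  note shorter = less.hyps
  \<comment> \<open>The lexicographic order on words is not well founded, but only finitely many
    words of length at most \<open>i + j\<close> over \<open>A\<close> lie below \<open>v\<close>;
    their number is the measure of the inner induction.\<close>
  define B where "B v = {w. length w \<le> i + j \<and> set w \<subseteq> A \<and> w < v}" for v :: "'c list"
  have finite_B: "finite (B v)" for v
    using finite_lists_length_le[OF finite_letters, of "i + j"]
    by (rule rev_finite_subset) (auto simp: B_def)
  have "commutator G (lyndon_elem u) (lyndon_elem v)
      \<in> lcs_span (i + j) (lyndon_elem ` {w \<in> lyndon_words (i + j). w < v})"
    if "u \<in> lyndon_words k" "v \<in> lyndon_words l" "u < v" "k + l = i + j" for u v k l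
    using that
  proof (induction "card (B v)" arbitrary: u v k l rule: less_induct)
    case (less v u k l)
    note uv = less.prems(1-3)
    let ?n = "i + j"
    let ?W = "{w \<in> lyndon_words ?n. w < v}"
    let ?H = "lcs_span ?n (lyndon_elem ` ?W)"
    have H: "subgroup ?H G" "lower_central G (Suc ?n) \<subseteq> ?H"
      using subgroup_lyndon_span[of ?W ?n ?n] lower_central_subset_span by auto
    have kl: "k \<ge> 1" "l \<ge> 1" using uv lyndon_words_pos by blast+
    \<comment> \<open>The two words may come in any order: equal ones give the identity, and a
      reversed pair gives an inverse.\<close>
    have below: "commutator G (lyndon_elem x) (lyndon_elem y) \<in> ?H"
      if xy: "x \<in> lyndon_words a" "y \<in> lyndon_words b" "x < v" "y < v" "a + b = ?n" for x y a b
    proof -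
      have xc: "lyndon_elem x \<in> carrier G" "lyndon_elem y \<in> carrier G"
        using xy lyndon_elem_lower_central lower_central_closed by blast+
      have *: "commutator G (lyndon_elem x) (lyndon_elem y) \<in> ?H"
        if xy: "x \<in> lyndon_words a" "y \<in> lyndon_words b" "y < v" "a + b = ?n" "x < y" for x y a b
      proof -
        have "B y \<subset> B v" using xy less.prems by (auto simp: B_def lyndon_words_def)
        then have "card (B y) < card (B v)" by (rule psubset_card_mono[OF finite_B])
        from less.hyps[OF this xy(1,2,5,4)] show ?thesis
          using lcs_span_mono[of "lyndon_elem ` {w \<in> lyndon_words ?n. w < y}" "lyndon_elem ` ?W" ?n]
            xy(3) by fastforce
      qed
      show ?thesis
      proof (cases x y rule: linorder_cases)
        case less
        then show ?thesis using * xy by blast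
      next
        case equal
        then show ?thesis using xc H by (simp add: commutator_self subgroup.one_closed)
      next
        case greater
        have "b + a = ?n" using xy(5) by simp
        from commutator_mem_swap[OF H(1) xc(2,1) *[OF xy(2,1,3) this greater]] show ?thesis .
      qed
    qed
    show ?case
    proof (cases "length u \<ge> 2 \<longrightarrow> v \<le> rfactor u")
      case True
      have lyn: "lyndon u" "lyndon v" using uv by (auto simp: lyndon_words_def)
      then have "rfactor (u @ v) = v" "lfactor (u @ v) = u"
        using factors_append True by blast+
      moreover have "length (u @ v) \<ge> 2"
        using kl uv by (simp add: lyndon_words_def)
      ultimately have "lyndon_elem (u @ v) = commutator G (lyndon_elem u) (lyndon_elem v)"
        by (simp add: lyndon_elem_def lyndon_brack.simps[of "u @ v"])
      moreover have "u @ v \<in> ?W"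
        using uv lyn less.prems(4) lyndon_append[OF lyn uv(3)]
          lyndon_append_less[OF lyn(2) uv(3) lyndon_not_Nil[OF lyn(1)]]
        by (auto simp: lyndon_words_def)
      ultimately show ?thesis by (metis lcs_span_incl imageI)
    next
      case False
      define u' u'' where "u' = lfactor u" and "u'' = rfactor u"
      have len: "length u \<ge> 2" and u''_v: "u'' < v" using False by (auto simp: u''_def)
      have lyn: "lyndon u" "lyndon u'" "lyndon u''" "u' < u''"
        using uv lyndon_lfactor lyndon_rfactor len lfactor_less_rfactor
        by (auto simp: lyndon_words_def u'_def u''_def)
      have u: "u = u' @ u''" using factorisation[OF len] by (simp add: u'_def u''_def)
      define a b where "a = length u'" and "b = length u''"
      have mem: "u' \<in> lyndon_words a" "u'' \<in> lyndon_words b"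
        using lyn uv u by (auto simp: lyndon_words_def a_def b_def)
      have ab: "k = a + b" using u uv by (auto simp: lyndon_words_def a_def b_def)
      have ab_pos: "a \<ge> 1" "b \<ge> 1" using mem lyndon_words_pos by blast+
      note el = mem[THEN lyndon_elem_lower_central] uv(2)[THEN lyndon_elem_lower_central]
      have u_eq: "lyndon_elem u = commutator G (lyndon_elem u') (lyndon_elem u'')"
        using len by (simp add: lyndon_elem_def lyndon_brack.simps[of u] u'_def u''_def)
      have n: "?n = a + b + l" "a + l < ?n" "b + l < ?n"
        using less.prems(4) ab ab_pos by auto
      have "u' < v" using lyn u''_v by simp
      have "commutator G (lyndon_elem u') (lyndon_elem v)
          \<in> lcs_span (a + l) (lyndon_elem ` {w \<in> lyndon_words (a + l). w < v})"
        using shorter[OF n(2) mem(1) uv(2) \<open>u' < v\<close>] .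
      then have 1: "commutator G (commutator G (lyndon_elem u') (lyndon_elem v)) (lyndon_elem u'') \<in> ?H"
      proof (rule commutator_span_left[OF H(1), rotated -1])
        show "lower_central G (Suc (a + l + b)) \<subseteq> ?H" using H n by (simp add: ac_simps)
        show "commutator G x (lyndon_elem u'') \<in> ?H"
          if "x \<in> lyndon_elem ` {w \<in> lyndon_words (a + l). w < v}" for x
          using that below mem u''_v n by (auto simp: ac_simps)
      qed (use el ab_pos kl in \<open>auto intro: lyndon_elem_lower_central\<close>)
      have "commutator G (lyndon_elem u'') (lyndon_elem v)
          \<in> lcs_span (b + l) (lyndon_elem ` {w \<in> lyndon_words (b + l). w < v})"
        using shorter[OF n(3) mem(2) uv(2) u''_v] .
      then have 2: "commutator G (lyndon_elem u') (commutator G (lyndon_elem u'') (lyndon_elem v)) \<in> ?H"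
      proof (rule commutator_span_right[OF H(1), rotated -1])
        show "lower_central G (Suc (b + l + a)) \<subseteq> ?H" using H n by (simp add: ac_simps)
        show "commutator G (lyndon_elem u') x \<in> ?H"
          if "x \<in> lyndon_elem ` {w \<in> lyndon_words (b + l). w < v}" for x
          using that below mem \<open>u' < v\<close> n by (auto simp: ac_simps)
      qed (use el ab_pos kl in \<open>auto intro: lyndon_elem_lower_central\<close>)
      show ?thesis unfolding u_eq
        using jacobi_mem_subgroup[OF H(1) _ el ab_pos kl(2) 1 2] H(2) n(1) by simp
    qed
  qed
  from this[OF less.prems HOL.refl] show ?case .
qed

lemma carrier_eq_lyndon_span: "carrier G = lcs_span 1 (lyndon_elem ` lyndon_words 1)"
proof -
  have "e ` A \<subseteq> lcs_span 1 (lyndon_elem ` lyndon_words 1)"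
  proof
    fix x assume "x \<in> e ` A"
    then obtain a where a: "a \<in> A" "x = e a" by blast
    then have "x = lyndon_elem [a]" "[a] \<in> lyndon_words 1"
      by (auto simp: lyndon_elem_def lyndon_brack_letter lyndon_words_def lyndon_letter)
    then show "x \<in> lcs_span 1 (lyndon_elem ` lyndon_words 1)" using lcs_span_incl by blast
  qed
  moreover have "subgroup (lcs_span 1 (lyndon_elem ` lyndon_words 1)) G"
    by (rule subgroup_lcs_span[OF lyndon_elem_subset_carrier[OF subset_refl]])
  ultimately have "carrier G \<subseteq> lcs_span 1 (lyndon_elem ` lyndon_words 1)"
    using generate_subgroup_incl[of "e ` A"] generates by blast
  then show ?thesis
    using lcs_span_subset_lower_central[OF lyndon_elem_subset[of "lyndon_words 1" 1]] by auto
qed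

text \<open>By bilinearity \<open>\<gamma>_(n+1)\<close> is spanned by commutators of Lyndon
  elements of degree \<open>n\<close> with letters. \<open>commutator_lyndon_elem\<close>, after a
  swap if the letter is the smaller word, rewrites these in Lyndon elements of degree
  \<open>n + 1\<close>.\<close>

theorem lower_central_eq_lyndon_span:
  assumes "n \<ge> 1"
  shows "lower_central G n = lcs_span n (lyndon_elem ` lyndon_words n)"
  using assms
proof (induction n rule: nat_induct_at_least)
  case base
  show ?case using carrier_eq_lyndon_span by simp
next
  case (Suc n)
  let ?H = "lcs_span (Suc n) (lyndon_elem ` lyndon_words (Suc n))"
  have H: "subgroup ?H G" "lower_central G (Suc (Suc n)) \<subseteq> ?H"
    by (rule subgroup_lyndon_span[OF subset_refl]) (rule lower_central_subset_span)
  have gens: "commutator G (lyndon_elem w) (lyndon_elem v) \<in> ?H"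
    if wv: "w \<in> lyndon_words n" "v \<in> lyndon_words 1" for w v
  proof -
    have wc: "lyndon_elem w \<in> carrier G" "lyndon_elem v \<in> carrier G"
      using wv lyndon_elem_lower_central lower_central_closed by blast+
    have mono: "lcs_span (Suc n) (lyndon_elem ` {x \<in> lyndon_words (Suc n). x < y}) \<subseteq> ?H" for y
      by (rule lcs_span_mono) auto
    show ?thesis
    proof (cases w v rule: linorder_cases)
      case less
      then show ?thesis using commutator_lyndon_elem[OF wv] mono by auto
    next
      case equal
      then show ?thesis using wc H by (simp add: commutator_self subgroup.one_closed)
    next
      case greater
      then show ?thesis
        using commutator_lyndon_elem[OF wv(2,1)] mono
        by (intro commutator_mem_swap[OF H(1) wc(2,1)]) auto
    qed
  qed
  have H': "lower_central G (Suc (n + 1)) \<subseteq> ?H" "lower_central G (Suc (1 + n)) \<subseteq> ?H"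
    using H(2) by simp_all
  have "commutator G h k \<in> ?H" if hk: "h \<in> lower_central G n" "k \<in> carrier G" for h k
  proof (rule commutator_span_right[OF H(1) H'(2) _ Suc.hyps lyndon_elem_subset[OF subset_refl] hk(1)])
    fix x assume "x \<in> lyndon_elem ` lyndon_words 1"
    then obtain v where v: "x = lyndon_elem v" "v \<in> lyndon_words 1" by blast
    show "commutator G h x \<in> ?H"
      by (rule commutator_span_left[OF H(1) H'(1) Suc.hyps _ lyndon_elem_subset[OF subset_refl]])
        (use hk Suc.IH v gens lyndon_elem_lower_central[OF v(2)] in auto)
  qed (use hk carrier_eq_lyndon_span in auto)
  then have "commutator_subgroup G (lower_central G n) (carrier G) \<subseteq> ?H"
    by (rule commutator_subgroup_subset[OF H(1)])
  then have "lower_central G (Suc n) \<subseteq> ?H" using Suc.hyps by (cases n) auto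
  then show ?case
    using lcs_span_subset_lower_central[OF lyndon_elem_subset[of "lyndon_words (Suc n)" "Suc n"]]
    by auto
qed

end

section \<open>Noncommutative power series and traces\<close>

text \<open>A separate type makes convolution the multiplication of a \<open>ring_1\<close>
  instance; integer coefficients serve all \<open>p\<close> at once.\<close>

typedef 'a nc_series = "UNIV :: ('a list \<Rightarrow> int) set"
  morphisms coeff Series ..

setup_lifting type_definition_nc_series

definition splits :: "'a list \<Rightarrow> ('a list \<times> 'a list) set" where
  "splits w = {(u, v). u @ v = w}"

lemma finite_splits [simp]: "finite (splits w)"
proof (rule finite_subset)
  show "splits w \<subseteq> (\<lambda>n. (take n w, drop n w)) ` {..length w}"
  proof
    fix p assume "p \<in> splits w"
    then show "p \<in> (\<lambda>n. (take n w, drop n w)) ` {..length w}"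
      by (intro image_eqI[of _ _ "length (fst p)"]) (auto simp: splits_def)
  qed
qed simp

instantiation nc_series :: (type) ring_1
begin

lift_definition zero_nc_series :: "'a nc_series" is "\<lambda>_. 0" .
lift_definition one_nc_series :: "'a nc_series" is "\<lambda>w. if w = [] then 1 else 0" .
lift_definition plus_nc_series :: "'a nc_series \<Rightarrow> 'a nc_series \<Rightarrow> 'a nc_series"
  is "\<lambda>f g w. f w + g w" .
lift_definition minus_nc_series :: "'a nc_series \<Rightarrow> 'a nc_series \<Rightarrow> 'a nc_series"
  is "\<lambda>f g w. f w - g w" .
lift_definition uminus_nc_series :: "'a nc_series \<Rightarrow> 'a nc_series" is "\<lambda>f w. - f w" .
lift_definition times_nc_series :: "'a nc_series \<Rightarrow> 'a nc_series \<Rightarrow> 'a nc_series"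
  is "\<lambda>f g w. \<Sum>(u, v)\<in>splits w. f u * g v" .

instance
proof
  fix f g h :: "'a nc_series"
  show "f * g * h = f * (g * h)"
  proof transfer
    fix f g h :: "'a list \<Rightarrow> int"
    show "(\<lambda>w. \<Sum>(u, v)\<in>splits w. (\<Sum>(x, y)\<in>splits u. f x * g y) * h v) =
          (\<lambda>w. \<Sum>(u, v)\<in>splits w. f u * (\<Sum>(x, y)\<in>splits v. g x * h y))"
    proof
      fix w
      have "(\<Sum>(u, v)\<in>splits w. (\<Sum>(x, y)\<in>splits u. f x * g y) * h v)
          = (\<Sum>(p, q)\<in>(SIGMA p:splits w. splits (fst p)). f (fst q) * g (snd q) * h (snd p))"
        by (subst sum.Sigma[symmetric]) (auto simp: case_prod_unfold sum_distrib_right)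
      \<comment> \<open>Both sums run over the factorisations of \<open>w\<close> into three words;
        the witnesses regroup them.\<close>
      also have "\<dots> = (\<Sum>(p, q)\<in>(SIGMA p:splits w. splits (snd p)). f (fst p) * (g (fst q) * h (snd q)))"
        by (rule sum.reindex_bij_witness[of _
              "\<lambda>(p, q). ((fst p @ fst q, snd q), (fst p, fst q))"
              "\<lambda>(p, q). ((fst q, snd q @ snd p), (snd q, snd p))"])
          (auto simp: splits_def)
      also have "\<dots> = (\<Sum>(u, v)\<in>splits w. f u * (\<Sum>(x, y)\<in>splits v. g x * h y))"
        by (subst sum.Sigma[symmetric]) (auto simp: case_prod_unfold sum_distrib_left)
      finally show "(\<Sum>(u, v)\<in>splits w. (\<Sum>(x, y)\<in>splits u. f x * g y) * h v)
          = (\<Sum>(u, v)\<in>splits w. f u * (\<Sum>(x, y)\<in>splits v. g x * h y))" .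
    qed
  qed
  show "1 * f = f"
  proof transfer
    fix f :: "'a list \<Rightarrow> int"
    have fin: "finite {(u, v). u @ v = w}" for w :: "'a list"
      using finite_splits[of w] by (simp add: splits_def)
    have "(\<Sum>(u, v)\<in>splits w. (if u = [] then 1 else 0) * f v) = f w" for w
      by (rule HOL.trans[OF sum.mono_neutral_right[of _ "{([], w)}"]]) (auto simp: splits_def fin split: if_splits)
    then show "(\<lambda>w. \<Sum>(u, v)\<in>splits w. (if u = [] then 1 else 0) * f v) = f" by blast
  qed
  show "f * 1 = f"
  proof transfer
    fix f :: "'a list \<Rightarrow> int"
    have fin: "finite {(u, v). u @ v = w}" for w :: "'a list"
      using finite_splits[of w] by (simp add: splits_def)
    have "(\<Sum>(u, v)\<in>splits w. f u * (if v = [] then 1 else 0)) = f w" for w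
      by (rule HOL.trans[OF sum.mono_neutral_right[of _ "{(w, [])}"]]) (auto simp: splits_def fin split: if_splits)
    then show "(\<lambda>w. \<Sum>(u, v)\<in>splits w. f u * (if v = [] then 1 else 0)) = f" by blast
  qed
  show "(f + g) * h = f * h + g * h"
    by transfer (simp add: case_prod_unfold distrib_right sum.distrib)
  show "f * (g + h) = f * g + f * h"
    by transfer (simp add: case_prod_unfold distrib_left sum.distrib)
  show "(0 :: 'a nc_series) \<noteq> 1"
    by transfer (auto dest: fun_cong[of _ _ "[]"])
qed (transfer, force)+

end

lemma coeff_simps [simp]:
  "coeff 0 w = 0" "coeff 1 w = (if w = [] then 1 else 0)" "coeff (f + g) w = coeff f w + coeff g w"
  "coeff (f - g) w = coeff f w - coeff g w" "coeff (- f) w = - coeff f w"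
  by (transfer; simp)+

lemma coeff_times: "coeff (f * g) w = (\<Sum>(u, v)\<in>splits w. coeff f u * coeff g v)"
  by transfer simp

lift_definition X :: "'a \<Rightarrow> 'a nc_series" is "\<lambda>a w. if w = [a] then 1 else 0" .

lemma coeff_X: "coeff (X a) w = (if w = [a] then 1 else 0)"
  by transfer simp

lemma splits_nonempty_Nil: "splits [] = {([], [])}"
  by (auto simp: splits_def)

text \<open>The alternating geometric series \<open>1 - a + a^2 - ...\<close>, inverse to
  \<open>1 + a\<close>.\<close>

lift_definition inverse_letter :: "'a \<Rightarrow> 'a nc_series"
  is "\<lambda>a w. if set w \<subseteq> {a} then (- 1) ^ length w else 0" .

lemma coeff_inverse_letter: "coeff (inverse_letter a) w = (if set w \<subseteq> {a} then (- 1) ^ length w else 0)"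
  by transfer simp

lemma coeff_X_times:
  "coeff (X a * f) w = (case w of [] \<Rightarrow> 0 | b # v \<Rightarrow> if b = a then coeff f v else 0)"
proof -
  have "coeff (X a * f) w = (\<Sum>(u, v)\<in>splits w \<inter> {([a], tl w)}. coeff (X a) u * coeff f v)"
    unfolding coeff_times
    by (rule sum.mono_neutral_right)
      (use finite_splits[of w] in \<open>auto simp: coeff_X splits_def split: if_splits\<close>)
  also have "\<dots> = (case w of [] \<Rightarrow> 0 | b # v \<Rightarrow> if b = a then coeff f v else 0)"
    by (auto split: list.split simp: splits_def coeff_X)
  finally show ?thesis .
qed

lemma coeff_times_X:
  "coeff (f * X a) w = (if w \<noteq> [] \<and> last w = a then coeff f (butlast w) else 0)"
proof -
  have "coeff (f * X a) w = (\<Sum>(u, v)\<in>splits w \<inter> {(butlast w, [a])}. coeff f u * coeff (X a) v)"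
    unfolding coeff_times
    by (rule sum.mono_neutral_right)
      (use finite_splits[of w] in \<open>auto simp: coeff_X splits_def split: if_splits\<close>)
  also have "\<dots> = (if w \<noteq> [] \<and> last w = a then coeff f (butlast w) else 0)"
    by (cases w rule: rev_cases) (auto simp: splits_def coeff_X)
  finally show ?thesis .
qed

lemma nc_series_eqI: "(\<And>w. coeff f w = coeff g w) \<Longrightarrow> f = g"
  by (simp add: coeff_inject[symmetric] fun_eq_iff)

lemma inverse_letter:
  "(1 + X a) * inverse_letter a = 1" "inverse_letter a * (1 + X a) = 1"
proof -
  show "(1 + X a) * inverse_letter a = 1"
    by (rule nc_series_eqI)
      (auto simp: distrib_right coeff_X_times coeff_inverse_letter split: list.split)
  show "inverse_letter a * (1 + X a) = 1"
  proof (rule nc_series_eqI)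
    show "coeff (inverse_letter a * (1 + X a)) w = coeff 1 w" for w
      by (cases w rule: rev_cases) (auto simp: distrib_left coeff_times_X coeff_inverse_letter)
  qed
qed

abbreviation poly_eval :: "'a lie_word \<Rightarrow> 'a nc_series" where
  "poly_eval \<equiv> lie_eval (\<lambda>f g. f * g - g * f) X"

section \<open>The trace monoid and its series\<close>

locale commutation =
  fixes E :: "'a \<Rightarrow> 'a \<Rightarrow> bool"
  assumes E_sym: "E a b \<Longrightarrow> E b a" and E_irrefl: "\<not> E a a"
begin

text \<open>Two words represent the same trace (element of the partially commutative monoid) if and only
  if their projections to all pairs of non-commuting letters agree. As a definition, this makes
  cancellation immediate. The case \<open>a = b\<close> counts the occurrences of a letter.\<close>

definition trace_eq :: "'a list \<Rightarrow> 'a list \<Rightarrow> bool" where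
  "trace_eq u w \<longleftrightarrow> (\<forall>a b. \<not> E a b \<longrightarrow>
     filter (\<lambda>x. x = a \<or> x = b) u = filter (\<lambda>x. x = a \<or> x = b) w)"

lemma trace_eq_refl [simp]: "trace_eq w w"
  by (simp add: trace_eq_def)

lemma trace_eq_sym: "trace_eq u w \<Longrightarrow> trace_eq w u"
  by (simp add: trace_eq_def)

lemma trace_eq_trans: "trace_eq u v \<Longrightarrow> trace_eq v w \<Longrightarrow> trace_eq u w"
  by (simp add: trace_eq_def)

lemma trace_eq_append_left: "trace_eq (x @ u) (x @ v) \<longleftrightarrow> trace_eq u v"
  by (simp add: trace_eq_def)

lemma trace_eq_append_right: "trace_eq (u @ x) (v @ x) \<longleftrightarrow> trace_eq u v"
  by (simp add: trace_eq_def)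

lemma trace_eq_swap: "E a b \<Longrightarrow> trace_eq [a, b] [b, a]"
  using E_sym by (auto simp: trace_eq_def)

lemma trace_eq_mset: "trace_eq u w \<Longrightarrow> mset u = mset w"
proof (rule multiset_eqI)
  fix a assume "trace_eq u w"
  then have "filter (\<lambda>x. x = a \<or> x = a) u = filter (\<lambda>x. x = a \<or> x = a) w"
    using E_irrefl unfolding trace_eq_def by blast
  then have "filter_mset (\<lambda>x. x = a) (mset u) = filter_mset (\<lambda>x. x = a) (mset w)"
    by (simp flip: mset_filter)
  from arg_cong[OF this, of "\<lambda>M. count M a"] show "count (mset u) a = count (mset w) a"
    by simp
qed

lemma trace_eq_length: "trace_eq u w \<Longrightarrow> length u = length w"
  using trace_eq_mset mset_eq_length by blast

lemma trace_eq_set: "trace_eq u w \<Longrightarrow> set u = set w"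
  using trace_eq_mset mset_eq_setD by blast

lemma finite_trace_class [simp]: "finite {u. trace_eq u w}"
  by (rule finite_subset[OF _ finite_lists_length_eq[of "set w" "length w"]])
    (auto dest: trace_eq_set trace_eq_length)

definition trace_coeff :: "'a list \<Rightarrow> 'a nc_series \<Rightarrow> int" where
  "trace_coeff t f = (\<Sum>w\<in>{u. trace_eq u t}. coeff f w)"

lemma trace_coeff_simps [simp]:
  "trace_coeff t 0 = 0" "trace_coeff t (f + g) = trace_coeff t f + trace_coeff t g"
  "trace_coeff t (f - g) = trace_coeff t f - trace_coeff t g"
  "trace_coeff t (- f) = - trace_coeff t f"
  by (simp_all add: trace_coeff_def sum.distrib sum_subtractf sum_negf)

lemma trace_coeff_one: "trace_coeff t 1 = (if t = [] then 1 else 0)"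
proof (cases "t = []")
  case True
  have "{u. trace_eq u []} = {[]}" using trace_eq_length by fastforce
  with True show ?thesis by (simp add: trace_coeff_def)
next
  case False
  then have "\<not> trace_eq [] t" using trace_eq_length by fastforce
  with False show ?thesis by (auto simp: trace_coeff_def intro!: sum.neutral)
qed

lemma finite_trace_splits: "finite {(u, v). trace_eq (u @ v) t}"
proof (rule finite_subset)
  show "{(u, v). trace_eq (u @ v) t} \<subseteq> (\<Union>w\<in>{u. trace_eq u t}. splits w)"
    by (auto simp: splits_def)
qed auto

lemma trace_coeff_times:
  "trace_coeff t (f * g) = (\<Sum>(u, v)\<in>{(u, v). trace_eq (u @ v) t}. coeff f u * coeff g v)"
proof -
  have "trace_coeff t (f * g)
      = (\<Sum>(w, p)\<in>(SIGMA w:{u. trace_eq u t}. splits w). coeff f (fst p) * coeff g (snd p))"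
    unfolding trace_coeff_def coeff_times
    by (subst sum.Sigma[symmetric]) (auto simp: case_prod_unfold)
  also have "\<dots> = (\<Sum>(u, v)\<in>{(u, v). trace_eq (u @ v) t}. coeff f u * coeff g v)"
    by (rule sum.reindex_bij_witness[of _ "\<lambda>(u, v). (u @ v, (u, v))" "\<lambda>(w, p). p"])
      (auto simp: splits_def)
  finally show ?thesis .
qed

text \<open>By right cancellation, the left factors that complete \<open>v\<close> to the trace of
  \<open>t\<close> form one trace class; this lets class sums be split off from products.\<close>

lemma trace_fibre_right:
  assumes "trace_eq (u0 @ v) t"
  shows "{u. trace_eq (u @ v) t} = {u. trace_eq u u0}"
  using assms trace_eq_append_right trace_eq_sym trace_eq_trans by blast

lemma trace_fibre_left:
  assumes "trace_eq (u @ v0) t"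
  shows "{v. trace_eq (u @ v) t} = {v. trace_eq v v0}"
  using assms trace_eq_append_left trace_eq_sym trace_eq_trans by blast

text \<open>Series over the trace monoid are represented by series over words; their coefficients are the
  sums over trace classes.\<close>

definition order_ge :: "nat \<Rightarrow> 'a nc_series set" where
  "order_ge n = {f. \<forall>t. length t < n \<longrightarrow> trace_coeff t f = 0}"

lemma order_geD: "f \<in> order_ge n \<Longrightarrow> length t < n \<Longrightarrow> trace_coeff t f = 0"
  by (simp add: order_ge_def)

lemma order_ge_0 [simp]: "f \<in> order_ge 0"
  by (simp add: order_ge_def)

lemma order_ge_antimono: "m \<le> n \<Longrightarrow> f \<in> order_ge n \<Longrightarrow> f \<in> order_ge m"
  by (auto simp: order_ge_def)

lemma order_ge_closed:
  "0 \<in> order_ge n" "f \<in> order_ge n \<Longrightarrow> g \<in> order_ge n \<Longrightarrow> f + g \<in> order_ge n"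
  "f \<in> order_ge n \<Longrightarrow> g \<in> order_ge n \<Longrightarrow> f - g \<in> order_ge n"
  "f \<in> order_ge n \<Longrightarrow> - f \<in> order_ge n"
  by (simp_all add: order_ge_def)

text \<open>In a factorisation of a trace shorter than \<open>n + m\<close>, either the left factor
  is shorter than \<open>n\<close> or the right one is shorter than \<open>m\<close>. With the other
  factor fixed, the short one runs through a full trace class by cancellation, so its class sum,
  which is 0, splits off.\<close>

lemma order_ge_times:
  assumes f: "f \<in> order_ge n" and g: "g \<in> order_ge m"
  shows "f * g \<in> order_ge (n + m)"
  unfolding order_ge_def
proof (intro CollectI allI impI)
  fix t :: "'a list" assume t: "length t < n + m"
  let ?S = "{(u, v). trace_eq (u @ v) t}"
  let ?A = "{(u, v). trace_eq (u @ v) t \<and> length u < n}"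
  let ?B = "{(u, v). trace_eq (u @ v) t \<and> \<not> length u < n}"
  have fin: "finite ?S" by (rule finite_trace_splits)
  have finA: "finite ?A" and finB: "finite ?B" by (auto intro: finite_subset[OF _ fin])
  have "(\<Sum>(u, v)\<in>?A. coeff f u * coeff g v)
      = (\<Sum>v\<in>snd ` ?A. \<Sum>p\<in>{p \<in> ?A. snd p = v}. coeff f (fst p) * coeff g (snd p))"
    using finA by (subst sum.image_gen[of _ _ snd]) (auto simp: case_prod_unfold)
  also have "\<dots> = 0"
  proof (rule sum.neutral, rule ballI)
    fix v assume "v \<in> snd ` ?A"
    then obtain u0 where u0: "trace_eq (u0 @ v) t" "length u0 < n" by auto
    have fibre: "trace_eq u u0 \<longleftrightarrow> trace_eq (u @ v) t \<and> length u < n" for u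
      using trace_fibre_right[OF u0(1)] trace_eq_length[of u u0] u0(2) by auto
    have "{p \<in> ?A. snd p = v} = (\<lambda>u. (u, v)) ` {u. trace_eq u u0}"
      by (auto simp: fibre)
    then have "(\<Sum>p\<in>{p \<in> ?A. snd p = v}. coeff f (fst p) * coeff g (snd p))
        = trace_coeff u0 f * coeff g v"
      by (simp add: sum.reindex inj_on_def trace_coeff_def sum_distrib_right)
    then show "(\<Sum>p\<in>{p \<in> ?A. snd p = v}. coeff f (fst p) * coeff g (snd p)) = 0"
      using order_geD[OF f u0(2)] by simp
  qed
  finally have A: "(\<Sum>(u, v)\<in>?A. coeff f u * coeff g v) = 0" .
  have "(\<Sum>(u, v)\<in>?B. coeff f u * coeff g v)
      = (\<Sum>u\<in>fst ` ?B. \<Sum>p\<in>{p \<in> ?B. fst p = u}. coeff f (fst p) * coeff g (snd p))"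
    using finB by (subst sum.image_gen[of _ _ fst]) (auto simp: case_prod_unfold)
  also have "\<dots> = 0"
  proof (rule sum.neutral, rule ballI)
    fix u assume "u \<in> fst ` ?B"
    then obtain v0 where v0: "trace_eq (u @ v0) t" "\<not> length u < n" by auto
    then have v0_len: "length v0 < m" using trace_eq_length[OF v0(1)] t by simp
    have fibre: "trace_eq v v0 \<longleftrightarrow> trace_eq (u @ v) t \<and> \<not> length u < n" for v
      using trace_fibre_left[OF v0(1)] v0(2) by auto
    have "{p \<in> ?B. fst p = u} = (\<lambda>v. (u, v)) ` {v. trace_eq v v0}"
      by (auto simp: fibre)
    then have "(\<Sum>p\<in>{p \<in> ?B. fst p = u}. coeff f (fst p) * coeff g (snd p))
        = coeff f u * trace_coeff v0 g"
      by (simp add: sum.reindex inj_on_def trace_coeff_def sum_distrib_left)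
    then show "(\<Sum>p\<in>{p \<in> ?B. fst p = u}. coeff f (fst p) * coeff g (snd p)) = 0"
      using order_geD[OF g v0_len] by simp
  qed
  finally have B: "(\<Sum>(u, v)\<in>?B. coeff f u * coeff g v) = 0" .
  have S: "?S = ?A \<union> ?B" and disj: "?A \<inter> ?B = {}" by auto
  have "trace_coeff t (f * g)
      = (\<Sum>(u, v)\<in>?A. coeff f u * coeff g v) + (\<Sum>(u, v)\<in>?B. coeff f u * coeff g v)"
    unfolding trace_coeff_times S by (rule sum.union_disjoint[OF finA finB disj])
  then show "trace_coeff t (f * g) = 0" using A B by simp
qed

text \<open>By right cancellation, the words of the trace of \<open>t @ [a]\<close> that end in
  \<open>a\<close> are the words of the trace of \<open>t\<close> with \<open>a\<close> appended;
  the others have coefficient 0 in \<open>f * X a\<close>.\<close>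

lemma trace_coeff_times_X: "trace_coeff (t @ [a]) (f * X a) = trace_coeff t f"
proof -
  have "trace_coeff (t @ [a]) (f * X a)
      = (\<Sum>w\<in>(\<lambda>u. u @ [a]) ` {u. trace_eq u t}. coeff (f * X a) w)"
    unfolding trace_coeff_def
  proof (rule sum.mono_neutral_right)
    show "\<forall>w\<in>{u. trace_eq u (t @ [a])} - (\<lambda>u. u @ [a]) ` {u. trace_eq u t}. coeff (f * X a) w = 0"
    proof
      fix w assume w: "w \<in> {u. trace_eq u (t @ [a])} - (\<lambda>u. u @ [a]) ` {u. trace_eq u t}"
      then have "w = u @ [a] \<Longrightarrow> False" for u by (auto simp: trace_eq_append_right)
      then show "coeff (f * X a) w = 0"
        by (cases w rule: rev_cases) (auto simp: coeff_times_X)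
    qed
  qed (auto simp: trace_eq_append_right)
  also have "\<dots> = trace_coeff t f"
    by (simp add: sum.reindex inj_on_def coeff_times_X trace_coeff_def)
  finally show ?thesis .
qed

lemma trace_coeff_X_times_eq_0:
  assumes "\<And>u. \<not> trace_eq (a # u) t"
  shows "trace_coeff t (X a * f) = 0"
  unfolding trace_coeff_def
  by (rule sum.neutral) (use assms in \<open>auto simp: coeff_X_times split: list.split\<close>)

lemma commuting_letters: "E a b \<Longrightarrow> trace_coeff t (X a * X b - X b * X a) = 0"
proof -
  assume E: "E a b"
  have "trace_coeff t (X a * X b) = (if trace_eq [a, b] t then 1 else 0)" for a b
  proof -
    have "coeff (X a * X b) w = (if w = [a, b] then 1 else 0)" for w
      by (auto simp: coeff_X_times coeff_X split: list.split)
    then show ?thesis by (simp add: trace_coeff_def sum.If_cases Int_def)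
  qed
  moreover have "trace_eq [a, b] t \<longleftrightarrow> trace_eq [b, a] t"
    using trace_eq_swap[OF E] trace_eq_sym trace_eq_trans by blast
  ultimately show ?thesis by simp
qed

end

section \<open>The Magnus expansion of a graph group\<close>

context commutation
begin

text \<open>The kernel of the passage from series over words to series over traces.\<close>

definition null :: "'a nc_series \<Rightarrow> bool" where
  "null f \<longleftrightarrow> (\<forall>t. trace_coeff t f = 0)"

lemma null_order_ge: "null f \<Longrightarrow> f \<in> order_ge n"
  by (simp add: null_def order_ge_def)

lemma null_iff_order_ge: "null f \<longleftrightarrow> (\<forall>n. f \<in> order_ge n)"
  by (auto simp: null_def order_ge_def)

lemma null_add: "null f \<Longrightarrow> null g \<Longrightarrow> null (f + g)"
  by (simp add: null_def)

lemma null_order_ge_iff: "null (f - g) \<Longrightarrow> f \<in> order_ge n \<longleftrightarrow> g \<in> order_ge n"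
  by (simp add: null_def order_ge_def)

lemma trace_coeff_Nil: "trace_coeff [] f = coeff f []"
proof -
  have "{u. trace_eq u []} = {[]}" using trace_eq_length by fastforce
  then show ?thesis by (simp add: trace_coeff_def)
qed

lemma commutator_order:
  assumes "f \<in> order_ge n" "g \<in> order_ge m"
  shows "f * g - g * f \<in> order_ge (n + m)"
  using order_ge_closed(3)[OF order_ge_times[OF assms]] order_ge_times[OF assms(2,1)]
  by (simp add: add.commute[of m n])

lemma poly_eval_order: "poly_eval s \<in> order_ge (degree s)"
proof (induction s)
  case (Letter a)
  then show ?case by (simp add: order_ge_def trace_coeff_Nil coeff_X)
next
  case (Brack s t)
  then show ?case by (simp add: commutator_order)
qed

lemma null_trans: "null (f - g) \<Longrightarrow> null (g - h) \<Longrightarrow> null (f - h)"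
  by (simp add: null_def)

lemma null_sym: "null (f - g) \<Longrightarrow> null (g - f)"
  by (simp add: null_def)

text \<open>The kernel is the intersection of all \<open>order_ge n\<close>, so it is an ideal
  because the filtration is multiplicative.\<close>

lemma null_times:
  assumes "null f"
  shows "null (f * g)" "null (g * f)"
  unfolding null_iff_order_ge
  using order_ge_times[OF null_order_ge[OF assms] order_ge_0[of g]]
    order_ge_times[OF order_ge_0[of g] null_order_ge[OF assms]] by simp_all

lemma null_times_cong:
  assumes "null (f - f')" "null (g - g')"
  shows "null (f * g - f' * g')"
proof -
  have "f * g - f' * g' = (f - f') * g + f' * (g - g')"
    by (simp add: algebra_simps)
  then show ?thesis
    using null_times(1)[OF assms(1), of g] null_times(2)[OF assms(2), of f'] by (simp add: null_def)
qed

end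

section \<open>The graph group and its expansion\<close>

text \<open>The numbering supplies the linear order on letters that Lyndon words need. The edgeless
  graph on the same vertices satisfies the same assumptions with the same letters, which allows a
  comparison with the free group.\<close>

locale indexed_graph =
  fixes \<Gamma> :: "'v pair_pre_digraph" and idx :: "'v \<Rightarrow> nat"
  assumes finite_verts: "finite (pverts \<Gamma>)"
    and arcs_verts: "(v, w) \<in> parcs \<Gamma> \<Longrightarrow> v \<in> pverts \<Gamma> \<and> w \<in> pverts \<Gamma>"
    and arcs_sym: "(v, w) \<in> parcs \<Gamma> \<Longrightarrow> (w, v) \<in> parcs \<Gamma>"
    and arcs_irrefl: "(v, v) \<notin> parcs \<Gamma>"
    and inj_idx: "inj_on idx (pverts \<Gamma>)"
begin

abbreviation G :: "'v word set monoid" where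
  "G \<equiv> raag \<Gamma>"

definition relators :: "'v word set" where
  "relators = {[(v, True), (w, True), (v, False), (w, False)] | v w. (v, w) \<in> parcs \<Gamma>}"

abbreviation cong :: "('v word \<times> 'v word) set" where
  "cong \<equiv> word_cong (pverts \<Gamma>) relators"

abbreviation cls :: "'v word \<Rightarrow> 'v word set" where
  "cls w \<equiv> cong `` {w}"

definition adj :: "nat \<Rightarrow> nat \<Rightarrow> bool" where
  "adj a b \<longleftrightarrow> (\<exists>v w. (v, w) \<in> parcs \<Gamma> \<and> a = idx v \<and> b = idx w)"

definition gen :: "nat \<Rightarrow> 'v word set" where
  "gen a = cls [(inv_into (pverts \<Gamma>) idx a, True)]"

abbreviation A :: "nat set" where
  "A \<equiv> idx ` pverts \<Gamma>"

lemma raag_eq: "G = presented_group (pverts \<Gamma>) relators"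
  by (simp add: raag_def relators_def)

sublocale group G
  unfolding raag_eq by (rule group_presented_group)

sublocale commutation adj
proof
  show "adj a b \<Longrightarrow> adj b a" for a b using arcs_sym by (auto simp: adj_def)
  show "\<not> adj a a" for a
    using arcs_verts arcs_irrefl inj_onD[OF inj_idx] by (fastforce simp: adj_def)
qed

lemma adj_idx:
  "v \<in> pverts \<Gamma> \<Longrightarrow> w \<in> pverts \<Gamma> \<Longrightarrow> adj (idx v) (idx w) \<longleftrightarrow> (v, w) \<in> parcs \<Gamma>"
proof -
  assume "v \<in> pverts \<Gamma>" "w \<in> pverts \<Gamma>"
  moreover have "v = v' \<and> w = w'"
    if "(v', w') \<in> parcs \<Gamma>" "idx v = idx v'" "idx w = idx w'" for v' w'
    using that arcs_verts[OF that(1)] calculation inj_onD[OF inj_idx] by blast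
  ultimately show ?thesis unfolding adj_def by blast
qed

lemma carrier_cls: "g \<in> carrier G \<Longrightarrow> \<exists>w\<in>words (pverts \<Gamma>). g = cls w"
  by (auto simp: raag_eq presented_group_def elim: quotientE)

lemma cls_closed [simp]: "w \<in> words (pverts \<Gamma>) \<Longrightarrow> cls w \<in> carrier G"
  by (auto simp: raag_eq presented_group_def intro: quotientI)

lemma cls_mult:
  "u \<in> words (pverts \<Gamma>) \<Longrightarrow> w \<in> words (pverts \<Gamma>) \<Longrightarrow> cls u \<otimes>\<^bsub>G\<^esub> cls w = cls (u @ w)"
  unfolding raag_eq by (rule presented_group_mult)

lemma cls_Nil: "cls [] = \<one>\<^bsub>G\<^esub>"
  by (simp add: raag_eq presented_group_def)

lemma cls_eq_iff: "u \<in> words (pverts \<Gamma>) \<Longrightarrow> w \<in> words (pverts \<Gamma>) \<Longrightarrow>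
    cls u = cls w \<longleftrightarrow> (u, w) \<in> cong"
  by (rule eq_equiv_class_iff[OF equiv_word_cong])

lemma words_simps [simp]:
  "[] \<in> words V" "(a # w) \<in> words V \<longleftrightarrow> fst a \<in> V \<and> w \<in> words V"
  "u @ w \<in> words V \<longleftrightarrow> u \<in> words V \<and> w \<in> words V"
  by (cases a; auto simp: words_def)+

lemma gen_idx: "v \<in> pverts \<Gamma> \<Longrightarrow> gen (idx v) = cls [(v, True)]"
  by (simp add: gen_def inj_idx)

lemma inv_cls_letter:
  assumes "v \<in> pverts \<Gamma>"
  shows "inv\<^bsub>G\<^esub> (cls [(v, b)]) = cls [(v, \<not> b)]"
proof (rule inv_equality)
  have "([] @ [(v, \<not> b), (v, \<not> \<not> b)] @ [], [] @ []) \<in> cong"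
    by (rule word_cong.cancel) (use assms in simp_all)
  then show "cls [(v, \<not> b)] \<otimes>\<^bsub>G\<^esub> cls [(v, b)] = \<one>\<^bsub>G\<^esub>"
    using assms by (simp add: cls_mult cls_eq_iff flip: cls_Nil)
qed (use assms in simp_all)

lemma generate_gens: "generate G (gen ` A) = carrier G"
proof
  show "generate G (gen ` A) \<subseteq> carrier G"
    by (rule generate_incl) (auto simp: gen_idx)
  have "cls w \<in> generate G (gen ` A)" if "w \<in> words (pverts \<Gamma>)" for w
    using that
  proof (induction w)
    case Nil
    show ?case unfolding cls_Nil by (rule generate.one)
  next
    case (Cons a w)
    obtain v b where a: "a = (v, b)" by (cases a)
    have v: "v \<in> pverts \<Gamma>" and w: "w \<in> words (pverts \<Gamma>)" using Cons.prems a by auto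
    have "gen (idx v) \<in> gen ` A" using v by blast
    then have "cls [(v, b)] \<in> generate G (gen ` A)"
      using generate.incl[of "cls [(v, True)]" "gen ` A" G] generate.inv[of "cls [(v, True)]" "gen ` A" G] v
      by (cases b) (simp_all add: gen_idx inv_cls_letter)
    then have "cls [(v, b)] \<otimes>\<^bsub>G\<^esub> cls w \<in> generate G (gen ` A)"
      using Cons.IH[OF w] by (rule generate.eng)
    then show ?case using v w by (simp add: cls_mult a)
  qed
  then show "carrier G \<subseteq> generate G (gen ` A)" using carrier_cls by blast
qed

sublocale generated_group G gen A
proof
  show "finite A" by (simp add: finite_verts)
  show "gen ` A \<subseteq> carrier G" by (auto simp: gen_idx)
  show "generate G (gen ` A) = carrier G" by (rule generate_gens)
qed

lemma gen_commute:
  assumes "adj a b"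
  shows "gen a \<otimes>\<^bsub>G\<^esub> gen b = gen b \<otimes>\<^bsub>G\<^esub> gen a"
proof -
  obtain v w where vw: "(v, w) \<in> parcs \<Gamma>" "a = idx v" "b = idx w"
    using assms by (auto simp: adj_def)
  then have verts: "v \<in> pverts \<Gamma>" "w \<in> pverts \<Gamma>" using arcs_verts by auto
  have "([] @ [(v, True), (w, True), (v, False), (w, False)] @ [], [] @ []) \<in> cong"
    by (rule word_cong.relator) (use vw verts in \<open>auto simp: relators_def\<close>)
  then have "cls [(v, True), (w, True), (v, False), (w, False)] = \<one>\<^bsub>G\<^esub>"
    using verts by (simp add: cls_eq_iff flip: cls_Nil)
  moreover have "commutator G (gen a) (gen b) = cls [(v, True), (w, True), (v, False), (w, False)]"
    using verts vw by (simp add: commutator_def gen_idx inv_cls_letter cls_mult)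
  ultimately show ?thesis
    using verts vw by (subst commutator_eq_one_iff[symmetric]) (auto simp: gen_idx)
qed

primrec magnus_word :: "'v word \<Rightarrow> nat nc_series" where
  "magnus_word [] = 1"
| "magnus_word (a # w) =
     (if snd a then 1 + X (idx (fst a)) else inverse_letter (idx (fst a))) * magnus_word w"

lemma magnus_word_append: "magnus_word (u @ w) = magnus_word u * magnus_word w"
  by (induction u) (simp_all add: mult.assoc)

lemma magnus_word_cong: "(u, w) \<in> cong \<Longrightarrow> null (magnus_word u - magnus_word w)"
proof (induction rule: word_cong.induct)
  case (refl w)
  then show ?case by (simp add: null_def)
next
  case (sym u w)
  show ?case by (rule null_sym[OF sym.IH])
next
  case (trans u v w)
  show ?case by (rule null_trans[OF trans.IH])
next
  case (cancel u w x b)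
  have "magnus_word [(x, b), (x, \<not> b)] = 1"
    by (cases b) (simp_all add: inverse_letter)
  then show ?case by (simp only: magnus_word_append mult_1_left) (simp add: null_def)
next
  case (relator u w r)
  then obtain v w' where r: "r = [(v, True), (w', True), (v, False), (w', False)]" "(v, w') \<in> parcs \<Gamma>"
    by (auto simp: relators_def)
  let ?a = "idx v" and ?b = "idx w'"
  let ?i = "inverse_letter ?a * inverse_letter ?b"
  have "(1 + X ?b) * (1 + X ?a) * ?i = (1 + X ?b) * ((1 + X ?a) * inverse_letter ?a) * inverse_letter ?b"
    by (simp only: mult.assoc)
  then have one: "(1 + X ?b) * (1 + X ?a) * ?i = 1"
    by (simp add: inverse_letter)
  have "magnus_word r = (1 + X ?a) * (1 + X ?b) * ?i"
    by (simp add: r mult.assoc)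
  \<comment> \<open>Swapping the first two factors costs the commutator of the two letters, and that
    is null because the letters commute.\<close>
  also have "\<dots> = ((1 + X ?b) * (1 + X ?a) + (X ?a * X ?b - X ?b * X ?a)) * ?i"
    by (simp add: algebra_simps)
  also have "\<dots> = 1 + (X ?a * X ?b - X ?b * X ?a) * ?i"
    using one by (simp only: distrib_right)
  finally have "magnus_word r - 1 = (X ?a * X ?b - X ?b * X ?a) * ?i" by simp
  moreover have "adj ?a ?b" using r by (auto simp: adj_def)
  then have "null (X ?a * X ?b - X ?b * X ?a)"
    unfolding null_def using commuting_letters by blast
  ultimately have "null (magnus_word r - 1)" by (simp add: null_times(1))
  then have "null (magnus_word u * (magnus_word r - 1) * magnus_word w)"
    by (rule null_times(1)[OF null_times(2)])
  then show ?case by (simp add: magnus_word_append algebra_simps)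
qed

text \<open>Since a representative is chosen, the value is meaningful only up to null series;
  identities between expansions are therefore stated as \<open>null\<close> of a difference.\<close>

definition magnus :: "'v word set \<Rightarrow> nat nc_series" where
  "magnus g = magnus_word (SOME w. w \<in> g)"

lemma magnus_cls:
  assumes "w \<in> words (pverts \<Gamma>)"
  shows "null (magnus (cls w) - magnus_word w)"
proof -
  have "w \<in> cls w" using assms by (auto intro: word_cong.refl)
  then have "(SOME u. u \<in> cls w) \<in> cls w" by (rule someI)
  then show ?thesis unfolding magnus_def by (intro magnus_word_cong[OF word_cong.sym]) simp
qed

lemma magnus_one: "null (magnus \<one>\<^bsub>G\<^esub> - 1)"
  using magnus_cls[of "[]"] by (simp add: cls_Nil)

lemma magnus_mult:
  assumes "g \<in> carrier G" "h \<in> carrier G"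
  shows "null (magnus (g \<otimes>\<^bsub>G\<^esub> h) - magnus g * magnus h)"
proof -
  obtain u w where u: "u \<in> words (pverts \<Gamma>)" "g = cls u" and w: "w \<in> words (pverts \<Gamma>)" "h = cls w"
    using assms carrier_cls by metis
  have "null (magnus (cls (u @ w)) - magnus_word u * magnus_word w)"
    using magnus_cls[of "u @ w"] u w by (simp add: magnus_word_append)
  moreover have "null (magnus_word u * magnus_word w - magnus (cls u) * magnus (cls w))"
    by (rule null_times_cong[OF null_sym[OF magnus_cls[OF u(1)]] null_sym[OF magnus_cls[OF w(1)]]])
  ultimately have "null (magnus (cls (u @ w)) - magnus (cls u) * magnus (cls w))"
    by (rule null_trans)
  then show ?thesis using u w by (simp add: cls_mult)
qed

lemma magnus_inv:
  assumes "g \<in> carrier G"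
  shows "null (magnus g * magnus (inv\<^bsub>G\<^esub> g) - 1)"
proof (rule null_trans[OF null_sym])
  show "null (magnus \<one>\<^bsub>G\<^esub> - magnus g * magnus (inv\<^bsub>G\<^esub> g))"
    using magnus_mult[of g "inv\<^bsub>G\<^esub> g"] assms by simp
qed (rule magnus_one)

lemma magnus_gen:
  assumes "a \<in> A"
  shows "null (magnus (gen a) - 1 - X a)"
proof -
  obtain v where v: "v \<in> pverts \<Gamma>" "a = idx v" using assms by blast
  then show ?thesis using magnus_cls[of "[(v, True)]"] by (simp add: gen_idx diff_diff_eq)
qed

end

context indexed_graph
begin

section \<open>Lowest-order terms of the expansion\<close>

lemma magnus_minus_one:
  assumes "g \<in> carrier G"
  shows "magnus g - 1 \<in> order_ge 1"
proof -
  obtain w where w: "w \<in> words (pverts \<Gamma>)" "g = cls w" using carrier_cls[OF assms] by blast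
  have "coeff (magnus_word w) [] = 1" for w
    by (induction w) (auto simp: coeff_times splits_nonempty_Nil coeff_X coeff_inverse_letter)
  then have "trace_coeff [] (magnus g) = 1"
    using magnus_cls[OF w(1)] unfolding null_def w(2) by (simp add: trace_coeff_Nil[symmetric])
  then show ?thesis by (simp add: order_ge_def trace_coeff_one)
qed

text \<open>Multiply \<open>g h - h g = (g - 1) (h - 1) - (h - 1) (g - 1)\<close> on the right by
  \<open>g^-1 h^-1\<close>.\<close>

lemma magnus_commutator:
  assumes "g \<in> carrier G" "h \<in> carrier G"
  shows "null (magnus (commutator G g h) - 1
    - ((magnus g - 1) * (magnus h - 1) - (magnus h - 1) * (magnus g - 1))
      * (magnus (inv\<^bsub>G\<^esub> g) * magnus (inv\<^bsub>G\<^esub> h)))"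
proof -
  let ?g = "magnus g" and ?h = "magnus h" and ?g' = "magnus (inv\<^bsub>G\<^esub> g)" and ?h' = "magnus (inv\<^bsub>G\<^esub> h)"
  have 1: "null (magnus (g \<otimes>\<^bsub>G\<^esub> h) - ?g * ?h)" using assms by (rule magnus_mult)
  have 2: "null (magnus (g \<otimes>\<^bsub>G\<^esub> h \<otimes>\<^bsub>G\<^esub> inv\<^bsub>G\<^esub> g) - ?g * ?h * ?g')"
    by (rule null_trans[OF magnus_mult null_times_cong[OF 1]]) (use assms in \<open>simp_all add: null_def\<close>)
  have 3: "null (magnus (commutator G g h) - ?g * ?h * ?g' * ?h')"
    unfolding commutator_def
    by (rule null_trans[OF magnus_mult null_times_cong[OF 2]]) (use assms in \<open>simp_all add: null_def\<close>)
  have 4: "null (?h * (?g * ?g' - 1) * ?h')"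
    using assms by (intro null_times(1) null_times(2) magnus_inv)
  have 5: "null (?h * ?h' - 1)" using assms by (intro magnus_inv)
  have eq: "magnus (commutator G g h) - 1
      - ((?g - 1) * (?h - 1) - (?h - 1) * (?g - 1)) * (?g' * ?h')
      = (magnus (commutator G g h) - ?g * ?h * ?g' * ?h') + ?h * (?g * ?g' - 1) * ?h' + (?h * ?h' - 1)"
    by (simp add: algebra_simps)
  show ?thesis unfolding eq by (intro null_add 3 4 5)
qed

lemma magnus_mult_minus_one:
  assumes "g \<in> carrier G" "h \<in> carrier G"
  shows "null (magnus (g \<otimes>\<^bsub>G\<^esub> h) - 1
    - ((magnus g - 1) + (magnus h - 1) + (magnus g - 1) * (magnus h - 1)))"
proof -
  have eq: "magnus (g \<otimes>\<^bsub>G\<^esub> h) - 1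
    - ((magnus g - 1) + (magnus h - 1) + (magnus g - 1) * (magnus h - 1))
    = magnus (g \<otimes>\<^bsub>G\<^esub> h) - magnus g * magnus h" by (simp add: algebra_simps)
  show ?thesis unfolding eq by (rule magnus_mult[OF assms])
qed

text \<open>An analogue of the dimension subgroups, which contain the terms of the lower central
  series.\<close>

lemma subgroup_magnus_order: "subgroup {g \<in> carrier G. magnus g - 1 \<in> order_ge n} G"
proof
  show "\<one>\<^bsub>G\<^esub> \<in> {g \<in> carrier G. magnus g - 1 \<in> order_ge n}"
    using null_order_ge[OF magnus_one] by simp
  fix g assume g: "g \<in> {g \<in> carrier G. magnus g - 1 \<in> order_ge n}"
  then have gc: "g \<in> carrier G" and go: "magnus g - 1 \<in> order_ge n" by auto
  let ?f = "magnus g - 1" and ?f' = "magnus (inv\<^bsub>G\<^esub> g) - 1"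
  \<comment> \<open>From \<open>g g^-1 = 1\<close> one gets \<open>f' = - f - f f'\<close>, and the
    right side has order at least \<open>n\<close> whatever the order of \<open>f'\<close>
    is.\<close>
  have eq: "?f' - (- ?f - ?f * ?f') = magnus g * magnus (inv\<^bsub>G\<^esub> g) - 1"
    by (simp add: algebra_simps)
  have "null (?f' - (- ?f - ?f * ?f'))" unfolding eq by (rule magnus_inv[OF gc])
  moreover have "?f * ?f' \<in> order_ge n" using order_ge_times[OF go order_ge_0] by simp
  then have "- ?f - ?f * ?f' \<in> order_ge n"
    by (rule order_ge_closed(3)[OF order_ge_closed(4)[OF go]])
  ultimately have "?f' \<in> order_ge n" by (simp only: null_order_ge_iff)
  then show "inv\<^bsub>G\<^esub> g \<in> {g \<in> carrier G. magnus g - 1 \<in> order_ge n}" using gc by simp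
  fix h assume h: "h \<in> {g \<in> carrier G. magnus g - 1 \<in> order_ge n}"
  then have hc: "h \<in> carrier G" and ho: "magnus h - 1 \<in> order_ge n" by auto
  have "?f * (magnus h - 1) \<in> order_ge n" using order_ge_times[OF go order_ge_0] by simp
  then have "?f + (magnus h - 1) + ?f * (magnus h - 1) \<in> order_ge n"
    by (rule order_ge_closed(2)[OF order_ge_closed(2)[OF go ho]])
  then have "magnus (g \<otimes>\<^bsub>G\<^esub> h) - 1 \<in> order_ge n"
    by (simp only: null_order_ge_iff[OF magnus_mult_minus_one[OF gc hc]])
  then show "g \<otimes>\<^bsub>G\<^esub> h \<in> {g \<in> carrier G. magnus g - 1 \<in> order_ge n}" using gc hc by simp
qed auto

lemma magnus_lower_central:
  "g \<in> lower_central G n \<Longrightarrow> magnus g - 1 \<in> order_ge n"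
proof (induction n arbitrary: g rule: induct_nat_012)
  case 1
  then show ?case using magnus_minus_one by simp
next
  case (ge2 n)
  let ?H = "{g \<in> carrier G. magnus g - 1 \<in> order_ge (Suc (Suc n))}"
  have "commutator G g h \<in> ?H" if g: "g \<in> lower_central G (Suc n)" and h: "h \<in> carrier G" for g h
  proof -
    have gc: "g \<in> carrier G" using g lower_central_closed by blast
    have "(magnus g - 1) * (magnus h - 1) - (magnus h - 1) * (magnus g - 1) \<in> order_ge (Suc n + 1)"
      using ge2.IH(2)[OF g] magnus_minus_one[OF h] by (rule commutator_order)
    from order_ge_times[OF this order_ge_0]
    have "((magnus g - 1) * (magnus h - 1) - (magnus h - 1) * (magnus g - 1))
        * (magnus (inv\<^bsub>G\<^esub> g) * magnus (inv\<^bsub>G\<^esub> h)) \<in> order_ge (Suc (Suc n))" by simp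
    then show ?thesis using gc h null_order_ge_iff[OF magnus_commutator[OF gc h]] by simp
  qed
  then have "lower_central G (Suc (Suc n)) \<subseteq> ?H"
    unfolding lower_central.simps by (intro commutator_subgroup_subset subgroup_magnus_order)
  then show ?case using ge2.prems by blast
qed simp

text \<open>\<open>f\<close> and \<open>f'\<close> stand for the lowest-order parts. The factor
  \<open>u\<close>, the expansion of \<open>g^-1\<close> times that of \<open>h^-1\<close>, is 1
  plus terms of positive order, so it does not affect the part of order \<open>n + m\<close>; nor do
  the corrections \<open>F - f\<close> and \<open>H - f'\<close>.\<close>

lemma magnus_commutator_leading:
  assumes "g \<in> carrier G" "h \<in> carrier G"
    and f: "magnus g - 1 - f \<in> order_ge (Suc n)" "f \<in> order_ge n"
    and f': "magnus h - 1 - f' \<in> order_ge (Suc m)" "f' \<in> order_ge m"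
  shows "magnus (commutator G g h) - 1 - (f * f' - f' * f) \<in> order_ge (Suc (n + m))"
proof -
  define F H where "F = magnus g - 1" and "H = magnus h - 1"
  define u where "u = magnus (inv\<^bsub>G\<^esub> g) * magnus (inv\<^bsub>G\<^esub> h)"
  define gi hi where "gi = magnus (inv\<^bsub>G\<^esub> g) - 1" and "hi = magnus (inv\<^bsub>G\<^esub> h) - 1"
  have Fo: "F \<in> order_ge n" "H \<in> order_ge m"
    using order_ge_closed(2)[OF order_ge_antimono[OF _ f(1)] f(2)]
      order_ge_closed(2)[OF order_ge_antimono[OF _ f'(1)] f'(2)]
    by (simp_all add: F_def H_def)
  have gi: "gi \<in> order_ge 1" "hi \<in> order_ge 1"
    using assms(1,2) magnus_minus_one by (simp_all add: gi_def hi_def)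
  have "u - 1 = gi + hi + gi * hi" by (simp add: u_def gi_def hi_def algebra_simps)
  moreover have "gi * hi \<in> order_ge 1" using order_ge_times[OF gi(1) order_ge_0] by simp
  then have "gi + hi + gi * hi \<in> order_ge 1"
    by (rule order_ge_closed(2)[OF order_ge_closed(2)[OF gi]])
  ultimately have u: "u - 1 \<in> order_ge 1" by simp
  have 1: "(F * H - H * F) * (u - 1) \<in> order_ge (Suc (n + m))"
    using order_ge_times[OF commutator_order[OF Fo] u] by simp
  have 2: "(F - f) * H \<in> order_ge (Suc (n + m))" "H * (F - f) \<in> order_ge (Suc (n + m))"
    "f * (H - f') \<in> order_ge (Suc (n + m))" "(H - f') * f \<in> order_ge (Suc (n + m))"
    using order_ge_times[of "F - f" "Suc n" H m] order_ge_times[of H m "F - f" "Suc n"]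
      order_ge_times[of f n "H - f'" "Suc m"] order_ge_times[of "H - f'" "Suc m" f n] f f' Fo
    by (simp_all add: F_def H_def add.commute)
  have "F * H - H * F - (f * f' - f' * f)
      = ((F - f) * H - H * (F - f)) + (f * (H - f') - (H - f') * f)"
    by (simp add: algebra_simps)
  also have "\<dots> \<in> order_ge (Suc (n + m))"
    by (intro order_ge_closed 2)
  finally have 3: "F * H - H * F - (f * f' - f' * f) \<in> order_ge (Suc (n + m))" .
  have "(F * H - H * F) * u - (f * f' - f' * f)
      = (F * H - H * F) * (u - 1) + (F * H - H * F - (f * f' - f' * f))"
    by (simp add: right_diff_distrib)
  also have "\<dots> \<in> order_ge (Suc (n + m))" using 1 3 by (rule order_ge_closed(2))
  finally have 4: "(F * H - H * F) * u - (f * f' - f' * f) \<in> order_ge (Suc (n + m))" .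
  have 5: "magnus (commutator G g h) - 1 - (F * H - H * F) * u \<in> order_ge (Suc (n + m))"
    using null_order_ge[OF magnus_commutator[OF assms(1,2)]] by (simp add: F_def H_def u_def)
  have "magnus (commutator G g h) - 1 - (f * f' - f' * f)
      = (magnus (commutator G g h) - 1 - (F * H - H * F) * u)
        + ((F * H - H * F) * u - (f * f' - f' * f))" by simp
  then show ?thesis using order_ge_closed(2)[OF 5 4] by (simp only:)
qed

definition lcoeff :: "nat list \<Rightarrow> 'v word set \<Rightarrow> int" where
  "lcoeff t g = trace_coeff t (magnus g)"

lemma lcoeff_eq: "t \<noteq> [] \<Longrightarrow> lcoeff t g = trace_coeff t (magnus g - 1)"
  by (simp add: lcoeff_def trace_coeff_one)

lemma lcoeff_lower_central:
  assumes "g \<in> lower_central G n" "length t < n" "t \<noteq> []"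
  shows "lcoeff t g = 0"
  using order_geD[OF magnus_lower_central[OF assms(1)] assms(2)] assms(3) by (simp add: lcoeff_eq)

text \<open>The cross term has order at least twice the length of \<open>t\<close>, which exceeds
  that length as \<open>t\<close> is nonempty. Hence traces of length \<open>n\<close> give
  homomorphisms from \<open>L_n\<close> to the integers.\<close>

lemma lcoeff_mult:
  assumes "g \<in> lower_central G (length t)" "h \<in> lower_central G (length t)" "t \<noteq> []"
  shows "lcoeff t (g \<otimes>\<^bsub>G\<^esub> h) = lcoeff t g + lcoeff t h"
proof -
  have "trace_coeff t ((magnus g - 1) * (magnus h - 1)) = 0"
    by (rule order_geD[OF order_ge_times[OF magnus_lower_central[OF assms(1)]
      magnus_lower_central[OF assms(2)]]]) (use assms(3) in simp)
  moreover have "trace_coeff t (magnus (g \<otimes>\<^bsub>G\<^esub> h) - 1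
      - ((magnus g - 1) + (magnus h - 1) + (magnus g - 1) * (magnus h - 1))) = 0"
    using magnus_mult_minus_one[OF assms(1,2)[THEN lower_central_closed]] unfolding null_def by blast
  ultimately show ?thesis
    by (simp only: lcoeff_eq[OF assms(3)] trace_coeff_simps)
qed

lemma lcoeff_one: "t \<noteq> [] \<Longrightarrow> lcoeff t \<one>\<^bsub>G\<^esub> = 0"
  using magnus_one by (simp add: lcoeff_eq null_def)

lemma lcoeff_inv:
  assumes "g \<in> lower_central G (length t)" "t \<noteq> []"
  shows "lcoeff t (inv\<^bsub>G\<^esub> g) = - lcoeff t g"
  using lcoeff_mult[OF assms(1) subgroup.m_inv_closed[OF subgroup_lower_central assms(1)] assms(2)]
    lcoeff_one[OF assms(2)] lower_central_closed[OF assms(1)] by simp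

lemma lcoeff_nat_pow:
  assumes "g \<in> lower_central G (length t)" "t \<noteq> []"
  shows "lcoeff t (g [^]\<^bsub>G\<^esub> (k::nat)) = int k * lcoeff t g \<and> g [^]\<^bsub>G\<^esub> k \<in> lower_central G (length t)"
proof (induction k)
  case 0
  then show ?case using assms by (simp add: lcoeff_one subgroup.one_closed subgroup_lower_central)
next
  case (Suc k)
  then show ?case
    using assms by (simp add: lcoeff_mult subgroup.m_closed[OF subgroup_lower_central] algebra_simps)
qed

lemma lcoeff_int_pow:
  assumes "g \<in> lower_central G (length t)" "t \<noteq> []"
  shows "lcoeff t (g [^]\<^bsub>G\<^esub> (k::int)) = k * lcoeff t g"
proof (cases "k < 0")
  case True
  note pow = lcoeff_nat_pow[OF assms, of "nat (- k)"]
  have "g [^]\<^bsub>G\<^esub> k = inv\<^bsub>G\<^esub> (g [^]\<^bsub>G\<^esub> nat (- k))"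
    using True by (simp only: int_pow_def2 if_True)
  then show ?thesis
    using lcoeff_inv[OF conjunct2[OF pow] assms(2)] conjunct1[OF pow] True by (simp only:) simp
next
  case False
  have "g [^]\<^bsub>G\<^esub> k = g [^]\<^bsub>G\<^esub> nat k"
    using False by (simp only: int_pow_def2 if_False)
  then show ?thesis
    using conjunct1[OF lcoeff_nat_pow[OF assms, of "nat k"]] False by (simp only:) simp
qed

lemma lcoeff_span_eq_0:
  assumes Y: "Y \<subseteq> lower_central G (length t)" "\<And>y. y \<in> Y \<Longrightarrow> lcoeff t y = 0" and t: "t \<noteq> []"
    and x: "x \<in> lcs_span (length t) Y"
  shows "lcoeff t x = 0"
proof -
  have sub: "subgroup {x \<in> lower_central G (length t). lcoeff t x = 0} G"
  proof
    show "{x \<in> lower_central G (length t). lcoeff t x = 0} \<subseteq> carrier G"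
      using lower_central_subset by blast
  qed (use t subgroup_lower_central in \<open>auto simp: lcoeff_mult lcoeff_one lcoeff_inv
      subgroup.m_closed subgroup.one_closed subgroup.m_inv_closed\<close>)
  have "lcs_span (length t) Y \<subseteq> {x \<in> lower_central G (length t). lcoeff t x = 0}"
    using Y lower_central_Suc_subset lcoeff_lower_central[of _ "Suc (length t)" t] t
    by (intro lcs_span_subset[OF sub]) auto
  then show ?thesis using x by blast
qed

lemma magnus_group_eval:
  "letters s \<subseteq> A \<Longrightarrow> magnus (group_eval s) - 1 - poly_eval s \<in> order_ge (Suc (degree s))"
proof (induction s)
  case (Letter a)
  then show ?case using null_order_ge[OF magnus_gen] by simp
next
  case (Brack s t)
  then have "group_eval s \<in> carrier G" "group_eval t \<in> carrier G"
    using group_eval_lower_central lower_central_closed by auto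
  then show ?case
    using Brack magnus_commutator_leading[OF _ _ _ poly_eval_order _ poly_eval_order] by simp
qed

lemma lcoeff_group_eval:
  assumes "letters s \<subseteq> A" "length t = degree s"
  shows "lcoeff t (group_eval s) = trace_coeff t (poly_eval s)"
proof -
  have "t \<noteq> []" using assms(2) degree_pos[of s] by auto
  then show ?thesis
    using order_geD[OF magnus_group_eval[OF assms(1)], of t] assms(2) by (simp add: lcoeff_eq)
qed

lemma lcoeff_commutator_gen:
  assumes g: "g \<in> lower_central G (length t)" and t: "t = a # s" and b: "b \<in> A" "b \<noteq> a" "\<not> adj a b"
  shows "lcoeff (t @ [b]) (commutator G g (gen b)) = lcoeff t g"
proof -
  have gb: "gen b \<in> carrier G" using b by (auto simp: gen_idx)
  have gc: "g \<in> carrier G" using g lower_central_closed by blast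
  let ?F = "magnus g - 1"
  have "X b \<in> order_ge 1" using poly_eval_order[of "Letter b"] by simp
  then have "magnus (commutator G g (gen b)) - 1 - (?F * X b - X b * ?F)
      \<in> order_ge (Suc (length t + 1))"
    using gc gb magnus_lower_central[OF g] null_order_ge[OF magnus_gen[OF b(1)]] order_ge_closed(1)
    by (intro magnus_commutator_leading) simp_all
  then have "lcoeff (t @ [b]) (commutator G g (gen b)) = trace_coeff (t @ [b]) (?F * X b - X b * ?F)"
    using order_geD[of _ _ "t @ [b]"] by (fastforce simp: lcoeff_eq)
  \<comment> \<open>Project to the noncommuting letters \<open>a\<close> and \<open>b\<close>: one
    word begins with \<open>b\<close>, the other with \<open>a\<close>.\<close>
  moreover have "\<not> trace_eq (b # u) (t @ [b])" for u
  proof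
    assume "trace_eq (b # u) (t @ [b])"
    then have "filter (\<lambda>x. x = a \<or> x = b) (b # u) = filter (\<lambda>x. x = a \<or> x = b) (t @ [b])"
      using b unfolding trace_eq_def by blast
    then show False using t b by simp
  qed
  then have "trace_coeff (t @ [b]) (X b * ?F) = 0" by (rule trace_coeff_X_times_eq_0)
  ultimately show ?thesis
    using t by (simp only: trace_coeff_simps trace_coeff_times_X) (simp add: lcoeff_eq)
qed

end

section \<open>Leading words and normal Lyndon words\<close>

text \<open>Homogeneity is included because the lexicographic order is in general compatible with
  products of words only when lengths agree.\<close>

definition leads :: "'a::linorder list \<Rightarrow> 'a nc_series \<Rightarrow> bool" where
  "leads w f \<longleftrightarrow> coeff f w = 1 \<and> (\<forall>x. coeff f x \<noteq> 0 \<longrightarrow> length x = length w \<and> w \<le> x)"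

lemma leads_coeff: "leads w f \<Longrightarrow> coeff f w = 1"
  by (simp add: leads_def)

lemma leadsD: "leads w f \<Longrightarrow> coeff f x \<noteq> 0 \<Longrightarrow> length x = length w \<and> w \<le> x"
  unfolding leads_def by blast

lemma leads_X: "leads [a] (X a)"
  by (auto simp: leads_def coeff_X)

lemma append_mono_length:
  fixes u v :: "'a::linorder list"
  assumes "length u' = length u" "u \<le> u'" "v \<le> v'"
  shows "u @ v \<le> u' @ v'"
proof (cases "u = u'")
  case True
  then show ?thesis using assms(3) less_append_prefix[of u v v'] by (auto simp: le_less)
next
  case False
  then have "u < u'" using assms by simp
  moreover have "\<nexists>z. u' = u @ z" using False assms(1) by auto
  ultimately show ?thesis using less_append_right less_imp_le by blast
qed

lemma append_eq_append_longer:
  assumes "a @ b = c @ d" "length c \<le> length a"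
  obtains z where "a = c @ z" "d = z @ b"
proof
  have "take (length c) (a @ b) = c" "drop (length c) (a @ b) = d" using assms by simp_all
  then have c: "take (length c) a = c" and d: "drop (length c) a @ b = d" using assms(2) by simp_all
  show "a = c @ drop (length c) a" using c by (metis append_take_drop_id)
  show "d = drop (length c) a @ b" using d by simp
qed

lemma leads_times:
  assumes "leads u f" "leads v g"
  shows "leads (u @ v) (f * g)"
  unfolding leads_def
proof (intro conjI allI impI)
  have "coeff (f * g) (u @ v) = (\<Sum>(x, y)\<in>{(u, v)}. coeff f x * coeff g y)"
    unfolding coeff_times
  proof (rule sum.mono_neutral_right)
    show "\<forall>p\<in>splits (u @ v) - {(u, v)}. (case p of (x, y) \<Rightarrow> coeff f x * coeff g y) = 0"
    proof
      fix p assume p: "p \<in> splits (u @ v) - {(u, v)}"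
      obtain x y where xy: "p = (x, y)" by (cases p)
      have "length x \<noteq> length u" using p xy by (auto simp: splits_def)
      then have "coeff f x = 0" using leadsD[OF assms(1)] by blast
      then show "(case p of (x, y) \<Rightarrow> coeff f x * coeff g y) = 0" by (simp add: xy)
    qed
  qed (auto simp: splits_def[of "u @ v"] intro: finite_splits[unfolded splits_def])
  then show "coeff (f * g) (u @ v) = 1" using assms by (simp add: leads_coeff)
  fix x assume "coeff (f * g) x \<noteq> 0"
  then obtain p where "p \<in> splits x" "(case p of (y, z) \<Rightarrow> coeff f y * coeff g z) \<noteq> 0"
    unfolding coeff_times by (meson sum.not_neutral_contains_not_neutral)
  then obtain y z where yz: "x = y @ z" "coeff f y \<noteq> 0" "coeff g z \<noteq> 0"
    by (auto simp: splits_def)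
  then have "length y = length u \<and> u \<le> y" "length z = length v \<and> v \<le> z"
    using leadsD assms by blast+
  then show "length x = length (u @ v)" "u @ v \<le> x"
    using append_mono_length[of y u v z] yz(1) by simp_all
qed

lemma leads_commutator:
  assumes "leads u f" "leads v g" "u @ v < v @ u"
  shows "leads (u @ v) (f * g - g * f)"
proof -
  note fg = leads_times[OF assms(1,2)] and gf = leads_times[OF assms(2,1)]
  have "coeff (g * f) (u @ v) = 0"
  proof (rule ccontr)
    assume "coeff (g * f) (u @ v) \<noteq> 0"
    from leadsD[OF gf this] show False using assms(3) by auto
  qed
  then have "coeff (f * g - g * f) (u @ v) = 1" using leads_coeff[OF fg] by simp
  moreover have "length x = length (u @ v) \<and> u @ v \<le> x"
    if "coeff (f * g - g * f) x \<noteq> 0" for x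
  proof -
    have "coeff (f * g) x \<noteq> 0 \<or> coeff (g * f) x \<noteq> 0" using that by auto
    then show ?thesis
    proof
      assume "coeff (f * g) x \<noteq> 0"
      from leadsD[OF fg this] show ?thesis .
    next
      assume "coeff (g * f) x \<noteq> 0"
      from leadsD[OF gf this] show ?thesis using assms(3) by auto
    qed
  qed
  ultimately show ?thesis unfolding leads_def by blast
qed

lemma leads_lyndon_brack: "lyndon w \<Longrightarrow> leads w (poly_eval (lyndon_brack w))"
proof (induction w rule: lyndon_brack.induct)
  case (1 w)
  show ?case
  proof (cases "length w \<ge> 2")
    case True
    have fac: "lyndon (lfactor w)" "lyndon (rfactor w)" "lfactor w < rfactor w"
      using "1.prems" True lyndon_lfactor lyndon_rfactor lfactor_less_rfactor by auto
    have "leads (lfactor w @ rfactor w) (poly_eval (lyndon_brack w))"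
      using leads_commutator[OF "1.IH"(1)[OF True fac(1)] "1.IH"(2)[OF True fac(2)]
          lyndon_append_swap[OF fac]] True
      by (simp add: lyndon_brack.simps[of w])
    then show ?thesis using factorisation(1)[OF True] by simp
  next
    case False
    then obtain a where "w = [a]"
      using lyndon_not_Nil[OF "1.prems"] by (cases w; cases "tl w") auto
    then show ?thesis by (simp add: lyndon_brack_letter leads_X)
  qed
qed

definition left_normed :: "'a \<Rightarrow> 'a list \<Rightarrow> 'a lie_word" where
  "left_normed b u = foldl (\<lambda>t c. Brack t (Letter c)) (Letter b) u"

lemma left_normed_simps [simp]:
  "left_normed b [] = Letter b"
  "left_normed b (u @ [c]) = Brack (left_normed b u) (Letter c)"
  by (simp_all add: left_normed_def)

lemma letters_left_normed: "letters (left_normed b u) = insert b (set u)"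
  by (induction u rule: rev_induct) auto

lemma degree_left_normed: "degree (left_normed b u) = Suc (length u)"
  by (induction u rule: rev_induct) auto

text \<open>As \<open>b\<close> is below every other letter, \<open>b # u @ [c] < c # b # u\<close>
  at each stage. The words are Lyndon, but this bracketing is not always the standard one; it is
  used where it vanishes in the group.\<close>

lemma leads_left_normed:
  "(\<And>c. c \<in> set u \<Longrightarrow> b < c) \<Longrightarrow> leads (b # u) (poly_eval (left_normed b u))"
proof (induction u rule: rev_induct)
  case Nil
  then show ?case by (simp add: leads_X)
next
  case (snoc c u)
  then have "leads (b # u) (poly_eval (left_normed b u))" by simp
  from leads_commutator[OF this leads_X[of c]] show ?case using snoc.prems by simp
qed

context commutation
begin

lemma trace_eq_move:
  assumes "\<And>c. c \<in> set z \<Longrightarrow> E a c"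
  shows "trace_eq (a # z) (z @ [a])"
  unfolding trace_eq_def
proof (intro allI impI)
  fix p q assume pq: "\<not> E p q"
  show "filter (\<lambda>x. x = p \<or> x = q) (a # z) = filter (\<lambda>x. x = p \<or> x = q) (z @ [a])"
  proof (cases "a = p \<or> a = q")
    case True
    then have "filter (\<lambda>x. x = p \<or> x = q) z = []"
      using assms pq E_sym E_irrefl by (auto simp: filter_empty_conv)
    then show ?thesis by simp
  qed simp
qed

end

section \<open>Greatest representatives of traces\<close>

locale ordered_commutation = commutation E for E :: "'a::linorder \<Rightarrow> 'a \<Rightarrow> bool"
begin

definition normal_word :: "'a list \<Rightarrow> bool" where
  "normal_word w \<longleftrightarrow> (\<forall>u. trace_eq u w \<longrightarrow> u \<le> w)"

text \<open>Every other word of the trace of \<open>w\<close> lies below \<open>w \<le> x\<close>,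
  where \<open>f\<close> has no support. So the class sum reduces to the coefficient at
  \<open>w\<close>.\<close>

lemma trace_coeff_leads:
  assumes "leads x f" "normal_word w" "w \<le> x"
  shows "trace_coeff w f = (if x = w then 1 else 0)"
proof -
  have zero: "coeff f u = 0" if "trace_eq u w" "u \<noteq> x" for u
    using leadsD[OF assms(1), of u] assms(2,3) that unfolding normal_word_def by fastforce
  show ?thesis
  proof (cases "x = w")
    case True
    have "trace_coeff w f = (\<Sum>u\<in>{w}. coeff f u)"
      unfolding trace_coeff_def by (rule sum.mono_neutral_right) (use zero True in auto)
    then show ?thesis using True leads_coeff[OF assms(1)] by simp
  next
    case False
    then have "\<not> trace_eq x w" using assms unfolding normal_word_def by fastforce
    then show ?thesis using False zero unfolding trace_coeff_def by (auto intro!: sum.neutral)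
  qed
qed

lemma not_normal_word_factor:
  assumes "b < a" "\<And>c. c \<in> set (b # u) \<Longrightarrow> E a c"
  shows "\<not> normal_word (x @ b # u @ a # y)"
proof -
  have "trace_eq (a # b # u) (b # u @ [a])" using trace_eq_move[of "b # u" a] assms(2) by simp
  then have "trace_eq (x @ (a # b # u) @ y) (x @ (b # u @ [a]) @ y)"
    by (simp only: trace_eq_append_left trace_eq_append_right)
  moreover have "x @ (b # u @ [a]) @ y < x @ (a # b # u) @ y"
    using assms(1) by (simp add: less_append_prefix)
  ultimately show ?thesis unfolding normal_word_def by (fastforce simp: not_le)
qed

lemma not_normal_wordE:
  assumes "\<not> normal_word w"
  obtains x b u a y where "w = x @ b # u @ a # y" "b < a"
    "\<And>c. c \<in> set (b # u) \<Longrightarrow> E a c" "\<And>c. c \<in> set u \<Longrightarrow> a < c"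
proof -
  obtain w' where w': "trace_eq w' w" "w < w'" using assms by (auto simp: normal_word_def)
  obtain x b z a z' where split: "w = x @ b # z" "w' = x @ a # z'" "b \<noteq> a"
  proof -
    have len: "length w = length w'" using trace_eq_length[OF w'(1)] by simp
    have "\<exists>x b z a z'. w = x @ b # z \<and> w' = x @ a # z' \<and> b \<noteq> a"
      if "length w = length w'" "w \<noteq> w'" for w w' :: "'a list"
      using that
    proof (induction w w' rule: list_induct2)
      case (Cons c w d w')
      show ?case
      proof (cases "c = d")
        case True
        with Cons obtain x b z a z' where "w = x @ b # z" "w' = x @ a # z'" "b \<noteq> a" by blast
        with True have "c # w = (c # x) @ b # z \<and> d # w' = (c # x) @ a # z' \<and> b \<noteq> a" by simp
        then show ?thesis by blast
      next
        case False
        then have "c # w = [] @ c # w \<and> d # w' = [] @ d # w' \<and> c \<noteq> d" by simp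
        then show ?thesis by blast
      qed
    qed simp
    from this[OF len] that w'(2) show ?thesis by blast
  qed
  have ba: "b < a" using w'(2) split by (auto simp: less_append_prefix)
  have eq: "trace_eq (a # z') (b # z)" using w'(1) split by (simp add: trace_eq_append_left)
  then have "a \<in> set z" using trace_eq_set[OF eq] split(3) by auto
  then obtain v y where z: "z = v @ a # y" "a \<notin> set v" by (meson split_list_first)
  \<comment> \<open>Otherwise the projections of two equal traces to \<open>a\<close> and
    \<open>c\<close> would begin with \<open>a\<close> and with \<open>c\<close>
    respectively.\<close>
  have E: "E a c" if c: "c \<in> set (b # v)" for c
  proof (rule ccontr)
    assume "\<not> E a c"
    then have "filter (\<lambda>q. q = a \<or> q = c) (a # z') = filter (\<lambda>q. q = a \<or> q = c) (b # z)"
      using eq unfolding trace_eq_def by blast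
    moreover have "c \<noteq> a" using c z split(3) by auto
    moreover have "\<exists>r. filter (\<lambda>q. q = a \<or> q = c) (b # v) = c # r"
      using c z(2) split(3)
    proof -
      have "set (filter (\<lambda>q. q = a \<or> q = c) (b # v)) = {c}" using c z(2) split(3) by auto
      then show ?thesis by (cases "filter (\<lambda>q. q = a \<or> q = c) (b # v)") auto
    qed
    moreover have "filter (\<lambda>q. q = a \<or> q = c) (b # z)
        = filter (\<lambda>q. q = a \<or> q = c) (b # v) @ filter (\<lambda>q. q = a \<or> q = c) (a # y)"
      using z by simp
    ultimately show False by auto
  qed
  \<comment> \<open>Starting the factor at the last letter below \<open>a\<close> leaves only
    letters above \<open>a\<close> in between; equality is excluded as \<open>E\<close> is
    irreflexive.\<close>
  have "\<exists>p\<in>set (b # v). p < a" using ba by simp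
  then obtain p d u where u: "b # v = p @ d # u" "d < a" "\<forall>c\<in>set u. \<not> c < a"
    by (rule split_list_last_propE)
  have "w = (x @ p) @ d # u @ a # y"
    using split(1) z(1) u(1) by (metis append.assoc append_Cons)
  moreover have "a < c" if "c \<in> set u" for c
  proof -
    have "c \<in> set (b # v)" using that u(1) by simp
    then have "c \<noteq> a" using E E_irrefl by blast
    then show ?thesis using u(3) that by auto
  qed
  moreover have "E a c" if "c \<in> set (d # u)" for c
    using that E u(1) by (metis Un_iff set_append)
  ultimately show thesis using that u(2) by blast
qed

text \<open>A forbidden factor \<open>b u a\<close> of \<open>w\<close> that lies in neither standard factor straddles the cut. Since
  the right factor is the least proper suffix of \<open>w\<close> and starts with a letter above \<open>b\<close>, the
  letter \<open>b\<close> is then the first letter of \<open>w\<close> and occurs nowhere else.\<close>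

lemma lyndon_not_normal_cases:
  assumes w: "lyndon w" "\<not> normal_word w"
  obtains (left) "length w \<ge> 2" "\<not> normal_word (lfactor w)"
  | (right) "length w \<ge> 2" "\<not> normal_word (rfactor w)"
  | (head) b u a y where "w = b # u @ a # y" "\<And>c. c \<in> set (b # u) \<Longrightarrow> E a c"
      "\<And>c. c \<in> set (u @ a # y) \<Longrightarrow> b < c"
proof -
  obtain x b u a y where f: "w = x @ b # u @ a # y" "b < a"
    "\<And>c. c \<in> set (b # u) \<Longrightarrow> E a c" "\<And>c. c \<in> set u \<Longrightarrow> a < c"
    by (rule not_normal_wordE[OF w(2)]) blast
  have len: "length w \<ge> 2" using f(1) by simp
  note fac = factorisation[OF len]
  have eq: "lfactor w @ rfactor w = x @ b # u @ a # y" using fac f(1) by simp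
  consider "length (x @ b # u @ [a]) \<le> length (lfactor w)" | "length (lfactor w) \<le> length x"
    | "length x < length (lfactor w)" "length (lfactor w) < length (x @ b # u @ [a])" by linarith
  then show thesis
  proof cases
    case 1
    have "lfactor w @ rfactor w = (x @ b # u @ [a]) @ y" using eq by simp
    then obtain y1 where "lfactor w = (x @ b # u @ [a]) @ y1"
      using 1 by (rule append_eq_append_longer)
    then have "lfactor w = x @ b # u @ a # y1" by simp
    then show thesis using left[OF len] not_normal_word_factor[OF f(2,3)] by simp
  next
    case 2
    then obtain x1 where "rfactor w = x1 @ b # u @ a # y"
      by (rule append_eq_append_longer[OF eq[symmetric]])
    then show thesis using right[OF len] not_normal_word_factor[OF f(2,3)] by simp
  next
    case 3
    obtain z where z: "lfactor w = x @ z" "z @ rfactor w = b # u @ a # y"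
      using append_eq_append_longer[OF eq] 3(1) by (metis less_imp_le)
    have "z \<noteq> []" using z(1) 3(1) by auto
    then obtain u1 where u1: "z = b # u1" "u1 @ rfactor w = u @ a # y"
      using z(2) by (cases z) auto
    have "length u1 \<le> length u" using 3(2) z(1) u1(1) by simp
    then obtain u2 where u2: "u = u1 @ u2" "rfactor w = u2 @ a # y"
      by (rule append_eq_append_longer[OF u1(2)[symmetric]])
    define d where "d = hd (rfactor w)"
    \<comment> \<open>The first letter of the right factor lies in \<open>u\<close> or is
      \<open>a\<close>, in either case above \<open>b\<close>.\<close>
    have d: "b < d" "rfactor w = d # tl (rfactor w)"
      using u2 f(2,4) unfolding d_def by (cases u2; force)+
    have x: "x = []"
    proof (rule ccontr)
      assume "x \<noteq> []"
      then have "rfactor w \<le> b # u @ a # y" using rfactor_le[of w x "b # u @ a # y"] f(1) by simp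
      then show False using d by (metis Cons_le_Cons less_asym less_irrefl)
    qed
    have "b < c" if c: "c \<in> set y" for c
    proof -
      obtain y1 y2 where y: "y = y1 @ c # y2" using split_list[OF c] by blast
      then have "rfactor w \<le> c # y2"
        using rfactor_le[of w "x @ b # u @ a # y1" "c # y2"] f(1) by simp
      then have "d \<le> c" using d by (metis Cons_le_Cons less_imp_le order_refl)
      then show ?thesis using d(1) by simp
    qed
    moreover have "b < c" if "c \<in> set u" for c using f(2) f(4)[OF that] by simp
    ultimately show thesis using head[of b u a y] f x by auto
  qed
qed

end

section \<open>Independence of normal Lyndon commutators\<close>

context group
begin

lemma lcs_span_empty: "lcs_span n {} = lower_central G (Suc n)"
  using lcs_span_subset[OF subgroup_lower_central, of "{}" "Suc n" n] lower_central_subset_span[of n "{}"]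
  by auto

text \<open>\<open>\<gamma>_n\<close> is central modulo \<open>\<gamma>_(n+1)\<close>, so the span
  of \<open>Y\<close> is normalised by the group and the products \<open>a^c z\<close> are closed
  under multiplication and inversion.\<close>

lemma lcs_span_insertE:
  assumes a: "a \<in> lower_central G n" and Y: "Y \<subseteq> lower_central G n" and n: "n \<ge> 1"
    and x: "x \<in> lcs_span n (insert a Y)"
  obtains c :: int and z where "z \<in> lcs_span n Y" "x = a [^] c \<otimes> z"
proof -
  let ?S = "lcs_span n Y"
  have aG: "a \<in> carrier G" using a lower_central_closed by blast
  have Yc: "Y \<subseteq> carrier G" using Y lower_central_closed by blast
  have S: "subgroup ?S G" by (rule subgroup_lcs_span[OF Yc])
  have SG: "z \<in> carrier G" if "z \<in> ?S" for z using subgroup.mem_carrier[OF S that] .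
  have conj: "g \<otimes> z \<otimes> inv g \<in> ?S" if g: "g \<in> carrier G" and z: "z \<in> ?S" for g z
  proof -
    have "commutator G z g \<in> lower_central G (n + 1)"
      using z g n lcs_span_subset_lower_central[OF Y] by (intro commutator_lower_central) auto
    then have "commutator G z g \<in> ?S" using lower_central_subset_span[of n Y] by auto
    then have "commutator G g z \<in> ?S"
      using commutator_mem_swap[OF S SG[OF z] g] by blast
    then have "commutator G g z \<otimes> z \<in> ?S" using subgroup.m_closed[OF S _ z] by blast
    then show ?thesis using g SG[OF z] by (simp add: commutator_def group_normalise)
  qed
  let ?H = "{x. \<exists>c::int. \<exists>z\<in>?S. x = a [^] c \<otimes> z}"
  have H: "subgroup ?H G"
  proof
    show "?H \<subseteq> carrier G" using aG SG by auto
    have "\<one> = a [^] (0::int) \<otimes> \<one>" by simp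
    then show "\<one> \<in> ?H" using subgroup.one_closed[OF S] by blast
  next
    fix x assume "x \<in> ?H"
    then obtain c z where x: "x = a [^] (c::int) \<otimes> z" "z \<in> ?S" by blast
    have "a [^] c \<otimes> inv z \<otimes> inv (a [^] c) \<in> ?S"
      using x(2) aG by (intro conj subgroup.m_inv_closed[OF S]) auto
    moreover have "inv x = a [^] (- c) \<otimes> (a [^] c \<otimes> inv z \<otimes> inv (a [^] c))"
      using x aG SG[OF x(2)] by (simp add: int_pow_neg group_normalise)
    ultimately show "inv x \<in> ?H" by blast
    fix y assume "y \<in> ?H"
    then obtain d z' where y: "y = a [^] (d::int) \<otimes> z'" "z' \<in> ?S" by blast
    have "inv (a [^] d) \<otimes> z \<otimes> inv (inv (a [^] d)) \<otimes> z' \<in> ?S"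
      using x(2) y(2) aG by (intro subgroup.m_closed[OF S] conj) auto
    moreover have "x \<otimes> y = a [^] (c + d) \<otimes> (inv (a [^] d) \<otimes> z \<otimes> inv (inv (a [^] d)) \<otimes> z')"
      using x y aG SG[OF x(2)] SG[OF y(2)] by (simp add: int_pow_mult group_normalise)
    ultimately show "x \<otimes> y \<in> ?H" by blast
  qed
  have "a = a [^] (1::int) \<otimes> \<one>" using aG by (simp add: int_pow_1)
  then have "a \<in> ?H" using subgroup.one_closed[OF S] by blast
  moreover have "z \<in> ?H" if "z \<in> ?S" for z
  proof -
    have "z = a [^] (0::int) \<otimes> z" using SG[OF that] by simp
    then show ?thesis using that by blast
  qed
  ultimately have "lcs_span n (insert a Y) \<subseteq> ?H"
    using lower_central_subset_span[of n Y] lcs_span_incl[of _ Y n]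
    by (intro lcs_span_subset[OF H]) auto
  then show thesis using x that by blast
qed

lemma lcs_coset_pow_mult:
  assumes "a \<in> lower_central G n" "b \<in> lower_central G n" "n \<ge> 1"
  shows "lcs_coset (Suc n) ((a \<otimes> b) [^] (p::nat)) = lcs_coset (Suc n) (a [^] p \<otimes> b [^] p)"
proof (induction p)
  case (Suc p)
  note carr = assms(1,2)[THEN lower_central_closed]
  have sub: "subgroup (lower_central G n) G" by (rule subgroup_lower_central)
  have powb: "b [^] p \<in> lower_central G n"
    using subgroup_int_pow_closed[OF sub assms(2), of "int p"] by (simp add: int_pow_int)
  have "lcs_coset (Suc n) ((a \<otimes> b) [^] Suc p) = lcs_coset (Suc n) (a [^] p \<otimes> b [^] p) <#> lcs_coset (Suc n) (a \<otimes> b)"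
    using carr Suc by (simp add: lcs_coset_mult)
  also have "\<dots> = lcs_coset (Suc n) (a [^] p) <#> lcs_coset (Suc n) (b [^] p \<otimes> a) <#> lcs_coset (Suc n) b"
    using carr by (simp add: m_assoc flip: lcs_coset_mult)
  also have "lcs_coset (Suc n) (b [^] p \<otimes> a) = lcs_coset (Suc n) (a \<otimes> b [^] p)"
    by (rule lcs_coset_commute[OF powb assms(1)]) (use assms in auto)
  also have "lcs_coset (Suc n) (a [^] p) <#> lcs_coset (Suc n) (a \<otimes> b [^] p) <#> lcs_coset (Suc n) b
      = lcs_coset (Suc n) (a [^] Suc p \<otimes> b [^] Suc p)"
    using carr by (simp add: m_assoc flip: lcs_coset_mult)
  finally show ?case .
qed simp

end

context indexed_graph
begin

sublocale ordered_commutation adj ..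

lemma lcoeff_lyndon_elem:
  assumes "w \<in> lyndon_words n" "normal_word t" "length t = n" "t \<le> w"
  shows "lcoeff t (lyndon_elem w) = (if w = t then 1 else 0)"
proof -
  have w: "lyndon w" "w \<noteq> []" "set w \<subseteq> A" "length w = n"
    using assms lyndon_not_Nil by (auto simp: lyndon_words_def)
  then have "lcoeff t (lyndon_elem w) = trace_coeff t (poly_eval (lyndon_brack w))"
    unfolding lyndon_elem_def using assms(3)
    by (intro lcoeff_group_eval) (simp_all add: letters_lyndon_brack degree_lyndon_brack)
  then show ?thesis
    using trace_coeff_leads[OF leads_lyndon_brack[OF w(1)] assms(2,4)] by simp
qed

text \<open>Triangularity: elements of larger words have coefficient 0 at \<open>b\<close>, so the
  exponent of the least word can be read off as a coefficient.\<close>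

lemma lyndon_span_insertE:
  assumes b: "b \<in> lyndon_words n" "normal_word b" and W: "W \<subseteq> lyndon_words n" "\<And>w. w \<in> W \<Longrightarrow> b < w"
    and x: "x \<in> lcs_span n (lyndon_elem ` insert b W)"
  obtains z where "z \<in> lcs_span n (lyndon_elem ` W)"
    "x = lyndon_elem b [^]\<^bsub>G\<^esub> lcoeff b x \<otimes>\<^bsub>G\<^esub> z"
proof -
  have n: "n \<ge> 1" using lyndon_words_pos[OF b(1)] .
  have len: "length b = n" "b \<noteq> []" using b n by (auto simp: lyndon_words_def)
  have bn: "lyndon_elem b \<in> lower_central G n" by (rule lyndon_elem_lower_central[OF b(1)])
  have Wn: "lyndon_elem ` W \<subseteq> lower_central G n" by (rule lyndon_elem_subset[OF W(1)])
  obtain c :: int and z where z: "z \<in> lcs_span n (lyndon_elem ` W)"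
    "x = lyndon_elem b [^]\<^bsub>G\<^esub> c \<otimes>\<^bsub>G\<^esub> z"
    by (rule lcs_span_insertE[OF bn Wn n x[unfolded image_insert]])
  have zn: "z \<in> lower_central G n" using z(1) lcs_span_subset_lower_central[OF Wn] by blast
  have powb: "lyndon_elem b [^]\<^bsub>G\<^esub> c \<in> lower_central G n"
    by (rule subgroup_int_pow_closed[OF subgroup_lower_central bn])
  have "lcoeff b (lyndon_elem w) = 0" if "w \<in> W" for w
    using lcoeff_lyndon_elem[of w n b] W that b len by fastforce
  then have "lcoeff b z = 0"
    using lcoeff_span_eq_0[of "lyndon_elem ` W" b z] Wn z(1) len by auto
  moreover have "lcoeff b x = lcoeff b (lyndon_elem b [^]\<^bsub>G\<^esub> c) + lcoeff b z"
    unfolding z(2) by (rule lcoeff_mult) (use powb zn len in auto)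
  moreover have "lcoeff b (lyndon_elem b [^]\<^bsub>G\<^esub> c) = c"
    using lcoeff_int_pow[of "lyndon_elem b" b c] bn len lcoeff_lyndon_elem[OF b(1,2) len(1)] by simp
  ultimately have "c = lcoeff b x" by simp
  then show thesis using that z by blast
qed

text \<open>Peel off words from the least upwards. The exponent of the least word is a coefficient,
  hence a multiple of \<open>p\<close>; dividing out this \<open>p\<close>-th power leaves all
  coefficients divisible. For \<open>p = 0\<close> all exponents vanish.\<close>

lemma lcoeff_divisible:
  assumes "n \<ge> 1" "W \<subseteq> lyndon_words n" "\<And>w. w \<in> W \<Longrightarrow> normal_word w"
    and "x \<in> lcs_span n (lyndon_elem ` W)"
    and "\<And>t. length t = n \<Longrightarrow> set t \<subseteq> A \<Longrightarrow> int p dvd lcoeff t x"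
  shows "\<exists>h\<in>lower_central G n. lcs_coset (Suc n) x = lcs_coset (Suc n) (h [^]\<^bsub>G\<^esub> p)"
proof -
  have "finite W" using assms(2) finite_lyndon_words finite_subset by blast
  then show ?thesis using assms(2-)
  proof (induction W arbitrary: x rule: finite_linorder_min_induct)
    case empty
    then have "x \<in> lower_central G (Suc n)" by (simp add: lcs_span_empty)
    then have "lcs_coset (Suc n) x = lcs_coset (Suc n) (\<one>\<^bsub>G\<^esub> [^]\<^bsub>G\<^esub> p)"
      using lower_central_closed by (simp add: lcs_coset_eq_iff)
    then show ?case using subgroup.one_closed[OF subgroup_lower_central] by blast
  next
    case (insert b W)
    have b: "b \<in> lyndon_words n" "normal_word b" and W: "W \<subseteq> lyndon_words n"
      using insert.prems by auto
    have bn: "lyndon_elem b \<in> lower_central G n" by (rule lyndon_elem_lower_central[OF b(1)])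
    have bc: "lyndon_elem b \<in> carrier G" using lower_central_closed[OF bn] .
    obtain z where z: "z \<in> lcs_span n (lyndon_elem ` W)"
      "x = lyndon_elem b [^]\<^bsub>G\<^esub> lcoeff b x \<otimes>\<^bsub>G\<^esub> z"
      using lyndon_span_insertE[OF b W _ insert.prems(3)] insert.hyps by blast
    have zn: "z \<in> lower_central G n"
      using z(1) lcs_span_subset_lower_central[OF lyndon_elem_subset[OF W]] by blast
    have "length b = n" "set b \<subseteq> A" using b by (simp_all add: lyndon_words_def)
    then obtain d where d: "lcoeff b x = int p * d"
      using insert.prems(4)[of b] by (auto simp: dvd_def)
    define u where "u = lyndon_elem b [^]\<^bsub>G\<^esub> d"
    have u: "u \<in> lower_central G n"
      unfolding u_def by (rule subgroup_int_pow_closed[OF subgroup_lower_central bn])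
    have uc: "u \<in> carrier G" using lower_central_closed[OF u] .
    have xu: "x = u [^]\<^bsub>G\<^esub> p \<otimes>\<^bsub>G\<^esub> z"
      using z(2) bc unfolding u_def d by (simp add: int_pow_pow mult.commute flip: int_pow_int)
    have "int p dvd lcoeff t z" if t: "length t = n" "set t \<subseteq> A" for t
    proof -
      have t': "t \<noteq> []" using t assms(1) by auto
      have "lcoeff t x = lcoeff t (u [^]\<^bsub>G\<^esub> p) + lcoeff t z"
        unfolding xu using lcoeff_nat_pow[of u t p] u zn t t' by (intro lcoeff_mult) auto
      moreover have "lcoeff t (u [^]\<^bsub>G\<^esub> p) = int p * lcoeff t u"
        using lcoeff_nat_pow[of u t p] u t t' by auto
      ultimately show ?thesis using insert.prems(4)[OF t] by (simp add: dvd_add_right_iff)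
    qed
    then obtain h where h: "h \<in> lower_central G n" "lcs_coset (Suc n) z = lcs_coset (Suc n) (h [^]\<^bsub>G\<^esub> p)"
      using insert.IH[OF W _ z(1)] insert.prems(2) by auto
    have hc: "h \<in> carrier G" using lower_central_closed[OF h(1)] .
    have "lcs_coset (Suc n) x = lcs_coset (Suc n) (u [^]\<^bsub>G\<^esub> p \<otimes>\<^bsub>G\<^esub> h [^]\<^bsub>G\<^esub> p)"
      unfolding xu using h(2) uc hc lower_central_closed[OF zn] by (simp add: lcs_coset_mult)
    also have "\<dots> = lcs_coset (Suc n) ((u \<otimes>\<^bsub>G\<^esub> h) [^]\<^bsub>G\<^esub> p)"
      by (rule lcs_coset_pow_mult[OF u h(1) assms(1), symmetric])
    finally show ?case using subgroup.m_closed[OF subgroup_lower_central u h(1)] by blast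
  qed
qed

text \<open>The words below \<open>w\<close> are removed from the least upwards: each occurs with
  its coefficient as exponent, which is 0.\<close>

lemma lyndon_span_above:
  assumes "W \<subseteq> lyndon_words n" "\<And>v. v \<in> W \<Longrightarrow> normal_word v"
    and "x \<in> lcs_span n (lyndon_elem ` W)"
    and "\<And>v. v \<in> W \<Longrightarrow> v < w \<Longrightarrow> lcoeff v x = 0"
  shows "x \<in> lcs_span n (lyndon_elem ` {v \<in> W. w \<le> v})"
proof -
  have "finite W" using assms(1) finite_lyndon_words finite_subset by blast
  then show ?thesis using assms
  proof (induction W rule: finite_linorder_min_induct)
    case empty
    then show ?case by simp
  next
    case (insert b W)
    show ?case
    proof (cases "b < w")
      case True
      have b: "b \<in> lyndon_words n" "normal_word b" and W: "W \<subseteq> lyndon_words n"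
        using insert.prems by auto
      obtain z where z: "z \<in> lcs_span n (lyndon_elem ` W)"
        "x = lyndon_elem b [^]\<^bsub>G\<^esub> lcoeff b x \<otimes>\<^bsub>G\<^esub> z"
        using lyndon_span_insertE[OF b W _ insert.prems(3)] insert.hyps by blast
      have "z \<in> carrier G"
        using subgroup.mem_carrier[OF subgroup_lyndon_span[OF W] z(1)] .
      then have "x = z" using z(2) insert.prems(4)[of b] True by simp
      then have "x \<in> lcs_span n (lyndon_elem ` {v \<in> W. w \<le> v})"
        using insert.IH[OF W] insert.prems z(1) by auto
      moreover have "{v \<in> insert b W. w \<le> v} = {v \<in> W. w \<le> v}" using True by auto
      ultimately show ?thesis by simp
    next
      case False
      then have "{v \<in> insert b W. w \<le> v} = insert b W"
        using insert.hyps by (auto intro: less_imp_le order_trans)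
      then show ?thesis using insert.prems by simp
    qed
  qed
qed

text \<open>Meant for the free group, where the expansion of a Lie word with leading word
  \<open>w\<close> has these coefficients: its Lyndon expression then starts with exactly one copy
  of the element of \<open>w\<close>.\<close>

lemma lyndon_span_leading:
  assumes W: "W \<subseteq> lyndon_words n" "\<And>v. v \<in> W \<Longrightarrow> normal_word v" and w: "w \<in> W"
    and x: "x \<in> lcs_span n (lyndon_elem ` W)"
    and lc: "\<And>v. v \<in> W \<Longrightarrow> v < w \<Longrightarrow> lcoeff v x = 0" "lcoeff w x = 1"
  obtains z where "z \<in> lcs_span n (lyndon_elem ` {v \<in> W. w < v})" "x = lyndon_elem w \<otimes>\<^bsub>G\<^esub> z"
proof -
  have "{v \<in> W. w \<le> v} = insert w {v \<in> W. w < v}" using w by auto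
  then have "x \<in> lcs_span n (lyndon_elem ` insert w {v \<in> W. w < v})"
    using lyndon_span_above[OF W x, of w] lc(1) by simp
  moreover have wn: "w \<in> lyndon_words n" "{v \<in> W. w < v} \<subseteq> lyndon_words n" using W w by auto
  ultimately obtain z where "z \<in> lcs_span n (lyndon_elem ` {v \<in> W. w < v})"
    "x = lyndon_elem w [^]\<^bsub>G\<^esub> lcoeff w x \<otimes>\<^bsub>G\<^esub> z"
    using lyndon_span_insertE[OF wn(1) W(2)[OF w] wn(2), of x] by blast
  then show thesis
    using that[of z] lc(2) lyndon_elem_lower_central[OF wn(1)] lower_central_closed by (simp add: int_pow_1)
qed

section \<open>Lie words that vanish in the group\<close>

text \<open>\<open>a\<close> commutes with \<open>b\<close> and with all letters of
  \<open>u\<close>, hence with their iterated commutator, so the bracket with \<open>a\<close> is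
  trivial and remains so under all later brackets.\<close>

lemma group_eval_left_normed_eq_one:
  assumes "insert b (set (u @ a # y)) \<subseteq> A" "\<And>c. c \<in> set (b # u) \<Longrightarrow> adj a c"
  shows "group_eval (left_normed b (u @ a # y)) = \<one>\<^bsub>G\<^esub>"
  using assms
proof (induction y rule: rev_induct)
  case Nil
  have a: "gen a \<in> carrier G" using Nil.prems by (auto simp: gen_idx)
  have "group_eval (left_normed b u) \<in> carrier G
    \<and> group_eval (left_normed b u) \<otimes>\<^bsub>G\<^esub> gen a = gen a \<otimes>\<^bsub>G\<^esub> group_eval (left_normed b u)"
    using Nil.prems
  proof (induction u rule: rev_induct)
    case Nil
    then show ?case using gen_commute[of a b] by (auto simp: gen_idx)
  next
    case (snoc c u)
    let ?g = "group_eval (left_normed b u)"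
    have c: "gen c \<in> carrier G" "gen c \<otimes>\<^bsub>G\<^esub> gen a = gen a \<otimes>\<^bsub>G\<^esub> gen c"
      using snoc.prems gen_commute[of a c] by (auto simp: gen_idx)
    have g: "?g \<in> carrier G" "?g \<otimes>\<^bsub>G\<^esub> gen a = gen a \<otimes>\<^bsub>G\<^esub> ?g"
      using snoc by auto
    \<comment> \<open>Conjugation by \<open>gen a\<close> fixes both arguments, hence their
      commutator.\<close>
    have conj: "gen a \<otimes>\<^bsub>G\<^esub> x \<otimes>\<^bsub>G\<^esub> inv\<^bsub>G\<^esub> gen a = x"
      if "x \<in> carrier G" "x \<otimes>\<^bsub>G\<^esub> gen a = gen a \<otimes>\<^bsub>G\<^esub> x" for x
      unfolding that(2)[symmetric] using that(1) a by (simp add: m_assoc)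
    let ?x = "commutator G ?g (gen c)"
    have x: "?x \<in> carrier G" using g c by simp
    have "gen a \<otimes>\<^bsub>G\<^esub> ?x \<otimes>\<^bsub>G\<^esub> inv\<^bsub>G\<^esub> gen a = ?x"
      using conj_commutator[OF g(1) c(1) a] conj[OF g] conj[OF c] by simp
    then have "?x \<otimes>\<^bsub>G\<^esub> gen a
        = gen a \<otimes>\<^bsub>G\<^esub> ?x \<otimes>\<^bsub>G\<^esub> inv\<^bsub>G\<^esub> gen a \<otimes>\<^bsub>G\<^esub> gen a"
      by (rule arg_cong[OF HOL.sym])
    also have "\<dots> = gen a \<otimes>\<^bsub>G\<^esub> ?x" using x a by (simp add: m_assoc)
    finally have "?x \<otimes>\<^bsub>G\<^esub> gen a = gen a \<otimes>\<^bsub>G\<^esub> ?x" .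
    then show ?case using x by simp
  qed
  then have "commutator G (group_eval (left_normed b u)) (gen a) = \<one>\<^bsub>G\<^esub>"
    using a by (intro iffD2[OF commutator_eq_one_iff]) auto
  then show ?case by simp
next
  case (snoc c y)
  then have "group_eval (left_normed b (u @ a # y)) = \<one>\<^bsub>G\<^esub>" by auto
  then have "group_eval (left_normed b ((u @ a # y) @ [c])) = commutator G \<one>\<^bsub>G\<^esub> (gen c)"
    by (simp only: left_normed_simps lie_eval.simps)
  moreover have "gen c \<in> carrier G" using snoc.prems by (auto simp: gen_idx)
  ultimately show ?case by (simp add: commutator_one)
qed

text \<open>If a standard factor is not normal, its vanishing Lie word is bracketed with the
  standard bracketing of the other factor. Otherwise \<open>w\<close> is
  \<open>b # u @ a # y\<close> with \<open>b\<close> below all other letters, and the left-normed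
  bracketing vanishes.\<close>

lemma vanishing_lie_word:
  assumes "lyndon w" "\<not> normal_word w" "set w \<subseteq> A"
  shows "\<exists>q. letters q \<subseteq> A \<and> degree q = length w \<and> leads w (poly_eval q) \<and> group_eval q = \<one>\<^bsub>G\<^esub>"
  using assms
proof (induction w rule: measure_induct_rule[of length])
  case (less w)
  show ?case
  proof (cases "length w \<ge> 2 \<and> (\<not> normal_word (lfactor w) \<or> \<not> normal_word (rfactor w))")
    case True
    then have len: "length w \<ge> 2" by simp
    note fac = factorisation(1)[OF len] and lens = length_factors[OF len]
    let ?u = "lfactor w" and ?v = "rfactor w"
    let ?P = "\<lambda>x q. letters q \<subseteq> A \<and> degree q = length x \<and> leads x (poly_eval q)"
    have lyn: "lyndon ?u" "lyndon ?v" "?u < ?v"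
      using less.prems(1) len lyndon_lfactor lyndon_rfactor lfactor_less_rfactor by auto
    have sets: "set ?u \<subseteq> A" "set ?v \<subseteq> A"
      using less.prems(3) fac by (metis Un_subset_iff set_append)+
    have brack: "?P x (lyndon_brack x)" if "lyndon x" "set x \<subseteq> A" for x
      using that lyndon_not_Nil[OF that(1)]
      by (simp add: letters_lyndon_brack degree_lyndon_brack leads_lyndon_brack)
    have combine: ?thesis
      if P: "?P ?u s" "?P ?v t" and one: "group_eval s = \<one>\<^bsub>G\<^esub> \<or> group_eval t = \<one>\<^bsub>G\<^esub>" for s t
    proof -
      have carr: "group_eval s \<in> carrier G" "group_eval t \<in> carrier G"
        by (rule lower_central_closed[OF group_eval_lower_central]; use P in simp)+
      from one have "group_eval (Brack s t) = \<one>\<^bsub>G\<^esub>"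
        by (elim disjE) (simp_all only: lie_eval.simps commutator_one carr)
      moreover have "leads (?u @ ?v) (poly_eval (Brack s t))"
        using leads_commutator[OF _ _ lyndon_append_swap[OF lyn]] P by simp
      then have "leads w (poly_eval (Brack s t))" by (simp only: fac[symmetric])
      ultimately show ?thesis using P lens(3) by (intro exI[of _ "Brack s t"]) simp
    qed
    show ?thesis
    proof (cases "normal_word ?u")
      case False
      then obtain q where q: "?P ?u q" "group_eval q = \<one>\<^bsub>G\<^esub>"
        using less.IH[OF lens(1) lyn(1) _ sets(1)] by blast
      show ?thesis by (rule combine[OF q(1) brack[OF lyn(2) sets(2)] disjI1[OF q(2)]])
    next
      case normal: True
      then obtain q where q: "?P ?v q" "group_eval q = \<one>\<^bsub>G\<^esub>"
        using less.IH[OF lens(2) lyn(2) _ sets(2)] True by blast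
      show ?thesis by (rule combine[OF brack[OF lyn(1) sets(1)] q(1) disjI2[OF q(2)]])
    qed
  next
    case False
    obtain b u a y where head: "w = b # u @ a # y" "\<And>c. c \<in> set (b # u) \<Longrightarrow> adj a c"
      "\<And>c. c \<in> set (u @ a # y) \<Longrightarrow> b < c"
      by (rule lyndon_not_normal_cases[OF less.prems(1,2)]) (use False in blast)+
    have "letters (left_normed b (u @ a # y)) \<subseteq> A" "degree (left_normed b (u @ a # y)) = length w"
      using less.prems(3) head(1) by (auto simp: letters_left_normed degree_left_normed)
    moreover have "leads w (poly_eval (left_normed b (u @ a # y)))"
      unfolding head(1) by (rule leads_left_normed) (rule head(3))
    moreover have "group_eval (left_normed b (u @ a # y)) = \<one>\<^bsub>G\<^esub>"
      using less.prems(3) head by (intro group_eval_left_normed_eq_one) auto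
    ultimately show ?thesis by blast
  qed
qed

end

section \<open>Divisibility in the lower central factors\<close>

context group_hom
begin

lemma hom_commutator:
  "x \<in> carrier G \<Longrightarrow> y \<in> carrier G \<Longrightarrow> h (commutator G x y) = commutator H (h x) (h y)"
  by (simp add: commutator_def)

lemma hom_lower_central: "h ` lower_central G n \<subseteq> lower_central H n"
proof (induction n rule: induct_nat_012)
  case (ge2 n)
  let ?S = "{commutator G x y |x y. x \<in> lower_central G (Suc n) \<and> y \<in> carrier G}"
  have "?S \<subseteq> carrier G"
    using G.lower_central_subset by (auto intro!: G.commutator_closed)
  then have "h ` lower_central G (Suc (Suc n)) = generate H (h ` ?S)"
    by (simp add: commutator_subgroup_def generate_img)
  also have "\<dots> \<subseteq> lower_central H (Suc (Suc n))"
  proof (rule H.generate_subgroup_incl[OF _ H.subgroup_lower_central])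
    show "h ` ?S \<subseteq> lower_central H (Suc (Suc n))"
    proof
      fix z assume "z \<in> h ` ?S"
      then obtain x y where xy: "z = h (commutator G x y)" "x \<in> lower_central G (Suc n)" "y \<in> carrier G"
        by blast
      then have "z = commutator H (h x) (h y)" by (simp add: hom_commutator G.lower_central_closed)
      moreover have "h x \<in> lower_central H (Suc n)" using ge2.IH(2) xy(2) by blast
      ultimately show "z \<in> lower_central H (Suc (Suc n))"
        using xy(3) by (auto intro: H.commutator_in_commutator_subgroup)
    qed
  qed
  finally show ?case .
qed auto

text \<open>Carries relations between Lyndon elements from the free group to the graph
  group.\<close>

lemma hom_lcs_span:
  assumes "Y \<subseteq> carrier G" "x \<in> G.lcs_span n Y"
  shows "h x \<in> H.lcs_span n (h ` Y)"
proof -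
  have "h ` G.lcs_span n Y = generate H (h ` (Y \<union> lower_central G (Suc n)))"
    using assms(1) G.lower_central_subset unfolding G.lcs_span_def by (intro generate_img[symmetric]) auto
  also have "\<dots> \<subseteq> H.lcs_span n (h ` Y)"
    unfolding H.lcs_span_def using hom_lower_central by (intro H.mono_generate) auto
  finally show ?thesis using assms(2) by blast
qed

end

context indexed_graph
begin

lemma edgeless: "indexed_graph (\<Gamma>\<lparr>parcs := {}\<rparr>) idx"
  by unfold_locales (simp_all add: finite_verts inj_idx)

text \<open>The vanishing Lie word for \<open>w\<close> is expanded in the free group, that is, in the group of the
  graph without edges, where every word is normal and the leading coefficients are available.\<close>

lemma lyndon_elem_not_normal:
  assumes w: "w \<in> lyndon_words n" "\<not> normal_word w"
  shows "lyndon_elem w \<in> lcs_span n (lyndon_elem ` {u \<in> lyndon_words n. w < u})"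
proof -
  interpret F: indexed_graph "\<Gamma>\<lparr>parcs := {}\<rparr>" idx by (rule edgeless)
  have F_rel: "F.relators = {}" by (simp add: F.relators_def)
  have F_words: "F.lyndon_words n = lyndon_words n"
    by (simp add: F.lyndon_words_def lyndon_words_def)
  have F_adj: "\<not> F.adj a b" for a b by (simp add: F.adj_def)
  have F_normal: "F.normal_word v" for v
    by (rule ccontr, erule F.not_normal_wordE) (use F_adj in auto)
  have cong_mono: "(u, v) \<in> F.cong \<Longrightarrow> (u, v) \<in> cong" for u v
  proof (induction rule: word_cong.induct)
    case (sym u w)
    show ?case by (rule word_cong.sym[OF sym.IH])
  next
    case (trans u v w)
    show ?case by (rule word_cong.trans[OF trans.IH])
  next
    case (relator u w r)
    then show ?case by (simp add: F_rel)
  next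
    case (cancel u w x b)
    then show ?case by (intro word_cong.cancel) simp_all
  qed (simp add: word_cong.refl)
  \<comment> \<open>The projection from the free group: saturating a free class under the coarser
    congruence yields the class that contains it.\<close>
  define \<pi> where "\<pi> g = cong `` g" for g
  have \<pi>_cls: "\<pi> (F.cls u) = cls u" if "u \<in> words (pverts \<Gamma>)" for u
  proof -
    have "(u, u) \<in> F.cong" using that by (intro word_cong.refl) simp
    then show ?thesis
      unfolding \<pi>_def using cong_mono by (auto intro: word_cong.trans)
  qed
  note \<pi>_cls = \<pi>_cls[simplified]
  have "group_hom F.G G \<pi>"
  proof (intro group_hom.intro group_hom_axioms.intro homI F.is_group is_group)
    fix g assume "g \<in> carrier F.G"
    then obtain u where u: "u \<in> words (pverts \<Gamma>)" "g = F.cls u" using F.carrier_cls by auto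
    then show "\<pi> g \<in> carrier G" by (simp add: \<pi>_cls)
    fix h assume "h \<in> carrier F.G"
    then obtain v where v: "v \<in> words (pverts \<Gamma>)" "h = F.cls v" using F.carrier_cls by auto
    have "g \<otimes>\<^bsub>F.G\<^esub> h = F.cls (u @ v)" using u v by (simp add: F.cls_mult[simplified])
    then show "\<pi> (g \<otimes>\<^bsub>F.G\<^esub> h) = \<pi> g \<otimes>\<^bsub>G\<^esub> \<pi> h"
      using u v by (simp add: \<pi>_cls cls_mult)
  qed
  then interpret \<pi>: group_hom F.G G \<pi> .
  have \<pi>_gen: "\<pi> (F.gen a) = gen a" if "a \<in> A" for a
    using that by (auto simp: gen_idx \<pi>_cls F.gen_idx[simplified])
  have \<pi>_eval: "\<pi> (F.group_eval t) = group_eval t" if "letters t \<subseteq> A" for t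
    using that
  proof (induction t)
    case (Letter a)
    then show ?case by (simp add: \<pi>_gen)
  next
    case (Brack s t)
    then have "letters s \<subseteq> idx ` pverts (\<Gamma>\<lparr>parcs := {}\<rparr>)" "letters t \<subseteq> idx ` pverts (\<Gamma>\<lparr>parcs := {}\<rparr>)"
      by auto
    then have "F.group_eval s \<in> carrier F.G" "F.group_eval t \<in> carrier F.G"
      using F.group_eval_lower_central F.lower_central_closed by blast+
    then show ?case using Brack by (simp add: \<pi>.hom_commutator)
  qed
  have \<pi>_elem: "\<pi> (F.lyndon_elem u) = lyndon_elem u" if "u \<in> lyndon_words m" for u m
    unfolding F.lyndon_elem_def lyndon_elem_def
    using that lyndon_not_Nil[of u] letters_lyndon_brack[of u]
    by (intro \<pi>_eval) (auto simp: lyndon_words_def)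
  have wn: "lyndon w" "length w = n" "set w \<subseteq> A" using w(1) by (auto simp: lyndon_words_def)
  obtain q where q: "letters q \<subseteq> A" "degree q = n" "leads w (poly_eval q)" "group_eval q = \<one>\<^bsub>G\<^esub>"
    using vanishing_lie_word[OF wn(1) w(2) wn(3)] wn(2) by blast
  have qF: "letters q \<subseteq> idx ` pverts (\<Gamma>\<lparr>parcs := {}\<rparr>)" using q(1) by simp
  have n: "n \<ge> 1" using lyndon_words_pos[OF w(1)] .
  let ?x = "F.group_eval q"
  \<comment> \<open>Every word is normal in the free group, so up to \<open>w\<close> the
    coefficients are those of a series with leading word \<open>w\<close>.\<close>
  have lc: "F.lcoeff v ?x = (if w = v then 1 else 0)" if "v \<in> lyndon_words n" "v \<le> w" for v
  proof -
    have "F.lcoeff v ?x = F.trace_coeff v (poly_eval q)"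
      using that(1) q by (intro F.lcoeff_group_eval[OF qF]) (simp add: lyndon_words_def)
    then show ?thesis using F.trace_coeff_leads[OF q(3) F_normal that(2)] by simp
  qed
  have "?x \<in> F.lcs_span n (F.lyndon_elem ` F.lyndon_words n)"
    using F.group_eval_lower_central[OF qF] q(2) F.lower_central_eq_lyndon_span[OF n] by simp
  then obtain z where z: "z \<in> F.lcs_span n (F.lyndon_elem ` {v \<in> F.lyndon_words n. w < v})"
    "?x = F.lyndon_elem w \<otimes>\<^bsub>F.G\<^esub> z"
    by (rule F.lyndon_span_leading[of "F.lyndon_words n" n w ?x, rotated 3])
      (use w(1) F_words F_normal lc in auto)
  have sub: "F.lyndon_elem ` {v \<in> F.lyndon_words n. w < v} \<subseteq> carrier F.G"
    by (rule F.lyndon_elem_subset_carrier[of _ n]) auto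
  have zF: "z \<in> carrier F.G" by (rule subgroup.mem_carrier[OF F.subgroup_lcs_span[OF sub] z(1)])
  have wF: "F.lyndon_elem w \<in> carrier F.G"
    using F.lyndon_elem_lower_central[of w n] w(1) F_words F.lower_central_closed by auto
  let ?U = "lyndon_elem ` {u \<in> lyndon_words n. w < u}"
  have "\<pi> ` F.lyndon_elem ` {v \<in> F.lyndon_words n. w < v} = ?U"
    unfolding F_words image_image by (rule image_cong) (auto simp: \<pi>_elem)
  then have \<pi>z: "\<pi> z \<in> lcs_span n ?U"
    using \<pi>.hom_lcs_span[OF sub z(1)] by simp
  have U: "subgroup (lcs_span n ?U) G"
    by (rule subgroup_lyndon_span[of _ n]) auto
  have wG: "lyndon_elem w \<in> carrier G"
    using lyndon_elem_lower_central[OF w(1)] lower_central_closed by blast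
  \<comment> \<open>\<open>q\<close> is trivial in the graph group, so the image of the free
    relation can be solved for \<open>lyndon_elem w\<close>.\<close>
  have "lyndon_elem w \<otimes>\<^bsub>G\<^esub> \<pi> z = \<one>\<^bsub>G\<^esub>"
    using \<pi>_eval[OF q(1)] q(4) z(2) \<pi>.hom_mult[OF wF zF] \<pi>_elem[OF w(1)] by simp
  then have "lyndon_elem w = inv\<^bsub>G\<^esub> (\<pi> z)"
    using wG subgroup.mem_carrier[OF U \<pi>z] by (simp add: inv_equality)
  then show ?thesis using subgroup.m_inv_closed[OF U \<pi>z] by simp
qed

text \<open>Elements of non-normal words are replaced by elements of larger words; as there are
  finitely many Lyndon words of length \<open>n\<close> over \<open>A\<close>, this
  terminates.\<close>

lemma lower_central_eq_normal_span:
  assumes n: "n \<ge> 1"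
  shows "lower_central G n = lcs_span n (lyndon_elem ` {w \<in> lyndon_words n. normal_word w})"
proof -
  let ?S = "lcs_span n (lyndon_elem ` {w \<in> lyndon_words n. normal_word w})"
  have S: "subgroup ?S G" by (rule subgroup_lyndon_span[of _ n]) auto
  have "lyndon_elem w \<in> ?S" if "w \<in> lyndon_words n" for w
    using that
  proof (induction "card {u \<in> lyndon_words n. w < u}" arbitrary: w rule: less_induct)
    case less
    show ?case
    proof (cases "normal_word w")
      case True
      then show ?thesis using less.prems by (intro lcs_span_incl) auto
    next
      case False
      have "lyndon_elem u \<in> ?S" if u: "u \<in> lyndon_words n" "w < u" for u
      proof (rule less.hyps[OF _ u(1)])
        show "card {v \<in> lyndon_words n. u < v} < card {v \<in> lyndon_words n. w < v}"
          using u finite_lyndon_words by (intro psubset_card_mono) auto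
      qed
      then have "lcs_span n (lyndon_elem ` {u \<in> lyndon_words n. w < u}) \<subseteq> ?S"
        by (intro lcs_span_subset[OF S]) (auto intro: subsetD[OF lower_central_subset_span])
      then show ?thesis using lyndon_elem_not_normal[OF less.prems False] by blast
    qed
  qed
  then have "lower_central G n \<subseteq> ?S"
    unfolding lower_central_eq_lyndon_span[OF n]
    by (intro lcs_span_subset[OF S]) (auto intro: subsetD[OF lower_central_subset_span])
  moreover have "?S \<subseteq> lower_central G n"
    by (intro lcs_span_subset_lower_central lyndon_elem_subset) auto
  ultimately show ?thesis by blast
qed

section \<open>From coefficients back to divisibility\<close>

lemma lcoeff_coset_cong:
  assumes "x \<in> lower_central G (length t)" "y \<in> lower_central G (length t)" "t \<noteq> []"
    and "lcs_coset (Suc (length t)) x = lcs_coset (Suc (length t)) y"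
  shows "lcoeff t x = lcoeff t y"
proof -
  note carr = assms(1,2)[THEN lower_central_closed]
  define z where "z = x \<otimes>\<^bsub>G\<^esub> inv\<^bsub>G\<^esub> y"
  have z: "z \<in> lower_central G (Suc (length t))"
    using assms(4) carr by (simp add: z_def lcs_coset_eq_iff)
  then have "z \<in> lower_central G (length t)" using lower_central_Suc_subset by blast
  moreover have "x = z \<otimes>\<^bsub>G\<^esub> y" using carr by (simp add: z_def m_assoc)
  moreover have "lcoeff t z = 0" using lcoeff_lower_central[OF z _ assms(3)] by simp
  ultimately show ?thesis using lcoeff_mult[OF _ assms(2,3), of z] by simp
qed

theorem lcs_divisible:
  assumes isolated: "\<And>v. v \<in> pverts \<Gamma> \<Longrightarrow> \<exists>w\<in>pverts \<Gamma>. w \<noteq> v \<and> (v, w) \<notin> parcs \<Gamma>"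
    and n: "n \<ge> 1" and g: "g \<in> lower_central G n"
    and comm: "\<And>a. a \<in> A \<Longrightarrow> \<exists>h\<in>lower_central G (Suc n).
      lcs_coset (Suc (Suc n)) (commutator G g (gen a)) = lcs_coset (Suc (Suc n)) (h [^]\<^bsub>G\<^esub> p)"
  shows "\<exists>h\<in>lower_central G n. lcs_coset (Suc n) g = lcs_coset (Suc n) (h [^]\<^bsub>G\<^esub> (p::nat))"
proof (rule lcoeff_divisible[OF n, of "{w \<in> lyndon_words n. normal_word w}"])
  show "g \<in> lcs_span n (lyndon_elem ` {w \<in> lyndon_words n. normal_word w})"
    using g lower_central_eq_normal_span[OF n] by simp
  fix t assume t: "length t = n" "set t \<subseteq> A"
  then obtain a s where as: "t = a # s" using n by (cases t) auto
  then obtain v where v: "v \<in> pverts \<Gamma>" "a = idx v" using t by auto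
  obtain w where w: "w \<in> pverts \<Gamma>" "w \<noteq> v" "(v, w) \<notin> parcs \<Gamma>" using isolated[OF v(1)] by blast
  define b where "b = idx w"
  have b: "b \<in> A" "b \<noteq> a" "\<not> adj a b"
    using v w inj_onD[OF inj_idx] by (auto simp: b_def adj_idx)
  obtain h where h: "h \<in> lower_central G (Suc n)"
    "lcs_coset (Suc (Suc n)) (commutator G g (gen b)) = lcs_coset (Suc (Suc n)) (h [^]\<^bsub>G\<^esub> p)"
    using comm[OF b(1)] by blast
  let ?t = "t @ [b]"
  have len: "length ?t = Suc n" using t by simp
  have hp: "lcoeff ?t (h [^]\<^bsub>G\<^esub> p) = int p * lcoeff ?t h" "h [^]\<^bsub>G\<^esub> p \<in> lower_central G (length ?t)"
    using lcoeff_nat_pow[of h ?t p] h(1) len by simp_all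
  have gb: "gen b \<in> lower_central G 1" using b(1) by (auto simp: gen_idx)
  have "lcoeff t g = lcoeff ?t (commutator G g (gen b))"
    using lcoeff_commutator_gen[OF _ as b] g t(1) by simp
  also have "\<dots> = lcoeff ?t (h [^]\<^bsub>G\<^esub> p)"
    using commutator_lower_central[OF g gb n] hp(2) h(2) len by (intro lcoeff_coset_cong) simp_all
  finally show "int p dvd lcoeff t g" using hp(1) by simp
qed auto

lemma gen_not_one: "a \<in> A \<Longrightarrow> gen a \<noteq> \<one>\<^bsub>G\<^esub>"
proof
  assume a: "a \<in> A" "gen a = \<one>\<^bsub>G\<^esub>"
  have "lcoeff [a] (gen a) = trace_coeff ([] @ [a]) (1 * X a)"
    using lcoeff_group_eval[of "Letter a" "[a]"] a(1) by simp
  also have "\<dots> = 1" unfolding trace_coeff_times_X by (simp add: trace_coeff_one)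
  finally show False using a(2) lcoeff_one[of "[a]"] by simp
qed

text \<open>A vertex adjacent to all others would commute with every generator and so be central; it
  is nontrivial because its expansion has coefficient 1 at its own letter.\<close>

lemma centreless_not_dominating:
  assumes centre: "group_centre G = {\<one>\<^bsub>G\<^esub>}" and v: "v \<in> pverts \<Gamma>"
  shows "\<exists>w\<in>pverts \<Gamma>. w \<noteq> v \<and> (v, w) \<notin> parcs \<Gamma>"
proof (rule ccontr)
  assume dom: "\<not> ?thesis"
  let ?g = "gen (idx v)"
  have g: "?g \<in> carrier G" using v by (simp add: gen_idx)
  have gens: "commutator G ?g (gen a) = \<one>\<^bsub>G\<^esub>" if "a \<in> A" for a
  proof -
    from that obtain w where w: "w \<in> pverts \<Gamma>" "a = idx w" by blast
    have "?g \<otimes>\<^bsub>G\<^esub> gen a = gen a \<otimes>\<^bsub>G\<^esub> ?g"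
      using dom w v gen_commute[of "idx v" a] by (cases "w = v") (auto simp: adj_idx)
    then show ?thesis using g w by (subst commutator_eq_one_iff) (simp_all add: gen_idx)
  qed
  have sub: "gen ` A \<subseteq> carrier G" by (rule e_closed)
  have "commutator G ?g y \<in> {\<one>\<^bsub>G\<^esub>}" if "y \<in> carrier G" for y
    by (rule commutator_generate_right[OF one_is_normal g sub])
      (use gens that generates in auto)
  then have "?g \<in> group_centre G"
    using g commutator_eq_one_iff by (auto simp: group_centre_def)
  then show False using centre gen_not_one[of "idx v"] v by auto
qed

end

section \<open>The centre of the Lie ring and of its quotients\<close>

text \<open>The bracket of the quotient is a union of cosets over all representatives. Each coset
  contains its bracket, so the union is \<open>I\<close> exactly if all brackets lie in
  \<open>I\<close>. The cosets cover \<open>L\<close>, so the second argument may run through the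
  whole carrier.\<close>

lemma lie_centre_quotient:
  assumes L: "group L" and I: "subgroup I L"
    and bracket_closed: "\<And>x y. x \<in> carrier L \<Longrightarrow> y \<in> carrier L \<Longrightarrow> bracket L x y \<in> carrier L"
  shows "lie_centre (lie_quotient L I)
    = {C \<in> rcosets\<^bsub>L\<^esub> I. \<forall>a\<in>C. \<forall>b\<in>carrier L. bracket L a b \<in> I}"
proof -
  have br: "bracket (lie_quotient L I) C D = (\<Union>a\<in>C. \<Union>b\<in>D. I #>\<^bsub>L\<^esub> bracket L a b)" for C D
    by (simp add: lie_quotient_def monoid.defs lie_ring.defs)
  have carr: "carrier (lie_quotient L I) = rcosets\<^bsub>L\<^esub> I" "\<one>\<^bsub>lie_quotient L I\<^esub> = I"
    by (simp_all add: lie_quotient_def monoid.defs lie_ring.defs FactGroup_def)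
  have sub: "C \<subseteq> carrier L" if "C \<in> rcosets\<^bsub>L\<^esub> I" for C
    using group.rcosets_part_G[OF L I] that by blast
  have eq_iff: "(\<Union>a\<in>C. \<Union>b\<in>D. I #>\<^bsub>L\<^esub> bracket L a b) = I \<longleftrightarrow> (\<forall>a\<in>C. \<forall>b\<in>D. bracket L a b \<in> I)"
    if CD: "C \<in> rcosets\<^bsub>L\<^esub> I" "D \<in> rcosets\<^bsub>L\<^esub> I" for C D
  proof
    assume eq: "(\<Union>a\<in>C. \<Union>b\<in>D. I #>\<^bsub>L\<^esub> bracket L a b) = I"
    show "\<forall>a\<in>C. \<forall>b\<in>D. bracket L a b \<in> I"
    proof (intro ballI)
      fix a b assume ab: "a \<in> C" "b \<in> D"
      then have "bracket L a b \<in> I #>\<^bsub>L\<^esub> bracket L a b"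
        using sub CD by (intro group.rcos_self[OF L _ I] bracket_closed) auto
      then show "bracket L a b \<in> I" using eq ab by blast
    qed
  next
    assume mem: "\<forall>a\<in>C. \<forall>b\<in>D. bracket L a b \<in> I"
    have "I #>\<^bsub>L\<^esub> bracket L a b = I" if "a \<in> C" "b \<in> D" for a b
      using mem that sub CD by (intro group.coset_join2[OF L _ I] bracket_closed) auto
    moreover have "C \<noteq> {}" "D \<noteq> {}"
      using CD group.rcos_self[OF L _ I] by (auto simp: RCOSETS_def)
    ultimately show "(\<Union>a\<in>C. \<Union>b\<in>D. I #>\<^bsub>L\<^esub> bracket L a b) = I" by auto
  qed
  have union: "(\<forall>D\<in>rcosets\<^bsub>L\<^esub> I. \<forall>b\<in>D. P b) \<longleftrightarrow> (\<forall>b\<in>carrier L. P b)" for P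
    unfolding group.rcosets_part_G[OF L I, symmetric] by blast
  have "(\<forall>D\<in>rcosets\<^bsub>L\<^esub> I. (\<Union>a\<in>C. \<Union>b\<in>D. I #>\<^bsub>L\<^esub> bracket L a b) = I)
      \<longleftrightarrow> (\<forall>a\<in>C. \<forall>b\<in>carrier L. bracket L a b \<in> I)" if C: "C \<in> rcosets\<^bsub>L\<^esub> I" for C
  proof -
    have "(\<forall>D\<in>rcosets\<^bsub>L\<^esub> I. (\<Union>a\<in>C. \<Union>b\<in>D. I #>\<^bsub>L\<^esub> bracket L a b) = I)
        \<longleftrightarrow> (\<forall>D\<in>rcosets\<^bsub>L\<^esub> I. \<forall>b\<in>D. \<forall>a\<in>C. bracket L a b \<in> I)"
    proof (rule ball_cong[OF HOL.refl])
      fix D assume "D \<in> rcosets\<^bsub>L\<^esub> I"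
      from eq_iff[OF C this]
      show "((\<Union>a\<in>C. \<Union>b\<in>D. I #>\<^bsub>L\<^esub> bracket L a b) = I) \<longleftrightarrow> (\<forall>b\<in>D. \<forall>a\<in>C. bracket L a b \<in> I)"
        by (simp only:) blast
    qed
    then show ?thesis unfolding union by blast
  qed
  then show ?thesis
    unfolding lie_centre_def carr br by (intro Collect_cong conj_cong HOL.refl)
qed

context group
begin

section \<open>The graded Lie ring of a group\<close>

abbreviation gr :: "(nat \<Rightarrow> 'a set) lie_ring" where
  "gr \<equiv> lcs_lie_ring G"

lemma lcs_factor_simps:
  "carrier (lcs_factor G n) = lcs_coset (Suc n) ` lower_central G n"
  "\<one>\<^bsub>lcs_factor G n\<^esub> = lower_central G (Suc n)"
  "x \<otimes>\<^bsub>lcs_factor G n\<^esub> y = x <#> y"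
  by (auto simp: lcs_factor_def FactGroup_def RCOSETS_def r_coset_def lcs_coset_def set_mult_def)

lemma group_lcs_factor: "group (lcs_factor G n)"
  unfolding lcs_factor_def
  using normal_restrict_supergroup[OF subgroup_lower_central normal_lower_central lower_central_Suc_subset]
  by (simp add: normal.factorgroup_is_group)

lemma comm_group_lcs_factor:
  assumes "n \<ge> 1"
  shows "comm_group (lcs_factor G n)"
proof (rule group.group_comm_groupI[OF group_lcs_factor])
  fix x y assume "x \<in> carrier (lcs_factor G n)" "y \<in> carrier (lcs_factor G n)"
  then obtain g h where g: "x = lcs_coset (Suc n) g" "g \<in> lower_central G n"
    and h: "y = lcs_coset (Suc n) h" "h \<in> lower_central G n"
    by (auto simp: lcs_factor_simps)
  then show "x \<otimes>\<^bsub>lcs_factor G n\<^esub> y = y \<otimes>\<^bsub>lcs_factor G n\<^esub> x"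
    using lcs_coset_commute[OF g(2) h(2), of "Suc n"] assms
    by (simp add: lcs_factor_simps lower_central_closed flip: lcs_coset_mult)
qed

lemma one_lcs_factor: "\<one>\<^bsub>lcs_factor G n\<^esub> = lcs_coset (Suc n) \<one>"
  by (simp add: lcs_factor_simps lcs_coset_def coset_mult_one lower_central_subset)

lemma lcs_coset_pow:
  assumes "g \<in> lower_central G n"
  shows "lcs_coset (Suc n) g [^]\<^bsub>lcs_factor G n\<^esub> (p::nat) = lcs_coset (Suc n) (g [^] p)"
proof (induction p)
  case 0
  show ?case by (simp add: one_lcs_factor)
next
  case (Suc p)
  then show ?case
    using lower_central_closed[OF assms] by (simp add: lcs_factor_simps lcs_coset_mult)
qed

text \<open>All cosets in the defining union agree, because commutators respect congruence in both
  arguments.\<close>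

lemma factor_bracket_coset:
  assumes g: "g \<in> lower_central G i" and h: "h \<in> lower_central G j" and ij: "i \<ge> 1" "j \<ge> 1"
  shows "factor_bracket G i j (lcs_coset (Suc i) g) (lcs_coset (Suc j) h)
    = lcs_coset (Suc (i + j)) (commutator G g h)"
proof -
  have in_coset: "g' \<in> lower_central G k \<and> lcs_coset (Suc k) g' = lcs_coset (Suc k) g"
    if g: "g \<in> lower_central G k" and g': "g' \<in> lcs_coset (Suc k) g" for g g' k
  proof -
    obtain z where z: "z \<in> lower_central G (Suc k)" "g' = z \<otimes> g"
      using g' by (auto simp: lcs_coset_def r_coset_def)
    then have "z \<in> lower_central G k" using lower_central_Suc_subset by blast
    then show ?thesis
      using z g subgroup.m_closed[OF subgroup_lower_central]
      by (simp add: lcs_coset_mult_left lower_central_closed)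
  qed
  have "lower_central G (i + j + 1) #> commutator G g' h' = lcs_coset (Suc (i + j)) (commutator G g h)"
    if "g' \<in> lcs_coset (Suc i) g" "h' \<in> lcs_coset (Suc j) h" for g' h'
    using in_coset[OF g that(1)] in_coset[OF h that(2)]
      lcs_coset_commutator_cong[OF _ g _ h ij, of g' h'] by (simp add: lcs_coset_def)
  moreover have "g \<in> lcs_coset (Suc i) g" "h \<in> lcs_coset (Suc j) h"
    using rcos_self[OF _ subgroup_lower_central] lower_central_closed g h
    unfolding lcs_coset_def by blast+
  ultimately show ?thesis unfolding factor_bracket_def by blast
qed

lemma factor_bracket_closed:
  assumes "x \<in> carrier (lcs_factor G i)" "y \<in> carrier (lcs_factor G j)" "i \<ge> 1" "j \<ge> 1"
  shows "factor_bracket G i j x y \<in> carrier (lcs_factor G (i + j))"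
  using assms by (auto simp: lcs_factor_simps factor_bracket_coset commutator_lower_central)

lemma factor_bracket_mult_left:
  assumes "x \<in> carrier (lcs_factor G i)" "x' \<in> carrier (lcs_factor G i)"
    "y \<in> carrier (lcs_factor G j)" "i \<ge> 1" "j \<ge> 1"
  shows "factor_bracket G i j (x \<otimes>\<^bsub>lcs_factor G i\<^esub> x') y
    = factor_bracket G i j x y \<otimes>\<^bsub>lcs_factor G (i + j)\<^esub> factor_bracket G i j x' y"
proof -
  obtain g g' h where g: "x = lcs_coset (Suc i) g" "g \<in> lower_central G i"
    and g': "x' = lcs_coset (Suc i) g'" "g' \<in> lower_central G i"
    and h: "y = lcs_coset (Suc j) h" "h \<in> lower_central G j"
    using assms(1-3) by (auto simp: lcs_factor_simps)
  note carr = g(2)[THEN lower_central_closed] g'(2)[THEN lower_central_closed]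
    h(2)[THEN lower_central_closed]
  have "x \<otimes>\<^bsub>lcs_factor G i\<^esub> x' = lcs_coset (Suc i) (g \<otimes> g')"
    using g g' carr by (simp add: lcs_factor_simps lcs_coset_mult)
  then show ?thesis
    using g g' h carr assms(4,5) subgroup.m_closed[OF subgroup_lower_central g(2) g'(2)]
      lcs_coset_commutator_mult_left[OF g(2) g'(2) h(2) assms(4,5)]
    by (simp add: factor_bracket_coset lcs_factor_simps(3) flip: lcs_coset_mult)
qed

lemma factor_bracket_one:
  assumes "i \<ge> 1" "j \<ge> 1"
  shows "y \<in> carrier (lcs_factor G j) \<Longrightarrow>
      factor_bracket G i j \<one>\<^bsub>lcs_factor G i\<^esub> y = \<one>\<^bsub>lcs_factor G (i + j)\<^esub>"
    "x \<in> carrier (lcs_factor G i) \<Longrightarrow>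
      factor_bracket G i j x \<one>\<^bsub>lcs_factor G j\<^esub> = \<one>\<^bsub>lcs_factor G (i + j)\<^esub>"
  using assms subgroup.one_closed[OF subgroup_lower_central] lower_central_closed
  by (auto simp: one_lcs_factor lcs_factor_simps(1) factor_bracket_coset commutator_one)

lemma carrier_lcs_lie:
  "carrier gr = {x \<in> \<Pi>\<^sub>E i\<in>{1..}. carrier (lcs_factor G i).
     finite {i \<in> {1..}. x i \<noteq> \<one>\<^bsub>lcs_factor G i\<^esub>}}"
  by (simp add: lcs_lie_ring_def monoid.defs lie_ring.defs carrier_sum_group group_lcs_factor)

lemma lcs_lie_simps:
  "x \<otimes>\<^bsub>gr\<^esub> y = (\<lambda>i\<in>{1..}. x i \<otimes>\<^bsub>lcs_factor G i\<^esub> y i)"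
  "\<one>\<^bsub>gr\<^esub> = (\<lambda>i\<in>{1..}. \<one>\<^bsub>lcs_factor G i\<^esub>)"
  "bracket gr x y = (\<lambda>n\<in>{1..}. \<Otimes>\<^bsub>lcs_factor G n\<^esub>i\<in>{1..<n}.
     factor_bracket G i (n - i) (x i) (y (n - i)))"
  by (simp_all add: lcs_lie_ring_def monoid.defs lie_ring.defs)

lemma group_lcs_lie: "group gr"
proof -
  have "group (sum_group {1..} (lcs_factor G))" by (simp add: group_lcs_factor)
  then interpret S: group "sum_group {1..} (lcs_factor G)" .
  \<comment> \<open>\<open>gr\<close> is an extended record, so the group axioms are transferred
    field by field from the direct sum.\<close>
  have eqs: "carrier gr = carrier (sum_group {1..} (lcs_factor G))"
    "(\<otimes>\<^bsub>gr\<^esub>) = (\<otimes>\<^bsub>sum_group {1..} (lcs_factor G)\<^esub>)"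
    "\<one>\<^bsub>gr\<^esub> = \<one>\<^bsub>sum_group {1..} (lcs_factor G)\<^esub>"
    unfolding lcs_lie_ring_def by (simp_all only: monoid.defs lie_ring.defs) simp_all
  show ?thesis
    by (rule groupI) (simp_all only: eqs S.m_closed S.one_closed S.m_assoc S.l_one S.l_inv_ex)
qed

lemma lcs_lie_component:
  "x \<in> carrier gr \<Longrightarrow> i \<ge> 1 \<Longrightarrow> x i \<in> carrier (lcs_factor G i)"
  by (auto simp: carrier_lcs_lie)

lemma lcs_lie_eqI:
  assumes "x \<in> carrier gr" "y \<in> carrier gr" "\<And>i. i \<ge> 1 \<Longrightarrow> x i = y i"
  shows "x = y"
  using assms by (intro PiE_ext[of x "{1..}" _ y]) (auto simp: carrier_lcs_lie)

lemma group_hom_component: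
  "i \<ge> 1 \<Longrightarrow> group_hom gr (lcs_factor G i) (\<lambda>x. x i)"
  by (intro group_hom.intro group_hom_axioms.intro homI group_lcs_lie group_lcs_factor)
    (auto simp: lcs_lie_component lcs_lie_simps)

lemma comm_group_lcs_lie: "comm_group gr"
proof (rule group.group_comm_groupI[OF group_lcs_lie])
  fix x y assume xy: "x \<in> carrier gr" "y \<in> carrier gr"
  then have "x i \<otimes>\<^bsub>lcs_factor G i\<^esub> y i = y i \<otimes>\<^bsub>lcs_factor G i\<^esub> x i" if "i \<ge> 1" for i
    using comm_group_lcs_factor[OF that] that
    by (intro comm_monoid.m_comm[OF comm_group.axioms(1)] lcs_lie_component)
  then show "x \<otimes>\<^bsub>gr\<^esub> y = y \<otimes>\<^bsub>gr\<^esub> x" 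
    by (auto simp: lcs_lie_simps(1) intro!: restrict_ext)
qed

lemma bracket_summand_closed:
  assumes "x \<in> carrier gr" "y \<in> carrier gr"
  shows "(\<lambda>i. factor_bracket G i (n - i) (x i) (y (n - i))) \<in> {1..<n} \<rightarrow> carrier (lcs_factor G n)"
proof
  fix i assume i: "i \<in> {1..<n}"
  then have "factor_bracket G i (n - i) (x i) (y (n - i)) \<in> carrier (lcs_factor G (i + (n - i)))"
    using assms by (intro factor_bracket_closed lcs_lie_component) auto
  then show "factor_bracket G i (n - i) (x i) (y (n - i)) \<in> carrier (lcs_factor G n)"
    using i by simp
qed

lemma factor_bracket_eq_one:
  assumes "x \<in> carrier gr" "y \<in> carrier gr" "i \<in> {1..<n}"
    "x i = \<one>\<^bsub>lcs_factor G i\<^esub> \<or> y (n - i) = \<one>\<^bsub>lcs_factor G (n - i)\<^esub>"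
  shows "factor_bracket G i (n - i) (x i) (y (n - i)) = \<one>\<^bsub>lcs_factor G n\<^esub>"
  using factor_bracket_one[of i "n - i"] lcs_lie_component[OF assms(1), of i]
    lcs_lie_component[OF assms(2), of "n - i"] assms(3,4) by fastforce

lemma bracket_component_one:
  assumes "x \<in> carrier gr" "y \<in> carrier gr" "n \<ge> 1"
    and "\<And>i. i \<in> {1..<n} \<Longrightarrow> x i = \<one>\<^bsub>lcs_factor G i\<^esub> \<or> y (n - i) = \<one>\<^bsub>lcs_factor G (n - i)\<^esub>"
  shows "bracket gr x y n = \<one>\<^bsub>lcs_factor G n\<^esub>"
proof -
  interpret Q: comm_group "lcs_factor G n" using assms(3) by (rule comm_group_lcs_factor)
  show ?thesis
    using assms factor_bracket_eq_one[OF assms(1,2)] by (auto simp: lcs_lie_simps intro!: Q.finprod_one_eqI)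
qed

lemma bracket_closed:
  assumes xy: "x \<in> carrier gr" "y \<in> carrier gr"
  shows "bracket gr x y \<in> carrier gr"
proof -
  have "bracket gr x y n \<in> carrier (lcs_factor G n)" if "n \<ge> 1" for n
  proof -
    interpret Q: comm_group "lcs_factor G n" using that by (rule comm_group_lcs_factor)
    show ?thesis
      using that Q.finprod_closed[OF bracket_summand_closed[OF xy]] by (simp add: lcs_lie_simps)
  qed
  moreover have "finite {n \<in> {1..}. bracket gr x y n \<noteq> \<one>\<^bsub>lcs_factor G n\<^esub>}"
  proof -
    have "\<exists>b. \<forall>i\<ge>1. z i \<noteq> \<one>\<^bsub>lcs_factor G i\<^esub> \<longrightarrow> i < b" if "z \<in> carrier gr" for z
      using that finite_nat_set_iff_bounded[of "{i \<in> {1..}. z i \<noteq> \<one>\<^bsub>lcs_factor G i\<^esub>}"]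
      by (auto simp: carrier_lcs_lie)
    then obtain b c where b: "\<And>i. i \<ge> 1 \<Longrightarrow> x i \<noteq> \<one>\<^bsub>lcs_factor G i\<^esub> \<Longrightarrow> i < b"
      and c: "\<And>i. i \<ge> 1 \<Longrightarrow> y i \<noteq> \<one>\<^bsub>lcs_factor G i\<^esub> \<Longrightarrow> i < c"
      using xy by meson
    \<comment> \<open>With supports below \<open>b\<close> and \<open>c\<close>, each summand of
      degree at least \<open>b + c\<close> has a trivial argument.\<close>
    have "bracket gr x y n = \<one>\<^bsub>lcs_factor G n\<^esub>" if n: "n \<ge> 1" "n \<ge> b + c" for n
    proof (rule bracket_component_one[OF xy n(1)])
      fix i assume i: "i \<in> {1..<n}"
      show "x i = \<one>\<^bsub>lcs_factor G i\<^esub> \<or> y (n - i) = \<one>\<^bsub>lcs_factor G (n - i)\<^esub>"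
        using b[of i] c[of "n - i"] i n(2) by fastforce
    qed
    then have "{n \<in> {1..}. bracket gr x y n \<noteq> \<one>\<^bsub>lcs_factor G n\<^esub>} \<subseteq> {..b + c}"
      using nat_le_linear by auto
    then show ?thesis by (rule finite_subset) simp
  qed
  moreover have "bracket gr x y \<in> extensional {1..}" by (simp add: lcs_lie_simps)
  ultimately show ?thesis by (auto simp: carrier_lcs_lie PiE_iff)
qed

lemma bracket_mult_left:
  assumes "x \<in> carrier gr" "x' \<in> carrier gr" "y \<in> carrier gr"
  shows "bracket gr (x \<otimes>\<^bsub>gr\<^esub> x') y
    = bracket gr x y \<otimes>\<^bsub>gr\<^esub> bracket gr x' y"
proof -
  interpret L: group gr by (rule group_lcs_lie)
  have "bracket gr (x \<otimes>\<^bsub>gr\<^esub> x') y n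
      = bracket gr x y n \<otimes>\<^bsub>lcs_factor G n\<^esub> bracket gr x' y n" if n: "n \<ge> 1" for n
  proof -
    interpret Q: comm_group "lcs_factor G n" using n by (rule comm_group_lcs_factor)
    have "factor_bracket G i (n - i) ((x \<otimes>\<^bsub>gr\<^esub> x') i) (y (n - i))
        = factor_bracket G i (n - i) (x i) (y (n - i))
          \<otimes>\<^bsub>lcs_factor G n\<^esub> factor_bracket G i (n - i) (x' i) (y (n - i))" if i: "i \<in> {1..<n}" for i
    proof -
      have "i \<ge> 1" "n - i \<ge> 1" "i + (n - i) = n" using i by auto
      then show ?thesis
        using factor_bracket_mult_left[of "x i" i "x' i" "y (n - i)" "n - i"] assms
        by (simp add: lcs_lie_component lcs_lie_simps(1))
    qed
    then have "(\<Otimes>\<^bsub>lcs_factor G n\<^esub>i\<in>{1..<n}.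
          factor_bracket G i (n - i) ((x \<otimes>\<^bsub>gr\<^esub> x') i) (y (n - i)))
        = (\<Otimes>\<^bsub>lcs_factor G n\<^esub>i\<in>{1..<n}. factor_bracket G i (n - i) (x i) (y (n - i))
          \<otimes>\<^bsub>lcs_factor G n\<^esub> factor_bracket G i (n - i) (x' i) (y (n - i)))"
      using bracket_summand_closed[OF assms(1,3), of n] bracket_summand_closed[OF assms(2,3), of n]
      by (intro Q.finprod_cong') auto
    also have "\<dots> = (\<Otimes>\<^bsub>lcs_factor G n\<^esub>i\<in>{1..<n}. factor_bracket G i (n - i) (x i) (y (n - i)))
        \<otimes>\<^bsub>lcs_factor G n\<^esub>
        (\<Otimes>\<^bsub>lcs_factor G n\<^esub>i\<in>{1..<n}. factor_bracket G i (n - i) (x' i) (y (n - i)))"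
      by (intro Q.finprod_multf bracket_summand_closed assms)
    finally show ?thesis using n by (simp add: lcs_lie_simps(3))
  qed
  then show ?thesis
    using assms by (intro lcs_lie_eqI bracket_closed L.m_closed) (auto simp: lcs_lie_simps(1))
qed

lemma bracket_pow_left:
  assumes "x \<in> carrier gr" "y \<in> carrier gr"
  shows "bracket gr (x [^]\<^bsub>gr\<^esub> (p::nat)) y = bracket gr x y [^]\<^bsub>gr\<^esub> p"
proof -
  interpret L: group gr by (rule group_lcs_lie)
  show ?thesis
  proof (induction p)
    case 0
    have "bracket gr \<one>\<^bsub>gr\<^esub> y n = \<one>\<^bsub>gr\<^esub> n" if "n \<ge> 1" for n
      using bracket_component_one[OF L.one_closed assms(2) that] that by (simp add: lcs_lie_simps(2))
    then show ?case using assms by (auto intro!: lcs_lie_eqI bracket_closed)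
  next
    case (Suc p)
    then show ?case using assms by (simp add: bracket_mult_left)
  qed
qed

definition degree_one :: "'a \<Rightarrow> nat \<Rightarrow> 'a set" where
  "degree_one g = (\<lambda>i\<in>{1..}. if i = 1 then lcs_coset 2 g else \<one>\<^bsub>lcs_factor G i\<^esub>)"

lemma degree_one_closed:
  assumes "g \<in> carrier G"
  shows "degree_one g \<in> carrier gr"
proof -
  have "lcs_coset 2 g \<in> carrier (lcs_factor G 1)"
    using assms by (auto simp: lcs_factor_simps numeral_2_eq_2)
  moreover have "finite {i \<in> {1..}. degree_one g i \<noteq> \<one>\<^bsub>lcs_factor G i\<^esub>}"
    by (rule finite_subset[of _ "{1}"]) (auto simp: degree_one_def)
  ultimately show ?thesis
    using group.is_monoid[OF group_lcs_factor, THEN monoid.one_closed]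
    by (auto simp: carrier_lcs_lie degree_one_def)
qed

text \<open>Only the summand \<open>i = n\<close> survives against an element of degree 1, so this
  bracket isolates the \<open>n\<close>th component of an arbitrary \<open>x\<close> and reduces
  central elements to homogeneous ones.\<close>

lemma bracket_degree_one:
  assumes x: "x \<in> carrier gr" and n: "n \<ge> 1" and g: "g \<in> lower_central G n" "x n = lcs_coset (Suc n) g"
    and y: "y \<in> carrier G"
  shows "bracket gr x (degree_one y) (Suc n) = lcs_coset (Suc (Suc n)) (commutator G g y)"
proof -
  interpret Q: comm_group "lcs_factor G (Suc n)" by (rule comm_group_lcs_factor) simp
  define f where "f i = factor_bracket G i (Suc n - i) (x i) (degree_one y (Suc n - i))" for i
  have closed: "f \<in> {1..<Suc n} \<rightarrow> carrier (lcs_factor G (Suc n))"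
    unfolding f_def by (rule bracket_summand_closed[OF x degree_one_closed[OF y]])
  have one: "f i = \<one>\<^bsub>lcs_factor G (Suc n)\<^esub>" if "i \<in> {1..<Suc n}" "i \<noteq> n" for i
    unfolding f_def
    using that by (intro factor_bracket_eq_one[OF x degree_one_closed[OF y]]) (auto simp: degree_one_def)
  have "finprod (lcs_factor G (Suc n)) f {1..<Suc n}
      = (\<Otimes>\<^bsub>lcs_factor G (Suc n)\<^esub>i\<in>{1..<Suc n}. if i = n then f i else \<one>\<^bsub>lcs_factor G (Suc n)\<^esub>)"
    using one closed by (intro Q.finprod_cong') auto
  also have "\<dots> = f n"
    using n closed by (intro Q.finprod_singleton_swap) auto
  also have "\<dots> = factor_bracket G n 1 (lcs_coset (Suc n) g) (lcs_coset (Suc 1) y)"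
    using g(2) by (simp add: f_def degree_one_def numeral_2_eq_2)
  also have "\<dots> = lcs_coset (Suc (n + 1)) (commutator G g y)"
    using g n y by (intro factor_bracket_coset) auto
  finally have "finprod (lcs_factor G (Suc n)) f {1..<Suc n} = lcs_coset (Suc (Suc n)) (commutator G g y)"
    by simp
  moreover have "(\<lambda>i. factor_bracket G i (Suc n - i) (x i) (degree_one y (Suc n - i))) = f"
    by (simp add: fun_eq_iff f_def)
  ultimately show ?thesis by (simp only: lcs_lie_simps(3) restrict_apply) simp
qed

lemma subgroup_multiples: "subgroup (multiples p gr) gr"
proof -
  interpret L: comm_group gr by (rule comm_group_lcs_lie)
  show ?thesis
  proof
    show "multiples p gr \<subseteq> carrier gr" by (auto simp: multiples_def)
    have "\<one>\<^bsub>gr\<^esub> = \<one>\<^bsub>gr\<^esub> [^]\<^bsub>gr\<^esub> p" by simp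
    then show "\<one>\<^bsub>gr\<^esub> \<in> multiples p gr" unfolding multiples_def by blast
    fix x assume "x \<in> multiples p gr"
    then obtain u where u: "x = u [^]\<^bsub>gr\<^esub> p" "u \<in> carrier gr" by (auto simp: multiples_def)
    have "inv\<^bsub>gr\<^esub> x = (inv\<^bsub>gr\<^esub> u) [^]\<^bsub>gr\<^esub> p" using u by (simp add: L.nat_pow_inv)
    then show "inv\<^bsub>gr\<^esub> x \<in> multiples p gr" using u unfolding multiples_def by blast
    fix y assume "y \<in> multiples p gr"
    then obtain v where v: "y = v [^]\<^bsub>gr\<^esub> p" "v \<in> carrier gr" by (auto simp: multiples_def)
    have "x \<otimes>\<^bsub>gr\<^esub> y = (u \<otimes>\<^bsub>gr\<^esub> v) [^]\<^bsub>gr\<^esub> p"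
      using u v by (simp add: L.pow_mult_distrib L.m_comm)
    then show "x \<otimes>\<^bsub>gr\<^esub> y \<in> multiples p gr" using u v unfolding multiples_def by blast
  qed
qed

lemma subgroup_lcs_degree_ge: "subgroup (lcs_degree_ge G c) gr"
proof -
  interpret L: group gr by (rule group_lcs_lie)
  have Q: "group (lcs_factor G i)" for i by (rule group_lcs_factor)
  show ?thesis
  proof
    show "lcs_degree_ge G c \<subseteq> carrier gr" by (auto simp: lcs_degree_ge_def)
    show "\<one>\<^bsub>gr\<^esub> \<in> lcs_degree_ge G c"
      using L.one_closed by (simp add: lcs_degree_ge_def lcs_lie_simps(2))
    fix x assume x: "x \<in> lcs_degree_ge G c"
    then show "inv\<^bsub>gr\<^esub> x \<in> lcs_degree_ge G c"
      using group_hom.hom_inv[OF group_hom_component] group.is_monoid[OF Q, THEN monoid.inv_one]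
      by (simp add: lcs_degree_ge_def)
    fix y assume "y \<in> lcs_degree_ge G c"
    with x show "x \<otimes>\<^bsub>gr\<^esub> y \<in> lcs_degree_ge G c"
      using L.m_closed group.is_monoid[OF Q, THEN monoid.l_one]
        group.is_monoid[OF Q, THEN monoid.one_closed]
      by (simp add: lcs_degree_ge_def lcs_lie_simps(1))
  qed
qed

text \<open>For \<open>p = 0\<close> the powers are trivial, and the property says that an element of \<open>\<gamma>\<^sub>n\<close> whose brackets
  with the group lie in \<open>\<gamma>\<^bsub>n+2\<^esub>\<close> belongs to \<open>\<gamma>\<^bsub>n+1\<^esub>\<close>.\<close>

definition pure_commutators :: "nat \<Rightarrow> bool" where
  "pure_commutators p \<longleftrightarrow> (\<forall>n\<ge>1. \<forall>g\<in>lower_central G n.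
     (\<forall>y\<in>carrier G. \<exists>h\<in>lower_central G (Suc n).
        lcs_coset (Suc (Suc n)) (commutator G g y) = lcs_coset (Suc (Suc n)) (h [^] p)) \<longrightarrow>
     (\<exists>h\<in>lower_central G n. lcs_coset (Suc n) g = lcs_coset (Suc n) (h [^] p)))"

section \<open>Reduction of the centres to single components\<close>

lemma component_divisible:
  assumes pure: "pure_commutators p" and x: "x \<in> carrier gr" and n: "n \<ge> 1"
    and br: "\<And>y. y \<in> carrier G \<Longrightarrow> \<exists>z\<in>carrier (lcs_factor G (Suc n)).
      bracket gr x (degree_one y) (Suc n) = z [^]\<^bsub>lcs_factor G (Suc n)\<^esub> p"
  shows "\<exists>z\<in>carrier (lcs_factor G n). x n = z [^]\<^bsub>lcs_factor G n\<^esub> p"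
proof -
  obtain g where g: "g \<in> lower_central G n" "x n = lcs_coset (Suc n) g"
    using lcs_lie_component[OF x n] by (auto simp: lcs_factor_simps(1))
  have "\<exists>h\<in>lower_central G (Suc n).
      lcs_coset (Suc (Suc n)) (commutator G g y) = lcs_coset (Suc (Suc n)) (h [^] p)"
    if y: "y \<in> carrier G" for y
    using br[OF y] bracket_degree_one[OF x n g y] lcs_coset_pow by (auto simp: lcs_factor_simps(1))
  then obtain h where "h \<in> lower_central G n" "lcs_coset (Suc n) g = lcs_coset (Suc n) (h [^] p)"
    using pure n g(1) unfolding pure_commutators_def by blast
  then show ?thesis
    using g(2) by (intro bexI[of _ "lcs_coset (Suc n) h"]) (auto simp: lcs_coset_pow lcs_factor_simps(1))
qed

text \<open>Only the component of degree \<open>n + 1\<close> of the brackets is assumed trivial, as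
  this is what the truncated quotient provides for \<open>n < c\<close>.\<close>

lemma component_one:
  assumes pure: "pure_commutators 0" and x: "x \<in> carrier gr" and n: "n \<ge> 1"
    and br: "\<And>y. y \<in> carrier gr \<Longrightarrow>
      bracket gr x y (Suc n) = \<one>\<^bsub>lcs_factor G (Suc n)\<^esub>"
  shows "x n = \<one>\<^bsub>lcs_factor G n\<^esub>"
proof -
  have "\<one>\<^bsub>lcs_factor G (Suc n)\<^esub> \<in> carrier (lcs_factor G (Suc n))"
    by (rule monoid.one_closed[OF group.is_monoid[OF group_lcs_factor]])
  then show ?thesis
    using component_divisible[OF pure x n] br[OF degree_one_closed] by auto
qed

lemma lie_centre_lcs_lie:
  assumes pure: "pure_commutators 0"
  shows "lie_centre gr = {\<one>\<^bsub>gr\<^esub>}"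
proof -
  interpret L: group gr by (rule group_lcs_lie)
  have "x = \<one>\<^bsub>gr\<^esub>" if "x \<in> lie_centre gr" for x
  proof -
    have x: "x \<in> carrier gr" "\<And>y. y \<in> carrier gr \<Longrightarrow> bracket gr x y = \<one>\<^bsub>gr\<^esub>"
      using that by (auto simp: lie_centre_def)
    have "x n = \<one>\<^bsub>lcs_factor G n\<^esub>" if "n \<ge> 1" for n
      using component_one[OF pure x(1) that] x(2) by (simp add: lcs_lie_simps(2))
    then show ?thesis
      by (intro lcs_lie_eqI[OF x(1) L.one_closed]) (simp add: lcs_lie_simps(2))
  qed
  moreover have "\<one>\<^bsub>gr\<^esub> \<in> lie_centre gr"
    using bracket_pow_left[of "\<one>\<^bsub>gr\<^esub>" _ 0] by (simp add: lie_centre_def)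
  ultimately show ?thesis by blast
qed

lemma lie_centre_mod_multiples:
  assumes pure: "pure_commutators p"
  shows "lie_centre (lie_quotient gr (multiples p gr))
    = {\<one>\<^bsub>lie_quotient gr (multiples p gr)\<^esub>}"
proof -
  interpret L: comm_group gr by (rule comm_group_lcs_lie)
  let ?I = "multiples p gr"
  note I = subgroup_multiples[of p]
  have one: "\<one>\<^bsub>lie_quotient gr ?I\<^esub> = ?I"
    by (simp add: lie_quotient_def monoid.defs lie_ring.defs FactGroup_def)
  have trivial: "C = ?I" if C: "C \<in> rcosets\<^bsub>gr\<^esub> ?I" "\<forall>a\<in>C. \<forall>b\<in>carrier gr. bracket gr a b \<in> ?I" for C
  proof -
    obtain a where a: "a \<in> carrier gr" "C = ?I #>\<^bsub>gr\<^esub> a" using C(1) by (auto simp: RCOSETS_def)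
    then have "a \<in> C" using L.rcos_self[OF _ I] by simp
    then have br: "bracket gr a b \<in> ?I" if "b \<in> carrier gr" for b using C(2) that by blast
    have "\<exists>z\<in>carrier (lcs_factor G n). a n = z [^]\<^bsub>lcs_factor G n\<^esub> p" if n: "n \<ge> 1" for n
    proof (rule component_divisible[OF pure a(1) n])
      fix y assume "y \<in> carrier G"
      then obtain u where u: "u \<in> carrier gr" "bracket gr a (degree_one y) = u [^]\<^bsub>gr\<^esub> p"
        using br[OF degree_one_closed] by (auto simp: multiples_def)
      then have "bracket gr a (degree_one y) (Suc n) = u (Suc n) [^]\<^bsub>lcs_factor G (Suc n)\<^esub> p"
        using group_hom.hom_nat_pow[OF group_hom_component, of "Suc n" u p] by simp
      then show "\<exists>z\<in>carrier (lcs_factor G (Suc n)).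
          bracket gr a (degree_one y) (Suc n) = z [^]\<^bsub>lcs_factor G (Suc n)\<^esub> p"
        using lcs_lie_component[OF u(1)] by auto
    qed
    then obtain z where z: "\<And>n. n \<ge> 1 \<Longrightarrow> z n \<in> carrier (lcs_factor G n)"
      "\<And>n. n \<ge> 1 \<Longrightarrow> a n = z n [^]\<^bsub>lcs_factor G n\<^esub> p"
      by metis
    \<comment> \<open>The chosen roots of trivial components might be nontrivial in infinitely many
      degrees, so they are replaced by the identity to keep the support finite.\<close>
    define u where "u = (\<lambda>n\<in>{1..}. if a n = \<one>\<^bsub>lcs_factor G n\<^esub> then \<one>\<^bsub>lcs_factor G n\<^esub> else z n)"
    have Q: "monoid (lcs_factor G n)" for n by (rule group.is_monoid[OF group_lcs_factor])
    have "finite {n \<in> {1..}. u n \<noteq> \<one>\<^bsub>lcs_factor G n\<^esub>}"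
      by (rule finite_subset[of _ "{n \<in> {1..}. a n \<noteq> \<one>\<^bsub>lcs_factor G n\<^esub>}"])
        (use a(1) in \<open>auto simp: carrier_lcs_lie u_def\<close>)
    then have u: "u \<in> carrier gr"
      using z(1) monoid.one_closed[OF Q] by (auto simp: carrier_lcs_lie u_def)
    have "a = u [^]\<^bsub>gr\<^esub> p"
    proof (rule lcs_lie_eqI[OF a(1)])
      fix n :: nat assume n: "n \<ge> 1"
      have "(u [^]\<^bsub>gr\<^esub> p) n = u n [^]\<^bsub>lcs_factor G n\<^esub> p"
        using group_hom.hom_nat_pow[OF group_hom_component[OF n] u] by simp
      then show "a n = (u [^]\<^bsub>gr\<^esub> p) n"
        using n z(2) monoid.nat_pow_one[OF Q] by (simp add: u_def)
    qed (use u in simp)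
    then have "a \<in> ?I" using u by (auto simp: multiples_def)
    then show ?thesis using a L.coset_join2[OF _ I] by simp
  qed
  have coset: "?I \<in> rcosets\<^bsub>gr\<^esub> ?I"
    by (rule subgroup.subgroup_in_rcosets[OF I L.is_group])
  have central: "bracket gr a b \<in> ?I" if ab: "a \<in> ?I" "b \<in> carrier gr" for a b
  proof -
    obtain u where u: "a = u [^]\<^bsub>gr\<^esub> p" "u \<in> carrier gr"
      using ab(1) by (auto simp: multiples_def)
    then show ?thesis
      using bracket_pow_left[OF u(2) ab(2)] bracket_closed[OF u(2) ab(2)] by (auto simp: multiples_def)
  qed
  have eq: "lie_centre (lie_quotient gr ?I)
      = {C \<in> rcosets\<^bsub>gr\<^esub> ?I. \<forall>a\<in>C. \<forall>b\<in>carrier gr. bracket gr a b \<in> ?I}"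
    by (rule lie_centre_quotient[OF group_lcs_lie I]) (rule bracket_closed)
  have "C \<in> lie_centre (lie_quotient gr ?I) \<longleftrightarrow> C = ?I" for C
    unfolding eq mem_Collect_eq
    using trivial coset central by metis
  then show ?thesis unfolding one by blast
qed

lemma lie_centre_mod_degree_ge:
  assumes pure: "pure_commutators 0" and c: "c > 0"
  shows "lie_centre (lie_quotient gr (lcs_degree_ge G (c + 1)))
    = (\<lambda>x. lcs_degree_ge G (c + 1) #>\<^bsub>gr\<^esub> x) ` lcs_degree G c"
proof -
  interpret L: comm_group gr by (rule comm_group_lcs_lie)
  let ?I = "lcs_degree_ge G (c + 1)"
  note I = subgroup_lcs_degree_ge[of "c + 1"]
  have Q: "monoid (lcs_factor G n)" for n by (rule group.is_monoid[OF group_lcs_factor])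
  have in_image: "C \<in> (\<lambda>x. ?I #>\<^bsub>gr\<^esub> x) ` lcs_degree G c"
    if C: "C \<in> rcosets\<^bsub>gr\<^esub> ?I" "\<forall>a\<in>C. \<forall>b\<in>carrier gr. bracket gr a b \<in> ?I" for C
  proof -
    obtain a where a: "a \<in> carrier gr" "C = ?I #>\<^bsub>gr\<^esub> a" using C(1) by (auto simp: RCOSETS_def)
    then have "a \<in> C" using L.rcos_self[OF _ I] by simp
    then have br: "bracket gr a b \<in> ?I" if "b \<in> carrier gr" for b using C(2) that by blast
    \<comment> \<open>For \<open>n < c\<close> the degree \<open>n + 1\<close> still lies below
      \<open>c + 1\<close>, where membership in the ideal forces the brackets to vanish.\<close>
    have low: "a n = \<one>\<^bsub>lcs_factor G n\<^esub>" if "n \<ge> 1" "n < c" for n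
      using component_one[OF pure a(1) that(1)] br that(2) by (simp add: lcs_degree_ge_def)
    \<comment> \<open>\<open>a\<close> is split into its component of degree \<open>c\<close> and
      the part \<open>r\<close> of higher degree; by \<open>low\<close> nothing is left
      below.\<close>
    define x where "x = (\<lambda>n\<in>{1..}. if n = c then a n else \<one>\<^bsub>lcs_factor G n\<^esub>)"
    define r where "r = (\<lambda>n\<in>{1..}. if n \<le> c then \<one>\<^bsub>lcs_factor G n\<^esub> else a n)"
    have "finite {n \<in> {1..}. x n \<noteq> \<one>\<^bsub>lcs_factor G n\<^esub>}"
      "finite {n \<in> {1..}. r n \<noteq> \<one>\<^bsub>lcs_factor G n\<^esub>}"
      by (rule finite_subset[of _ "{n \<in> {1..}. a n \<noteq> \<one>\<^bsub>lcs_factor G n\<^esub>}"];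
          use a(1) in \<open>auto simp: carrier_lcs_lie x_def r_def\<close>)+
    then have xr: "x \<in> carrier gr" "r \<in> carrier gr"
      using lcs_lie_component[OF a(1)] monoid.one_closed[OF Q]
      by (auto simp: carrier_lcs_lie x_def r_def)
    have x: "x \<in> lcs_degree G c" using xr(1) by (auto simp: lcs_degree_def x_def)
    have r: "r \<in> ?I" using xr(2) by (auto simp: lcs_degree_ge_def r_def)
    have "a = r \<otimes>\<^bsub>gr\<^esub> x"
    proof (rule lcs_lie_eqI[OF a(1) L.m_closed[OF xr(2,1)]])
      fix n :: nat assume n: "n \<ge> 1"
      have "a n \<in> carrier (lcs_factor G n)" using lcs_lie_component[OF a(1) n] .
      then show "a n = (r \<otimes>\<^bsub>gr\<^esub> x) n"
        using n low[OF n] monoid.l_one[OF Q] monoid.r_one[OF Q] monoid.one_closed[OF Q]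
        by (cases n c rule: linorder_cases) (simp_all add: lcs_lie_simps(1) x_def r_def)
    qed
    then have "a \<in> ?I #>\<^bsub>gr\<^esub> x" using r by (auto simp: r_coset_def)
    then have "C = ?I #>\<^bsub>gr\<^esub> x"
      unfolding a(2) using L.repr_independence[OF _ xr(1) I] by simp
    then show ?thesis using x by blast
  qed
  have coset: "?I #>\<^bsub>gr\<^esub> x \<in> rcosets\<^bsub>gr\<^esub> ?I" if "x \<in> lcs_degree G c" for x
    using that by (auto simp: RCOSETS_def lcs_degree_def)
  have central: "bracket gr a b \<in> ?I"
    if x: "x \<in> lcs_degree G c" and a: "a \<in> ?I #>\<^bsub>gr\<^esub> x" and b: "b \<in> carrier gr" for x a b
  proof -
    obtain r where r: "r \<in> ?I" "a = r \<otimes>\<^bsub>gr\<^esub> x" using a by (auto simp: r_coset_def)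
    have carr: "r \<in> carrier gr" "x \<in> carrier gr"
      using r x by (auto simp: lcs_degree_ge_def lcs_degree_def)
    then have ac: "a \<in> carrier gr" using r by simp
    have "a n = \<one>\<^bsub>lcs_factor G n\<^esub>" if "n \<ge> 1" "n < c" for n
      using r x that monoid.l_one[OF Q monoid.one_closed[OF Q]]
      by (simp add: lcs_lie_simps(1) lcs_degree_ge_def lcs_degree_def)
    \<comment> \<open>In degree at most \<open>c\<close>, a summand pairs a component of
      \<open>b\<close> of degree at least 1 with a component of \<open>a\<close> of degree below
      \<open>c\<close>.\<close>
    then have "bracket gr a b n = \<one>\<^bsub>lcs_factor G n\<^esub>" if "n \<ge> 1" "n < c + 1" for n
      using that by (intro bracket_component_one[OF ac b]) auto
    then show ?thesis using bracket_closed[OF ac b] by (simp add: lcs_degree_ge_def)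
  qed
  have eq: "lie_centre (lie_quotient gr ?I)
      = {C \<in> rcosets\<^bsub>gr\<^esub> ?I. \<forall>a\<in>C. \<forall>b\<in>carrier gr. bracket gr a b \<in> ?I}"
    by (rule lie_centre_quotient[OF group_lcs_lie I]) (rule bracket_closed)
  have "C \<in> lie_centre (lie_quotient gr ?I) \<longleftrightarrow> C \<in> (\<lambda>x. ?I #>\<^bsub>gr\<^esub> x) ` lcs_degree G c" for C
    unfolding eq mem_Collect_eq
  proof
    assume "C \<in> rcosets\<^bsub>gr\<^esub> ?I \<and> (\<forall>a\<in>C. \<forall>b\<in>carrier gr. bracket gr a b \<in> ?I)"
    then show "C \<in> (\<lambda>x. ?I #>\<^bsub>gr\<^esub> x) ` lcs_degree G c" using in_image by simp
  next
    assume "C \<in> (\<lambda>x. ?I #>\<^bsub>gr\<^esub> x) ` lcs_degree G c"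
    then show "C \<in> rcosets\<^bsub>gr\<^esub> ?I \<and> (\<forall>a\<in>C. \<forall>b\<in>carrier gr. bracket gr a b \<in> ?I)"
      using coset central by auto
  qed
  then show ?thesis by (rule Set.set_eqI)
qed

end

theorem theorem3p11:
  fixes \<Gamma> :: "'v pair_pre_digraph" and p c :: nat
  defines "L \<equiv> lcs_lie_ring (raag \<Gamma>)"
  assumes "pair_graph \<Gamma>"
    and "group_centre (raag \<Gamma>) = {\<one>\<^bsub>raag \<Gamma>\<^esub>}"
    and "p > 0" and "c > 0"
  shows "lie_centre L = {\<one>\<^bsub>L\<^esub>}
    \<and> lie_centre (lie_quotient L (multiples p L)) = {\<one>\<^bsub>lie_quotient L (multiples p L)\<^esub>}
    \<and> lie_centre (lie_quotient L (lcs_degree_ge (raag \<Gamma>) (c + 1)))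
        = (\<lambda>x. lcs_degree_ge (raag \<Gamma>) (c + 1) #>\<^bsub>L\<^esub> x) ` lcs_degree (raag \<Gamma>) c"
proof -
  interpret P: pair_graph \<Gamma> by fact
  obtain idx :: "'v \<Rightarrow> nat" where idx: "inj_on idx (pverts \<Gamma>)"
    using finite_imp_inj_to_nat_seg[OF P.pair_finite_verts] by blast
  interpret \<Gamma>: indexed_graph \<Gamma> idx
  proof
    show "(v, w) \<in> parcs \<Gamma> \<Longrightarrow> v \<in> pverts \<Gamma> \<and> w \<in> pverts \<Gamma>" for v w
      using P.in_arcsD1 P.in_arcsD2 by blast
    show "(v, w) \<in> parcs \<Gamma> \<Longrightarrow> (w, v) \<in> parcs \<Gamma>" for v w
      using P.pair_sym_arcs by (auto simp: symmetric_def dest: symD)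
    show "(v, v) \<notin> parcs \<Gamma>" for v using P.pair_no_loops by fastforce
  qed (use P.pair_finite_verts idx in auto)
  \<comment> \<open>The case \<open>q = 0\<close> serves the centres of \<open>L\<close> and of its
    truncation, the case \<open>q = p\<close> that of \<open>L\<close> modulo
    \<open>p\<close>.\<close>
  have pure: "\<Gamma>.pure_commutators q" for q
    unfolding \<Gamma>.pure_commutators_def
  proof (intro allI impI ballI)
    fix n g
    assume n: "1 \<le> n" and g: "g \<in> lower_central (raag \<Gamma>) n"
      and br: "\<forall>y\<in>carrier (raag \<Gamma>). \<exists>h\<in>lower_central (raag \<Gamma>) (Suc n).
        \<Gamma>.lcs_coset (Suc (Suc n)) (commutator (raag \<Gamma>) g y)
          = \<Gamma>.lcs_coset (Suc (Suc n)) (h [^]\<^bsub>raag \<Gamma>\<^esub> q)"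
    show "\<exists>h\<in>lower_central (raag \<Gamma>) n. \<Gamma>.lcs_coset (Suc n) g = \<Gamma>.lcs_coset (Suc n) (h [^]\<^bsub>raag \<Gamma>\<^esub> q)"
      using \<Gamma>.e_closed br
      by (intro \<Gamma>.lcs_divisible[OF \<Gamma>.centreless_not_dominating[OF assms(3)] n g]) auto
  qed
  show ?thesis
    unfolding L_def
    by (intro conjI \<Gamma>.lie_centre_lcs_lie[OF pure] \<Gamma>.lie_centre_mod_multiples[OF pure]
      \<Gamma>.lie_centre_mod_degree_ge[OF pure assms(5)])
qed

end
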